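(* Let $\mathcal{T}_h$ and $\mathcal{T}_H$ be nested conforming triangulations ($\mathcal{T}_h$ a refinement of $\mathcal{T}_H$) and let $f\in L^2\Lambda^n(\Omega)$. Let $(\tilde u_h,\tilde\sigma_h,\tilde p_h)=\mathcal{L}_h^{-1}f_{\mathfrak{B}_H}$ and $(u_h,\sigma_h,p_h)=\mathcal{L}_h^{-1}f_{\mathfrak{B}_h}$. Then there exists a constant $C$ such that $$\|\sigma_h-\tilde\sigma_h\|\le C\,\mathrm{osc}(f_{\mathfrak{B}_h},\mathcal{T}_H).$$
   Context: Let $\Omega\subset\mathbb{R}^n$ ($n\ge2$) be a bounded Lipschitz polyhedral domain. Notation for forms: - $L^2\Lambda^j(\Omega)$ is the space of square-integrable $j$-forms, with inner product $\langle\cdot,\cdot\rangle$, norm $\|\cdot\|$, and $\|\cdot\|_T$ on $T$. - $d$ is the exterior derivative, and $H\Lambda^j(\Omega)=\{\omega\in L^2\Lambda^j: d\omega\in L^2\Lambda^{j+1}\}$. Discrete spaces: for a conforming shape-regular simplicial triangulation $\mathcal{T}_h$, $\Lambda^{n-1}_h\subset H\Lambda^{n-1}$ and $\Lambda^n_h\subset L^2\Lambda^n$ are Arnold–Falk–Winther finite element spaces (from $\mathcal{P}_r\Lambda$, $\mathcal{P}_r^-\Lambda$) with $d\Lambda^{n-1}_h\subset\Lambda^n_h$, nested under refinement. Discrete problem: for $g\in L^2\Lambda^n$, $\mathcal{L}_h^{-1}g$ denotes the discrete solution, with $(\sigma_h,u_h)\in\Lambda^{n-1}_h\times\Lambda^n_h$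 solving - $\langle\sigma_h,\tau\rangle-\langle d\tau,u_h\rangle=0$ for all $\tau\in\Lambda^{n-1}_h$, - $\langle d\sigma_h,v\rangle=\langle g,v\rangle$ for all $v\in\Lambda^n_h$, and with harmonic component $p_h=0$ since there are no nonzero harmonic $n$-forms. Projections and oscillation: - $g_{\mathfrak{B}_h}$ is the $L^2$ projection of $g$ onto $\mathfrak{B}^n_h=d\Lambda^{n-1}_h$, which equals the $L^2$ projection onto $\Lambda^n_h$; similarly for $H$. - $\mathrm{osc}(f_{\mathfrak{B}_h},\mathcal{T}_H)=\big(\sum_{T\in\mathcal{T}_H}\|h_T(f_{\mathfrak{B}_h}-f_{\mathfrak{B}_H})\|_T^2\big)^{1/2}$, with $h_T=\mathrm{diam}(T)$. $C$ depends only on $\Omega$, the polynomial degree and shape regularity. *)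

theory Defs
  imports "HOL-Analysis.Analysis"
begin

text \<open>Points of R^n are vectors of type real^'n.  Via the standard vector proxies
  (Hodge star), (n-1)-forms are vector fields real^'n => real^'n, n-forms are
  scalar functions real^'n => real, and d : (n-1)-forms -> n-forms is the divergence.\<close>

definition lipschitz_boundary :: "(real^'n) set \<Rightarrow> bool" where
  "lipschitz_boundary \<Omega> \<longleftrightarrow>
     (\<forall>x\<in>frontier \<Omega>. \<exists>e \<rho> L g. norm e = 1 \<and> \<rho> > 0 \<and>
        L-lipschitz_on UNIV (g :: real^'n \<Rightarrow> real) \<and>
        (\<forall>y\<in>ball x \<rho>. y \<in> \<Omega> \<longleftrightarrow> y \<bullet> e < g (y - (y \<bullet> e) *\<^sub>R e)))"

definition lipschitz_polyhedral_domain :: "(real^'n) set \<Rightarrow> bool" where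
  "lipschitz_polyhedral_domain \<Omega> \<longleftrightarrow>
     open \<Omega> \<and> bounded \<Omega> \<and> connected \<Omega> \<and> \<Omega> \<noteq> {} \<and> lipschitz_boundary \<Omega> \<and>
     (\<exists>P. finite P \<and> (\<forall>S\<in>P. polytope S) \<and> closure \<Omega> = \<Union>P)"

definition conforming_triangulation :: "(real^'n) set \<Rightarrow> (real^'n) set set \<Rightarrow> bool" where
  "conforming_triangulation \<Omega> \<T> \<longleftrightarrow>
     triangulation \<T> \<and> (\<forall>T\<in>\<T>. int CARD('n) simplex T) \<and> \<Union>\<T> = closure \<Omega>"

definition refines :: "(real^'n) set set \<Rightarrow> (real^'n) set set \<Rightarrow> bool" where
  "refines \<T>h \<T>H \<longleftrightarrow> (\<forall>T\<in>\<T>h. \<exists>T'\<in>\<T>H. T \<subseteq> T')"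

definition shape_regular :: "real \<Rightarrow> (real^'n) set set \<Rightarrow> bool" where
  "shape_regular \<kappa> \<T> \<longleftrightarrow>
     (\<forall>T\<in>\<T>. \<exists>x \<rho>. \<rho> > 0 \<and> ball x \<rho> \<subseteq> T \<and> diameter T \<le> \<kappa> * \<rho>)"

definition poly_fun :: "nat \<Rightarrow> (real^'n \<Rightarrow> real) \<Rightarrow> bool" where
  "poly_fun r p \<longleftrightarrow>
     (\<exists>c :: ('n \<Rightarrow> nat) \<Rightarrow> real. \<forall>x.
        p x = (\<Sum>\<alpha>\<in>{\<alpha>. (\<Sum>i\<in>UNIV. \<alpha> i) \<le> r}. c \<alpha> * (\<Prod>i\<in>UNIV. (x $ i) ^ \<alpha> i)))"

datatype fe_family = P_full | P_minus

text \<open>Local shape functions for (n-1)-forms: P_r \<Lambda>^{n-1} (BDM_r) and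
  P_r^- \<Lambda>^{n-1} = P_{r-1}\<Lambda>^{n-1} + \<kappa> P_{r-1}\<Lambda>^n (RT_{r-1}).\<close>
definition local_sigma :: "fe_family \<Rightarrow> nat \<Rightarrow> (real^'n \<Rightarrow> real^'n) \<Rightarrow> bool" where
  "local_sigma fam r q \<longleftrightarrow>
     (case fam of
        P_full \<Rightarrow> (\<forall>i. poly_fun r (\<lambda>x. q x $ i))
      | P_minus \<Rightarrow> (\<exists>a b. (\<forall>i. poly_fun (r - 1) (\<lambda>x. a x $ i)) \<and> poly_fun (r - 1) b \<and>
                       (\<forall>x. q x = a x + b x *\<^sub>R x)))"

definition L2 :: "(real^'n) set \<Rightarrow> (real^'n \<Rightarrow> 'b::euclidean_space) \<Rightarrow> bool" where
  "L2 \<Omega> f \<longleftrightarrow> set_borel_measurable lebesgue \<Omega> f \<and>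
                 set_integrable lebesgue \<Omega> (\<lambda>x. (norm (f x))\<^sup>2)"

definition l2_inner :: "(real^'n) set \<Rightarrow> (real^'n \<Rightarrow> 'b::euclidean_space) \<Rightarrow> (real^'n \<Rightarrow> 'b) \<Rightarrow> real" where
  "l2_inner \<Omega> u v = (LINT x:\<Omega>|lebesgue. u x \<bullet> v x)"

definition l2_norm :: "(real^'n) set \<Rightarrow> (real^'n \<Rightarrow> 'b::euclidean_space) \<Rightarrow> real" where
  "l2_norm \<Omega> u = sqrt (LINT x:\<Omega>|lebesgue. (norm (u x))\<^sup>2)"

definition test_fun :: "(real^'n) set \<Rightarrow> (real^'n \<Rightarrow> real) \<Rightarrow> (real^'n \<Rightarrow> real^'n) \<Rightarrow> bool" where
  "test_fun \<Omega> \<phi> G \<longleftrightarrow>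
     (\<exists>K. compact K \<and> K \<subseteq> \<Omega> \<and> (\<forall>x. x \<notin> K \<longrightarrow> \<phi> x = 0)) \<and>
     continuous_on UNIV G \<and> (\<forall>x. (\<phi> has_derivative (\<lambda>h. G x \<bullet> h)) (at x))"

definition weak_d :: "(real^'n) set \<Rightarrow> (real^'n \<Rightarrow> real^'n) \<Rightarrow> (real^'n \<Rightarrow> real) \<Rightarrow> bool" where
  "weak_d \<Omega> \<sigma> w \<longleftrightarrow>
     (\<forall>\<phi> G. test_fun \<Omega> \<phi> G \<longrightarrow>
        (LINT x:\<Omega>|lebesgue. \<sigma> x \<bullet> G x) = - (LINT x:\<Omega>|lebesgue. w x * \<phi> x))"

definition H_Lambda :: "(real^'n) set \<Rightarrow> (real^'n \<Rightarrow> real^'n) \<Rightarrow> bool" where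
  "H_Lambda \<Omega> \<sigma> \<longleftrightarrow> L2 \<Omega> \<sigma> \<and> (\<exists>w. L2 \<Omega> w \<and> weak_d \<Omega> \<sigma> w)"

definition Lambda_nm1_h :: "fe_family \<Rightarrow> nat \<Rightarrow> (real^'n) set \<Rightarrow> (real^'n) set set
                             \<Rightarrow> (real^'n \<Rightarrow> real^'n) set" where
  "Lambda_nm1_h fam r \<Omega> \<T> =
     {\<sigma>. (\<forall>T\<in>\<T>. \<exists>q. local_sigma fam r q \<and> (\<forall>x\<in>interior T. \<sigma> x = q x)) \<and> H_Lambda \<Omega> \<sigma>}"

text \<open>n-forms: discontinuous P_{r-1}\<Lambda>^n (= P_r^-\<Lambda>^n), the AFW partner of both families.\<close>
definition Lambda_n_h :: "nat \<Rightarrow> (real^'n) set set \<Rightarrow> (real^'n \<Rightarrow> real) set" where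
  "Lambda_n_h r \<T> =
     {v. \<forall>T\<in>\<T>. \<exists>q. poly_fun (r - 1) q \<and> (\<forall>x\<in>interior T. v x = q x)}"

definition discrete_solution :: "fe_family \<Rightarrow> nat \<Rightarrow> (real^'n) set \<Rightarrow> (real^'n) set set
     \<Rightarrow> (real^'n \<Rightarrow> real) \<Rightarrow> (real^'n \<Rightarrow> real^'n) \<Rightarrow> (real^'n \<Rightarrow> real) \<Rightarrow> bool" where
  "discrete_solution fam r \<Omega> \<T> g \<sigma> u \<longleftrightarrow>
     \<sigma> \<in> Lambda_nm1_h fam r \<Omega> \<T> \<and> u \<in> Lambda_n_h r \<T> \<and>
     (\<forall>\<tau> w. \<tau> \<in> Lambda_nm1_h fam r \<Omega> \<T> \<and> weak_d \<Omega> \<tau> w \<and> L2 \<Omega> w \<longrightarrow>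
              l2_inner \<Omega> \<sigma> \<tau> - l2_inner \<Omega> w u = 0) \<and>
     (\<exists>d\<sigma>. weak_d \<Omega> \<sigma> d\<sigma> \<and> L2 \<Omega> d\<sigma> \<and>
        (\<forall>v\<in>Lambda_n_h r \<T>. l2_inner \<Omega> d\<sigma> v = l2_inner \<Omega> g v))"

text \<open>L^2 projection of f onto \<Lambda>^n_h (= onto d\<Lambda>^{n-1}_h).\<close>
definition is_L2_proj :: "(real^'n) set \<Rightarrow> (real^'n \<Rightarrow> real) set \<Rightarrow> (real^'n \<Rightarrow> real)
                          \<Rightarrow> (real^'n \<Rightarrow> real) \<Rightarrow> bool" where
  "is_L2_proj \<Omega> V f p \<longleftrightarrow> p \<in> V \<and> (\<forall>v\<in>V. l2_inner \<Omega> (\<lambda>x. f x - p x) v = 0)"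

definition osc :: "(real^'n \<Rightarrow> real) \<Rightarrow> (real^'n \<Rightarrow> real) \<Rightarrow> (real^'n) set set \<Rightarrow> real" where
  "osc fh fH \<T>H =
     sqrt (\<Sum>T\<in>\<T>H. (LINT x:T|lebesgue. (diameter T * (fh x - fH x))\<^sup>2))"

end

theory Submission
  imports Defs
begin

text \<open>
  Put \<open>\<delta> = \<sigma>h - \<sigma>t\<close>, \<open>w = uh - ut\<close> and \<open>g = fh - fH\<close>. Then \<open>\<delta>\<close> is the discrete gradient of \<open>w\<close>, that is
  \<open>\<langle>\<delta>, \<tau>\<rangle> = \<langle>div \<tau>, w\<rangle>\<close> for all discrete \<open>\<tau>\<close>, and \<open>\<parallel>\<delta>\<parallel>\<^sup>2 = \<langle>g, w\<rangle>\<close>. As \<open>g\<close> has mean zero on every coarse cell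
  \<open>T\<close>, it suffices to find constants \<open>c\<close> with \<open>\<parallel>w - c\<parallel> \<le> C diam T \<parallel>\<delta>\<parallel>\<close> on \<open>T\<close>.

  Testing with bubbles bounds \<open>w\<close> minus its mean on each fine element, by a weighted Poincare inequality
  whose constant does not depend on the shape of the element. Testing with lowest order
  Raviart-Thomas functions of a facet bounds the jump of the means across that facet. The elements of \<open>T\<close>
  around a vertex are uniformly few, comparable in size and connected through facets, so the
  means differ little from a continuous piecewise affine function, to which the Poincare
  inequality on the convex set \<open>T\<close> applies.
\<close>

subsection \<open>Polynomial shape functions\<close>

text \<open>A coarse cell \<open>T\<close> may contain arbitrarily many fine elements, graded in any
  way, so finite dimensionality and scaling to a reference patch give no uniform constant on
  \<open>T\<close>. Every estimate is therefore local to one element, one facet or one vertex star.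
  Only the Poincare inequality for the continuous interpolant involves all of \<open>T\<close>, and
  its constant depends on \<open>T\<close> only through the diameter.

  All test fields are supported in one or two fine elements inside \<open>T\<close>. Hence
  \<open>w\<close> is controlled on \<open>T\<close> by the norm of \<open>\<delta>\<close> on
  \<open>T\<close> alone, and the bounds for the coarse cells can be summed.

  Traces and surface measures never occur. That a piecewise field has a weak divergence is checked
  by a volume identity on cones: the integral of the divergence of
  \<open>\<psi> x *\<^sub>R (x - a)\<close> over a cone with apex \<open>a\<close> vanishes if
  \<open>\<psi>\<close> vanishes on the base, because \<open>x - a\<close> is tangential to the
  lateral faces.

  The polynomial degree does not enter the constant, since the weighted Poincare inequality holds
  for all continuously differentiable functions.\<close>

definition C1_with_grad :: "('a::euclidean_space \<Rightarrow> real) \<Rightarrow> ('a \<Rightarrow> 'a) \<Rightarrow> bool" where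
  "C1_with_grad \<phi> G \<longleftrightarrow>
     continuous_on UNIV G \<and> (\<forall>x. (\<phi> has_derivative (\<lambda>h. G x \<bullet> h)) (at x))"

lemma C1_with_gradD:
  assumes "C1_with_grad \<phi> G"
  shows "continuous_on S G" "(\<phi> has_derivative (\<lambda>h. G x \<bullet> h)) (at x within T)" "continuous_on S \<phi>"
proof -
  show "continuous_on S G"
    using assms continuous_on_subset unfolding C1_with_grad_def by blast
  show "(\<phi> has_derivative (\<lambda>h. G x \<bullet> h)) (at x within T)" for x T
    using assms has_derivative_at_withinI unfolding C1_with_grad_def by blast
  then show "continuous_on S \<phi>"
    by (rule has_derivative_continuous_on)
qed

lemma C1_with_grad_mult:
  assumes "C1_with_grad f F" "C1_with_grad g G"
  shows "C1_with_grad (\<lambda>x. f x * g x) (\<lambda>x. g x *\<^sub>R F x + f x *\<^sub>R G x)"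
  using assms C1_with_gradD(3)[OF assms(1)] C1_with_gradD(3)[OF assms(2)]
  unfolding C1_with_grad_def
  by (auto intro!: derivative_eq_intros continuous_intros simp: inner_add_left algebra_simps)

lemma C1_with_grad_sum:
  "(\<And>i. i \<in> I \<Longrightarrow> C1_with_grad (f i) (F i)) \<Longrightarrow>
     C1_with_grad (\<lambda>x. \<Sum>i\<in>I. f i x) (\<lambda>x. \<Sum>i\<in>I. F i x)"
  unfolding C1_with_grad_def
  by (auto intro!: derivative_eq_intros continuous_intros simp: inner_sum_left)

lemma C1_with_grad_cmult:
  "C1_with_grad f F \<Longrightarrow> C1_with_grad (\<lambda>x. c * f x) (\<lambda>x. c *\<^sub>R F x)"
  unfolding C1_with_grad_def
  by (auto intro!: derivative_eq_intros continuous_intros)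

lemma finite_multi_indices: "finite {\<alpha> :: 'n::finite \<Rightarrow> nat. (\<Sum>i\<in>UNIV. \<alpha> i) \<le> r}"
proof (rule finite_subset)
  show "{\<alpha> :: 'n \<Rightarrow> nat. (\<Sum>i\<in>UNIV. \<alpha> i) \<le> r} \<subseteq> (\<Pi>\<^sub>E i\<in>UNIV. {..r})"
  proof
    fix \<alpha> :: "'n \<Rightarrow> nat" assume a: "\<alpha> \<in> {\<alpha>. (\<Sum>i\<in>UNIV. \<alpha> i) \<le> r}"
    have "\<alpha> i \<le> r" for i using a member_le_sum[of i UNIV \<alpha>] by simp
    then show "\<alpha> \<in> (\<Pi>\<^sub>E i\<in>UNIV. {..r})" by (simp add: PiE_UNIV_domain)
  qed
qed (auto intro: finite_PiE)

definition monom_fun :: "('n::finite \<Rightarrow> nat) \<Rightarrow> real^'n \<Rightarrow> real" where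
  "monom_fun \<alpha> x = (\<Prod>i\<in>UNIV. (x $ i) ^ \<alpha> i)"

lemma poly_fun_monom:
  fixes \<alpha> :: "'n::finite \<Rightarrow> nat"
  assumes "(\<Sum>i\<in>UNIV. \<alpha> i) \<le> r"
  shows "poly_fun r (monom_fun \<alpha>)"
  unfolding poly_fun_def
  by (intro exI[of _ "\<lambda>\<beta>. if \<beta> = \<alpha> then 1 else 0"])
     (use assms in \<open>simp add: monom_fun_def if_distrib[of "\<lambda>c. c * _"] finite_multi_indices cong: if_cong\<close>)

lemma poly_fun_add:
  "poly_fun r p \<Longrightarrow> poly_fun r q \<Longrightarrow> poly_fun r (\<lambda>x. p x + q x)"
  unfolding poly_fun_def
proof (elim exE)
  fix c d :: "('a \<Rightarrow> nat) \<Rightarrow> real"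
  assume "\<forall>x. p x = (\<Sum>\<alpha> | sum \<alpha> UNIV \<le> r. c \<alpha> * (\<Prod>i\<in>UNIV. x $ i ^ \<alpha> i))"
    "\<forall>x. q x = (\<Sum>\<alpha> | sum \<alpha> UNIV \<le> r. d \<alpha> * (\<Prod>i\<in>UNIV. x $ i ^ \<alpha> i))"
  then show "\<exists>c. \<forall>x. p x + q x = (\<Sum>\<alpha> | sum \<alpha> UNIV \<le> r. c \<alpha> * (\<Prod>i\<in>UNIV. x $ i ^ \<alpha> i))"
    by (intro exI[of _ "\<lambda>\<alpha>. c \<alpha> + d \<alpha>"]) (simp add: sum.distrib algebra_simps)
qed

lemma poly_fun_cmult: "poly_fun r p \<Longrightarrow> poly_fun r (\<lambda>x. k * p x)"
  unfolding poly_fun_def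
proof (elim exE)
  fix c :: "('a \<Rightarrow> nat) \<Rightarrow> real"
  assume "\<forall>x. p x = (\<Sum>\<alpha> | sum \<alpha> UNIV \<le> r. c \<alpha> * (\<Prod>i\<in>UNIV. x $ i ^ \<alpha> i))"
  then show "\<exists>c. \<forall>x. k * p x = (\<Sum>\<alpha> | sum \<alpha> UNIV \<le> r. c \<alpha> * (\<Prod>i\<in>UNIV. x $ i ^ \<alpha> i))"
    by (intro exI[of _ "\<lambda>\<alpha>. k * c \<alpha>"]) (simp add: sum_distrib_left algebra_simps)
qed

lemma poly_fun_const: "poly_fun r (\<lambda>x. k)"
  using poly_fun_cmult[OF poly_fun_monom[of "\<lambda>i. 0" r], of k] by (simp add: monom_fun_def)

lemma poly_fun_diff:
  assumes "poly_fun r p" "poly_fun r q" shows "poly_fun r (\<lambda>x. p x - q x)"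
  using poly_fun_add[OF assms(1) poly_fun_cmult[OF assms(2), of "-1"]] by simp

lemma poly_fun_sum:
  "(\<And>i. i \<in> I \<Longrightarrow> poly_fun r (p i)) \<Longrightarrow> poly_fun r (\<lambda>x. \<Sum>i\<in>I. p i x)"
  by (induction I rule: infinite_finite_induct) (auto intro: poly_fun_const poly_fun_add)

text \<open>The truncated \<open>\<alpha> i - 1\<close> is harmless for
  \<open>\<alpha> i = 0\<close>, because the factor \<open>real (\<alpha> i)\<close> vanishes
  then.\<close>

definition monom_grad :: "('n::finite \<Rightarrow> nat) \<Rightarrow> real^'n \<Rightarrow> real^'n" where
  "monom_grad \<alpha> x = (\<chi> i. real (\<alpha> i) * monom_fun (\<alpha>(i := \<alpha> i - 1)) x)"

lemma C1_with_grad_monom: "C1_with_grad (monom_fun \<alpha>) (monom_grad \<alpha>)"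
  unfolding C1_with_grad_def
proof (intro conjI allI)
  show "continuous_on UNIV (monom_grad \<alpha>)"
    unfolding monom_grad_def monom_fun_def by (intro continuous_intros)
  fix x :: "real^'a"
  have "((\<lambda>x. (\<Prod>i\<in>UNIV. (x $ i) ^ \<alpha> i)) has_derivative
      (\<lambda>y. \<Sum>i\<in>UNIV. (real (\<alpha> i) * (y $ i) * (x $ i) ^ (\<alpha> i - 1)) * (\<Prod>j\<in>UNIV - {i}. (x $ j) ^ \<alpha> j))) (at x)"
    by (rule has_derivative_prod)
       (auto intro!: derivative_eq_intros bounded_linear_imp_has_derivative bounded_linear_vec_nth)
  moreover have "(real (\<alpha> i) * (y $ i) * (x $ i) ^ (\<alpha> i - 1)) * (\<Prod>j\<in>UNIV - {i}. (x $ j) ^ \<alpha> j)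
      = monom_grad \<alpha> x $ i * y $ i" for i y
  proof -
    have "monom_fun (\<alpha>(i := \<alpha> i - 1)) x = x $ i ^ (\<alpha> i - 1) * (\<Prod>j\<in>UNIV - {i}. (x $ j) ^ \<alpha> j)"
      unfolding monom_fun_def by (subst prod.remove[of _ i]) auto
    then show ?thesis by (simp add: monom_grad_def)
  qed
  moreover have "(\<bullet>) (monom_grad \<alpha> x) = (\<lambda>y. \<Sum>i\<in>UNIV. monom_grad \<alpha> x $ i * y $ i)"
    by (simp add: fun_eq_iff inner_vec_def)
  ultimately show "(monom_fun \<alpha> has_derivative (\<bullet>) (monom_grad \<alpha> x)) (at x)"
    unfolding monom_fun_def[abs_def] by (simp only:)
qed

text \<open>Differentiation lowers the degree by one and the affine factor restores it. This keeps
  the product of a derivative of \<open>p\<close> and a barycentric coordinate within the degree of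
  \<open>p\<close>, which makes the bubble coefficients admissible.\<close>

lemma monom_grad_times_affine:
  fixes \<alpha> :: "'n::finite \<Rightarrow> nat"
  assumes "(\<Sum>i\<in>UNIV. \<alpha> i) \<le> r"
  shows "poly_fun r (\<lambda>x. (v \<bullet> monom_grad \<alpha> x) * (c + u \<bullet> x))"
proof -
  have le: "sum (\<alpha>(i := \<alpha> i - 1)) UNIV \<le> sum \<alpha> UNIV" for i
    by (rule sum_mono) auto
  have *: "poly_fun r (\<lambda>x. monom_grad \<alpha> x $ i)" for i
    unfolding monom_grad_def using assms le[of i]
    by (auto intro!: poly_fun_cmult poly_fun_monom)
  have **: "poly_fun r (\<lambda>x. monom_grad \<alpha> x $ i * x $ j)" for i j
  proof (cases "\<alpha> i = 0")
    case True then show ?thesis by (simp add: monom_grad_def poly_fun_const)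
  next
    case False
    let ?\<beta> = "\<alpha>(i := \<alpha> i - 1)"
    let ?\<gamma> = "?\<beta>(j := ?\<beta> j + 1)"
    have 1: "monom_fun ?\<beta> x * x $ j = monom_fun ?\<gamma> x" for x
    proof -
      have "monom_fun ?\<beta> x = x $ j ^ ?\<beta> j * (\<Prod>k\<in>UNIV-{j}. x $ k ^ ?\<beta> k)"
        unfolding monom_fun_def by (subst prod.remove[of _ j]) auto
      moreover have "monom_fun ?\<gamma> x = x $ j ^ ?\<gamma> j * (\<Prod>k\<in>UNIV-{j}. x $ k ^ ?\<gamma> k)"
        unfolding monom_fun_def by (subst prod.remove[of _ j]) auto
      ultimately show ?thesis by (simp add: algebra_simps)
    qed
    \<comment> \<open>Splitting off single indices shows that \<open>?\<gamma>\<close> has the same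
      degree as \<open>\<alpha>\<close>; \<open>\<alpha> i \<noteq> 0\<close> ensures that the
      subtraction is not truncated.\<close>
    have "sum \<alpha> UNIV = \<alpha> i + sum \<alpha> (UNIV - {i})" "sum ?\<beta> UNIV = \<alpha> i - 1 + sum \<alpha> (UNIV - {i})"
      by (subst sum.remove[of _ i]; simp)+
    moreover have "sum ?\<gamma> UNIV = ?\<beta> j + 1 + sum ?\<beta> (UNIV - {j})"
      by (subst sum.remove[of _ j]; simp)
    moreover have "sum ?\<beta> UNIV = ?\<beta> j + sum ?\<beta> (UNIV - {j})"
      by (subst sum.remove[of _ j]) (auto simp del: fun_upd_apply)
    ultimately have "sum ?\<gamma> UNIV \<le> r"
      using assms False by linarith
    from poly_fun_cmult[OF poly_fun_monom[OF this], of "real (\<alpha> i)"] show ?thesis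
      unfolding monom_grad_def vec_lambda_beta mult.assoc 1 .
  qed
  have "(\<lambda>x. (v \<bullet> monom_grad \<alpha> x) * (c + u \<bullet> x)) =
     (\<lambda>x. (\<Sum>i\<in>UNIV. (c * v $ i) * monom_grad \<alpha> x $ i) +
        (\<Sum>i\<in>UNIV. \<Sum>j\<in>UNIV. (v $ i * u $ j) * (monom_grad \<alpha> x $ i * x $ j)))"
    by (auto simp: inner_vec_def sum_distrib_left sum_distrib_right algebra_simps sum.distrib fun_eq_iff intro: sum.swap)
  then show ?thesis
    by (auto intro!: poly_fun_add poly_fun_sum poly_fun_cmult * **)
qed

lemma poly_fun_C1_with_grad:
  assumes "poly_fun r p"
  obtains G where "C1_with_grad p G" "\<And>v c u. poly_fun r (\<lambda>x. (v \<bullet> G x) * (c + u \<bullet> x))"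
proof -
  obtain c where c: "\<And>x. p x = (\<Sum>\<alpha> | sum \<alpha> UNIV \<le> r. c \<alpha> * monom_fun \<alpha> x)"
    using assms unfolding poly_fun_def monom_fun_def by blast
  define G where "G x = (\<Sum>\<alpha> | sum \<alpha> UNIV \<le> r. c \<alpha> *\<^sub>R monom_grad \<alpha> x)" for x
  have "C1_with_grad (\<lambda>x. \<Sum>\<alpha> | sum \<alpha> UNIV \<le> r. c \<alpha> * monom_fun \<alpha> x) G"
    unfolding G_def by (intro C1_with_grad_sum C1_with_grad_cmult C1_with_grad_monom)
  moreover have "p = (\<lambda>x. \<Sum>\<alpha> | sum \<alpha> UNIV \<le> r. c \<alpha> * monom_fun \<alpha> x)"
    using c by (rule ext)
  ultimately have "C1_with_grad p G" by simp
  moreover have "poly_fun r (\<lambda>x. (v \<bullet> G x) * (c' + u \<bullet> x))" for v c' u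
  proof -
    have "(\<lambda>x. (v \<bullet> G x) * (c' + u \<bullet> x)) =
        (\<lambda>x. \<Sum>\<alpha> | sum \<alpha> UNIV \<le> r. c \<alpha> * ((v \<bullet> monom_grad \<alpha> x) * (c' + u \<bullet> x)))"
      unfolding G_def by (simp add: inner_sum_right sum_distrib_right mult.assoc)
    then show ?thesis
      by (auto intro!: poly_fun_sum poly_fun_cmult monom_grad_times_affine)
  qed
  ultimately show ?thesis using that by blast
qed

lemma poly_fun_mono:
  assumes "poly_fun r p" "r \<le> s" shows "poly_fun s p"
proof -
  obtain c where c: "\<And>x. p x = (\<Sum>\<alpha> | sum \<alpha> UNIV \<le> r. c \<alpha> * monom_fun \<alpha> x)"
    using assms unfolding poly_fun_def monom_fun_def by blast
  have "poly_fun s (\<lambda>x. \<Sum>\<alpha> | sum \<alpha> UNIV \<le> r. c \<alpha> * monom_fun \<alpha> x)"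
    using assms(2) by (intro poly_fun_sum poly_fun_cmult poly_fun_monom) auto
  moreover have "p = (\<lambda>x. \<Sum>\<alpha> | sum \<alpha> UNIV \<le> r. c \<alpha> * monom_fun \<alpha> x)"
    using c by (rule ext)
  ultimately show ?thesis by simp
qed

lemma poly_fun_mult_coord:
  assumes "poly_fun r p" shows "poly_fun (Suc r) (\<lambda>x. p x * x $ j)"
proof -
  obtain c where c: "\<And>x. p x = (\<Sum>\<alpha> | sum \<alpha> UNIV \<le> r. c \<alpha> * monom_fun \<alpha> x)"
    using assms unfolding poly_fun_def monom_fun_def by blast
  have "monom_fun \<alpha> x * x $ j = monom_fun (\<alpha>(j := Suc (\<alpha> j))) x" for \<alpha> and x :: "real^'a"
    unfolding monom_fun_def by (simp add: prod.remove[of _ j])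
  moreover have "sum (\<alpha>(j := Suc (\<alpha> j))) UNIV = Suc (sum \<alpha> UNIV)" for \<alpha> :: "'a \<Rightarrow> nat"
    by (simp add: sum.remove[of _ j])
  ultimately have "poly_fun (Suc r) (\<lambda>x. \<Sum>\<alpha> | sum \<alpha> UNIV \<le> r. c \<alpha> * (monom_fun \<alpha> x * x $ j))"
    by (intro poly_fun_sum poly_fun_cmult) (auto simp del: fun_upd_apply intro!: poly_fun_monom)
  then show ?thesis using c by (simp add: sum_distrib_right mult.assoc)
qed

text \<open>All test fields are written in Raviart-Thomas form: \<open>P_r^-\<close> is contained in
  \<open>P_r\<close>, so one construction serves both families. The bound \<open>r \<ge> 1\<close>
  turns the degree \<open>r - 1\<close> raised by one into \<open>r\<close>.\<close>

lemma local_sigma_P_minus_imp: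
  assumes "\<And>i. poly_fun (r - 1) (\<lambda>x. a x $ i)" "poly_fun (r - 1) b" "r \<ge> 1"
  shows "local_sigma fam r (\<lambda>x. a x + b x *\<^sub>R x)"
proof (cases fam)
  case P_full
  have "poly_fun r (\<lambda>x. a x $ i + b x * x $ i)" for i
    using poly_fun_mono[OF assms(1), of r] poly_fun_mult_coord[OF assms(2)] assms(3)
    by (auto intro!: poly_fun_add)
  then show ?thesis using P_full by (simp add: local_sigma_def)
next
  case P_minus
  then show ?thesis using assms by (auto simp: local_sigma_def)
qed

lemma local_sigma_diff:
  assumes "local_sigma fam r p" "local_sigma fam r q"
  shows "local_sigma fam r (\<lambda>x. p x - q x)"
proof (cases fam)
  case P_full
  then show ?thesis using assms by (auto simp: local_sigma_def intro!: poly_fun_diff)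
next
  case P_minus
  obtain a b c d where *: "\<forall>i. poly_fun (r - 1) (\<lambda>x. a x $ i)" "poly_fun (r - 1) b"
      "\<forall>x. p x = a x + b x *\<^sub>R x" "\<forall>i. poly_fun (r - 1) (\<lambda>x. c x $ i)" "poly_fun (r - 1) d"
      "\<forall>x. q x = c x + d x *\<^sub>R x"
    using assms P_minus by (auto simp: local_sigma_def)
  have "(\<forall>i. poly_fun (r - 1) (\<lambda>x. (a x - c x) $ i)) \<and> poly_fun (r - 1) (\<lambda>x. b x - d x) \<and>
     (\<forall>x. p x - q x = (a x - c x) + (b x - d x) *\<^sub>R x)"
    using * by (auto intro!: poly_fun_diff simp: algebra_simps)
  then show ?thesis using P_minus unfolding local_sigma_def
    by (simp only: fe_family.case)
       (intro exI[of _ "\<lambda>x. a x - c x"] exI[of _ "\<lambda>x. b x - d x"], simp)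
qed

subsection \<open>Integration by parts on simplices\<close>

lemma nn_integral_lborel_translate:
  fixes f :: "'a::euclidean_space \<Rightarrow> ennreal"
  assumes [measurable]: "f \<in> borel_measurable borel"
  shows "(\<integral>\<^sup>+x. f (x + t) \<partial>lborel) = (\<integral>\<^sup>+x. f x \<partial>lborel)"
proof -
  have "(\<integral>\<^sup>+x. f x \<partial>lborel) = (\<integral>\<^sup>+x. f x \<partial>(distr lborel borel ((+) t)))"
    by (simp add: lborel_distr_plus)
  also have "\<dots> = (\<integral>\<^sup>+x. f (t + x) \<partial>lborel)"
    by (rule nn_integral_distr) auto
  finally show ?thesis by (simp add: add.commute)
qed

text \<open>Averaging over translations along \<open>u\<close> reduces the rank-one change of variables to Tonelli
  and one-dimensional substitutions, so no determinants are needed.\<close>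

lemma nn_integral_lborel_rank_one:
  fixes f :: "'a::euclidean_space \<Rightarrow> ennreal"
  assumes [measurable]: "f \<in> borel_measurable borel" and k: "1 + q \<bullet> u \<noteq> 0"
  shows "(\<integral>\<^sup>+x. f x \<partial>lborel) = \<bar>1 + q \<bullet> u\<bar> * (\<integral>\<^sup>+x. f (x + (c + q \<bullet> x) *\<^sub>R u) \<partial>lborel)"
proof -
  define k where "k = 1 + q \<bullet> u"
  define l where "l x = c + q \<bullet> x" for x
  have k0: "k \<noteq> 0" using k by (simp add: k_def)
  have lmeas[measurable]: "l \<in> borel_measurable borel" unfolding l_def by measurable
  \<comment> \<open>A probability density on the line, used to average over the translations; only
    its total mass matters.\<close>
  define \<eta> :: "real \<Rightarrow> ennreal" where "\<eta> = indicator {0..1}"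
  have [measurable]: "\<eta> \<in> borel_measurable borel" unfolding \<eta>_def by measurable
  have \<eta>1: "(\<integral>\<^sup>+s. \<eta> (s + t) \<partial>lborel) = 1" for t
    by (subst nn_integral_lborel_translate) (auto simp: \<eta>_def)
  define I where "I = (\<integral>\<^sup>+x. f (x + l x *\<^sub>R u) \<partial>lborel)"
  \<comment> \<open>Shifting \<open>x\<close> by \<open>s *\<^sub>R u\<close> raises
    \<open>l x\<close> by \<open>s * (q \<bullet> u)\<close>, so the image moves by
    \<open>k * s\<close> along \<open>u\<close>.\<close>
  have trans: "(\<integral>\<^sup>+x. f (x + (l x + k * s) *\<^sub>R u) \<partial>lborel) = I" for s
  proof -
    have "I = (\<integral>\<^sup>+x. f ((x + s *\<^sub>R u) + l (x + s *\<^sub>R u) *\<^sub>R u) \<partial>lborel)"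
      unfolding I_def by (rule nn_integral_lborel_translate[symmetric]) measurable
    also have "\<dots> = (\<integral>\<^sup>+x. f (x + (l x + k * s) *\<^sub>R u) \<partial>lborel)"
      by (intro nn_integral_cong arg_cong[of _ _ f])
         (simp add: l_def k_def inner_add_right algebra_simps)
    finally show ?thesis by simp
  qed
  have "\<bar>k\<bar> * I = \<bar>k\<bar> * (\<integral>\<^sup>+s. \<eta> (s + 0) * I \<partial>lborel)"
    by (subst nn_integral_multc) (auto simp only: \<eta>1, auto)
  also have "\<dots> = \<bar>k\<bar> * (\<integral>\<^sup>+s. (\<integral>\<^sup>+x. \<eta> s * f (x + (l x + k * s) *\<^sub>R u) \<partial>lborel) \<partial>lborel)"
    by (simp add: nn_integral_cmult trans)
  also have "\<dots> = \<bar>k\<bar> * (\<integral>\<^sup>+x. (\<integral>\<^sup>+s. \<eta> s * f (x + (l x + k * s) *\<^sub>R u) \<partial>lborel) \<partial>lborel)"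
    by (subst lborel_pair.Fubini') (auto simp: split_beta')
  also have "\<dots> = (\<integral>\<^sup>+x. \<bar>k\<bar> * (\<integral>\<^sup>+s. \<eta> s * f (x + (l x + k * s) *\<^sub>R u) \<partial>lborel) \<partial>lborel)"
    by (subst nn_integral_cmult) auto
  also have "\<dots> = (\<integral>\<^sup>+x. (\<integral>\<^sup>+s. \<eta> ((s - l x) / k) * f (x + s *\<^sub>R u) \<partial>lborel) \<partial>lborel)"
  proof (rule nn_integral_cong)
    fix x :: 'a
    show "\<bar>k\<bar> * (\<integral>\<^sup>+s. \<eta> s * f (x + (l x + k * s) *\<^sub>R u) \<partial>lborel)
        = (\<integral>\<^sup>+s. \<eta> ((s - l x) / k) * f (x + s *\<^sub>R u) \<partial>lborel)"
      using k0 by (subst (2) nn_integral_real_affine[of _ k "l x"]) auto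
  qed
  also have "\<dots> = (\<integral>\<^sup>+s. (\<integral>\<^sup>+x. \<eta> ((s - l x) / k) * f (x + s *\<^sub>R u) \<partial>lborel) \<partial>lborel)"
    by (subst lborel_pair.Fubini') (auto simp: split_beta')
  \<comment> \<open>A second shift, by \<open>- s\<close> along \<open>u\<close>, frees
    \<open>f\<close> from \<open>s\<close>. It lowers \<open>l\<close> by
    \<open>s * (k - 1)\<close>, so that \<open>s\<close> enters the argument of
    \<open>\<eta>\<close> with coefficient 1 and can be integrated out.\<close>
  also have "\<dots> = (\<integral>\<^sup>+s. (\<integral>\<^sup>+x. \<eta> (s + - l x / k) * f x \<partial>lborel) \<partial>lborel)"
  proof (rule nn_integral_cong)
    fix s :: real
    have eq: "(s - l (x - s *\<^sub>R u)) / k = s + - l x / k" for x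
      using k0 by (simp add: l_def k_def inner_diff_right field_simps)
    have "(\<integral>\<^sup>+x. \<eta> ((s - l x) / k) * f (x + s *\<^sub>R u) \<partial>lborel) =
      (\<integral>\<^sup>+x. (\<lambda>x. \<eta> ((s - l (x - s *\<^sub>R u)) / k) * f x) (x + s *\<^sub>R u) \<partial>lborel)"
      by simp
    also have "\<dots> = (\<integral>\<^sup>+x. \<eta> ((s - l (x - s *\<^sub>R u)) / k) * f x \<partial>lborel)"
      by (rule nn_integral_lborel_translate) measurable
    finally show "(\<integral>\<^sup>+x. \<eta> ((s - l x) / k) * f (x + s *\<^sub>R u) \<partial>lborel) =
        (\<integral>\<^sup>+x. \<eta> (s + - l x / k) * f x \<partial>lborel)"
      by (simp only: eq)
  qed
  also have "\<dots> = (\<integral>\<^sup>+x. (\<integral>\<^sup>+s. \<eta> (s + - l x / k) * f x \<partial>lborel) \<partial>lborel)"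
    by (subst lborel_pair.Fubini') (auto simp: split_beta')
  also have "\<dots> = (\<integral>\<^sup>+x. f x \<partial>lborel)"
    by (subst nn_integral_multc) (auto simp only: \<eta>1, auto)
  finally show ?thesis by (simp add: I_def k_def l_def)
qed

text \<open>The nonnegative formula for indicators is read as an equality of measures; Bochner
  integrals then transform without any integrability condition on \<open>f\<close>.\<close>

lemma integral_lborel_rank_one:
  fixes f :: "'a::euclidean_space \<Rightarrow> real"
  assumes f[measurable]: "f \<in> borel_measurable borel" and k: "1 + q \<bullet> u \<noteq> 0"
  shows "(\<integral>x. f x \<partial>lborel) = \<bar>1 + q \<bullet> u\<bar> * (\<integral>x. f (x + (c + q \<bullet> x) *\<^sub>R u) \<partial>lborel)"
proof -
  let ?M = "\<lambda>x. x + (c + q \<bullet> x) *\<^sub>R u"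
  have [measurable]: "?M \<in> borel_measurable borel" by measurable
  have "(lborel :: 'a measure) = density (distr lborel borel ?M) (\<lambda>_. ennreal \<bar>1 + q \<bullet> u\<bar>)"
  proof (rule measure_eqI)
    fix A :: "'a set" assume "A \<in> sets lborel"
    then have [measurable]: "A \<in> sets borel" by simp
    have "emeasure lborel A = (\<integral>\<^sup>+x. indicator A x \<partial>lborel)" by simp
    also have "\<dots> = \<bar>1 + q \<bullet> u\<bar> * (\<integral>\<^sup>+x. indicator A (?M x) \<partial>lborel)"
      by (rule nn_integral_lborel_rank_one) (auto simp: k)
    also have "(\<integral>\<^sup>+x. indicator A (?M x) \<partial>lborel) = emeasure (distr lborel borel ?M) A"
      using nn_integral_distr[of ?M lborel borel "indicator A"] by simp
    finally show "emeasure lborel A = emeasure (density (distr lborel borel ?M) (\<lambda>_. ennreal \<bar>1 + q \<bullet> u\<bar>)) A"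
      by (simp add: emeasure_density nn_integral_cmult)
  qed simp
  then have "(\<integral>x. f x \<partial>lborel) = (\<integral>x. f x \<partial>density (distr lborel borel ?M) (\<lambda>_. ennreal \<bar>1 + q \<bullet> u\<bar>))"
    by simp
  also have "\<dots> = \<bar>1 + q \<bullet> u\<bar> * (\<integral>x. f (?M x) \<partial>lborel)"
    by (subst integral_density) (auto simp: integral_distr)
  finally show ?thesis .
qed

lemma nn_integral_lborel_affine:
  fixes f :: "'a::euclidean_space \<Rightarrow> ennreal"
  assumes [measurable]: "f \<in> borel_measurable borel" and "c \<noteq> 0"
  shows "(\<integral>\<^sup>+x. f x \<partial>lborel) = ennreal (\<bar>c\<bar> ^ DIM('a)) * (\<integral>\<^sup>+x. f (t + c *\<^sub>R x) \<partial>lborel)"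
  by (subst lborel_affine[OF assms(2), of t])
     (simp add: nn_integral_density nn_integral_distr nn_integral_cmult)

lemma integral_lborel_affine:
  fixes f :: "'a::euclidean_space \<Rightarrow> real"
  assumes [measurable]: "f \<in> borel_measurable borel" and "c \<noteq> 0"
  shows "(\<integral>x. f x \<partial>lborel) = \<bar>c\<bar> ^ DIM('a) * (\<integral>x. f (t + c *\<^sub>R x) \<partial>lborel)"
  by (subst lborel_affine[OF assms(2), of t])
     (simp add: integral_density integral_distr)

lemma set_integrable_compact_continuous:
  fixes f :: "'a::euclidean_space \<Rightarrow> 'b::euclidean_space"
  assumes "compact K" "continuous_on K f"
  shows "set_integrable lborel K f" "set_integrable lebesgue K f"
  using borel_integrable_compact[OF assms] unfolding set_integrable_def
  by (auto intro: integrable_completion[THEN iffD2, rotated])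

lemma LINT_lebesgue_eq_lborel:
  fixes f :: "'a::euclidean_space \<Rightarrow> 'b::euclidean_space"
  assumes "compact K" "continuous_on K f"
  shows "(LINT x:K|lebesgue. f x) = (LINT x:K|lborel. f x)"
  using set_integrable_compact_continuous(1)[OF assms] unfolding set_lebesgue_integral_def set_integrable_def
  by (intro integral_completion) auto

text \<open>The dilation with centre \<open>a\<close> and factor \<open>\<rho> < 1\<close> removes from \<open>K\<close> a layer along \<open>F\<close>, on which
  \<open>\<psi> = O(1 - \<rho>)\<close>; hence the derivative at \<open>\<rho> = 1\<close> of the integral of \<open>\<psi>\<close> over the dilated set vanishes.\<close>

lemma integral_cone_div_eq_0:
  fixes K :: "'a::euclidean_space set" and \<psi> :: "'a \<Rightarrow> real"
  assumes K: "compact K" "convex K" and a: "a \<in> K" and F: "F \<subseteq> K"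
    and cone: "\<And>x. x \<in> K \<Longrightarrow> \<exists>y\<in>F. \<exists>s\<in>{0..1}. x = a + s *\<^sub>R (y - a)"
    and \<psi>: "C1_with_grad \<psi> G" and \<psi>0: "\<And>y. y \<in> F \<Longrightarrow> \<psi> y = 0"
  shows "(LINT x:K|lebesgue. real DIM('a) * \<psi> x + G x \<bullet> (x - a)) = 0"
proof -
  let ?n = "DIM('a)"
  have c\<psi>: "continuous_on S \<psi>" and cG: "continuous_on S G" for S
    using C1_with_gradD[OF \<psi>] by auto
  have [measurable]: "\<psi> \<in> borel_measurable borel" "K \<in> sets borel"
    using c\<psi> K(1) by (auto intro: borel_measurable_continuous_onI borel_compact)
  define D where "D = diameter K"
  have D: "norm (x - y) \<le> D" if "x \<in> K" "y \<in> K" for x y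
    using diameter_bounded_bound[OF compact_imp_bounded[OF K(1)] that] by (simp add: D_def dist_norm)
  have "D \<ge> 0" using D[OF a a] by simp
  have "bounded (G ` K)"
    using compact_imp_bounded[OF compact_continuous_image[OF cG K(1)]] .
  then obtain L where L: "\<And>x. x \<in> K \<Longrightarrow> norm (G x) \<le> L" unfolding bounded_iff by blast
  have "L \<ge> 0" using L[OF a] norm_ge_zero order_trans by blast
  have lip: "\<bar>\<psi> x - \<psi> y\<bar> \<le> L * norm (x - y)" if "x \<in> K" "y \<in> K" for x y
  proof -
    have "norm (\<psi> x - \<psi> y) \<le> L * norm (x - y)"
    proof (rule differentiable_bound[OF K(2) _ _ that])
      fix z assume "z \<in> K"
      show "(\<psi> has_derivative (\<lambda>h. G z \<bullet> h)) (at z within K)" using C1_with_gradD(2)[OF \<psi>] .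
      show "onorm ((\<bullet>) (G z)) \<le> L"
        using L[OF \<open>z \<in> K\<close>] Cauchy_Schwarz_ineq2[of "G z"]
        by (intro onorm_le) (metis dual_order.trans mult_right_mono norm_ge_zero real_norm_def)
    qed
    then show ?thesis by simp
  qed
  have "bounded (\<psi> ` K)"
    using compact_imp_bounded[OF compact_continuous_image[OF c\<psi> K(1)]] .
  then obtain B where B: "\<And>x. x \<in> K \<Longrightarrow> \<bar>\<psi> x\<bar> \<le> B" unfolding bounded_iff by auto
  have "B \<ge> 0" using B[OF a] by linarith
  define m where "m = measure lborel K"
  \<comment> \<open>A sequence strictly between 0 and 1 that tends to 1; the shift by two keeps
    \<open>\<rho> 0\<close> positive.\<close>
  define \<rho> where "\<rho> k = 1 - inverse (real (Suc (Suc k)))" for k :: nat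
  have \<rho>: "0 < \<rho> k" "\<rho> k < 1" for k by (auto simp: \<rho>_def field_simps)
  have \<rho>lim: "\<rho> \<longlonglongrightarrow> 1"
    using tendsto_diff[OF tendsto_const[of 1] LIMSEQ_Suc[OF LIMSEQ_inverse_real_of_nat]]
    by (simp add: \<rho>_def[abs_def])
  define h where "h k x = a + \<rho> k *\<^sub>R (x - a)" for k x
  have hK: "h k x \<in> K" if "x \<in> K" for k x
    using convexD_alt[OF K(2) a that, of "\<rho> k"] \<rho>[of k] by (simp add: h_def algebra_simps)
  have h_aff: "h k x = (1 - \<rho> k) *\<^sub>R a + \<rho> k *\<^sub>R x" for k x
    by (simp add: h_def algebra_simps)
  have [measurable]: "h k \<in> borel_measurable borel" for k unfolding h_def by measurable
  have hh: "h k x = h k y \<longleftrightarrow> x = y" for k x y using \<rho>[of k] by (simp add: h_def)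
  have img[measurable]: "h k ` K \<in> sets borel" for k
  proof -
    have "compact (h k ` K)"
      unfolding h_def by (intro compact_continuous_image K continuous_intros)
    then show ?thesis by (rule borel_compact)
  qed
  \<comment> \<open>After substitution, \<open>A k\<close> is the integral of \<open>\<psi>\<close>
    over \<open>K\<close> minus that over the dilated set, divided by \<open>1 - \<rho> k\<close>.
    Its limit is computed twice: from the size of the removed layer and by dominated
    convergence.\<close>
  define A where "A k = (\<integral>x. indicator K x * ((\<psi> x - \<rho> k ^ ?n * \<psi> (h k x)) / (1 - \<rho> k)) \<partial>lborel)" for k
  have int\<psi>: "integrable lborel (\<lambda>x. indicator K x * \<psi> x)"
    using borel_integrable_compact[OF K(1) c\<psi>] by simp
  have int\<psi>h: "integrable lborel (\<lambda>x. indicator K x * \<psi> (h k x))" for k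
  proof -
    have "continuous_on K (\<lambda>x. \<psi> (h k x))"
      by (intro continuous_on_compose2[OF c\<psi>[of UNIV]]) (auto simp: h_def intro!: continuous_intros)
    then show ?thesis using borel_integrable_compact[OF K(1)] by fastforce
  qed
  have scale: "(\<integral>x. indicator (h k ` K) x * f x \<partial>lborel)
      = \<rho> k ^ ?n * (\<integral>x. indicator K x * f (h k x) \<partial>lborel)"
    if [measurable]: "f \<in> borel_measurable borel" for f :: "'a \<Rightarrow> real" and k
  proof -
    have "(\<integral>x. indicator (h k ` K) x * f x \<partial>lborel)
      = \<bar>\<rho> k\<bar> ^ ?n * (\<integral>x. indicator (h k ` K) ((1 - \<rho> k) *\<^sub>R a + \<rho> k *\<^sub>R x) * f ((1 - \<rho> k) *\<^sub>R a + \<rho> k *\<^sub>R x) \<partial>lborel)"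
      using \<rho>[of k] by (intro integral_lborel_affine) auto
    moreover have "indicat_real (h k ` K) (h k x) = indicator K x" for x
      using hh[of k] by (auto simp: indicator_def image_iff)
    ultimately show ?thesis using \<rho>[of k] by (simp add: h_aff[symmetric])
  qed
  have Abound: "\<bar>A k\<bar> \<le> L * D * (m * (1 - \<rho> k ^ ?n))" for k
  proof -
    have eps: "1 - \<rho> k > 0" using \<rho> by simp
    have sub: "h k ` K \<subseteq> K" using hK by auto
    have int2: "integrable lborel (\<lambda>x. indicator (h k ` K) x * \<psi> x)"
      using integrable_mult_indicator[OF _ int\<psi>, of "h k ` K"] sub img
      by (auto simp: indicator_inter_arith[symmetric] Int_absorb2 mult.assoc[symmetric])
    have m1: "(\<integral>x. indicat_real K x \<partial>lborel) = m" "integrable lborel (indicat_real K)"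
      using emeasure_compact_finite[OF K(1)] by (auto simp: m_def)
    have m2: "(\<integral>x. indicat_real (h k ` K) x \<partial>lborel) = \<rho> k ^ ?n * m"
      using scale[of "\<lambda>_. 1" k] by (simp add: m_def)
    have m3: "integrable lborel (indicat_real (h k ` K))"
      using emeasure_compact_finite[of "h k ` K"] emeasure_mono[OF sub] emeasure_compact_finite[OF K(1)]
      by (auto intro!: order.strict_trans1[OF emeasure_mono[OF sub]])
    have "(1 - \<rho> k) * A k = (\<integral>x. indicator K x * \<psi> x - \<rho> k ^ ?n * (indicator K x * \<psi> (h k x)) \<partial>lborel)"
      unfolding A_def integral_mult_right_zero[symmetric] using eps
      by (intro Bochner_Integration.integral_cong) (auto simp: field_simps)
    also have "\<dots> = (\<integral>x. indicator K x * \<psi> x \<partial>lborel) - \<rho> k ^ ?n * (\<integral>x. indicator K x * \<psi> (h k x) \<partial>lborel)"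
      using int\<psi> int\<psi>h by simp
    also have "\<dots> = (\<integral>x. indicator K x * \<psi> x \<partial>lborel) - (\<integral>x. indicator (h k ` K) x * \<psi> x \<partial>lborel)"
      by (simp add: scale)
    also have "\<dots> = (\<integral>x. indicator K x * \<psi> x - indicator (h k ` K) x * \<psi> x \<partial>lborel)"
      using int\<psi> int2 by simp
    finally have "\<bar>(1 - \<rho> k) * A k\<bar> \<le> (\<integral>x. \<bar>indicator K x * \<psi> x - indicator (h k ` K) x * \<psi> x\<bar> \<partial>lborel)"
      using integral_abs_bound by metis
    also have "\<dots> \<le> (\<integral>x. L * D * (1 - \<rho> k) * (indicator K x - indicator (h k ` K) x) \<partial>lborel)"
    proof (rule integral_mono)
      show "integrable lborel (\<lambda>x. \<bar>indicat_real K x * \<psi> x - indicat_real (h k ` K) x * \<psi> x\<bar>)"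
        using int\<psi> int2 by simp
      show "integrable lborel (\<lambda>x. L * D * (1 - \<rho> k) * (indicat_real K x - indicat_real (h k ` K) x))"
        using m1 m3 by simp
      fix x
      show "\<bar>indicat_real K x * \<psi> x - indicat_real (h k ` K) x * \<psi> x\<bar>
          \<le> L * D * (1 - \<rho> k) * (indicat_real K x - indicat_real (h k ` K) x)"
      proof (cases "x \<in> K \<and> x \<notin> h k ` K")
        case True
        then obtain y s where y: "y \<in> F" "0 \<le> s" "s \<le> 1" "x = a + s *\<^sub>R (y - a)" using cone by force
        \<comment> \<open>Otherwise \<open>x\<close> would be the dilate of the point
          \<open>z\<close> of the same ray, which lies in \<open>K\<close>.\<close>
        have "s > \<rho> k"
        proof (rule ccontr)
          assume "\<not> s > \<rho> k"
          define z where "z = a + (s / \<rho> k) *\<^sub>R (y - a)"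
          have "y \<in> K" using y F by auto
          have "z \<in> K"
            using convexD_alt[OF K(2) a \<open>y \<in> K\<close>, of "s / \<rho> k"] \<open>\<not> s > \<rho> k\<close> y \<rho>[of k]
            by (simp add: z_def algebra_simps)
          moreover have "x = h k z" using y \<rho>[of k] by (simp add: z_def h_def)
          ultimately show False using True by blast
        qed
        have "\<bar>\<psi> x - \<psi> y\<bar> \<le> L * norm (x - y)" using lip True y F by blast
        also have "x - y = (1 - s) *\<^sub>R (a - y)" using y by (simp add: algebra_simps)
        also have "L * norm ((1 - s) *\<^sub>R (a - y)) \<le> L * ((1 - \<rho> k) * D)"
          using y \<open>s > \<rho> k\<close> D[OF a, of y] F \<open>L \<ge> 0\<close> by (auto intro!: mult_left_mono mult_mono)
        finally show ?thesis using True \<psi>0[OF y(1)] by (simp add: mult_ac)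
      next
        case False
        then show ?thesis using sub by (auto simp: indicator_def)
      qed
    qed
    also have "\<dots> = L * D * (1 - \<rho> k) * (m - \<rho> k ^ ?n * m)"
      using m1 m2 m3 by simp
    also have "\<dots> = (1 - \<rho> k) * (L * D * (m * (1 - \<rho> k ^ ?n)))" by (simp add: algebra_simps)
    also have "\<bar>(1 - \<rho> k) * A k\<bar> = (1 - \<rho> k) * \<bar>A k\<bar>" using eps by (simp add: abs_mult)
    finally have "(1 - \<rho> k) * \<bar>A k\<bar> \<le> (1 - \<rho> k) * (L * D * (m * (1 - \<rho> k ^ ?n)))" .
    then show ?thesis using eps by simp
  qed
  have "A \<longlonglongrightarrow> 0"
  proof (rule Lim_null_comparison[of _ "\<lambda>k. L * D * (m * (1 - \<rho> k ^ ?n))"])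
    show "\<forall>\<^sub>F k in sequentially. norm (A k) \<le> L * D * (m * (1 - \<rho> k ^ ?n))"
      using Abound by simp
    have "(\<lambda>k. L * D * (m * (1 - \<rho> k ^ ?n))) \<longlonglongrightarrow> L * D * (m * (1 - 1 ^ ?n))"
      by (intro tendsto_intros \<rho>lim)
    then show "(\<lambda>k. L * D * (m * (1 - \<rho> k ^ ?n))) \<longlonglongrightarrow> 0" by simp
  qed
  moreover have "A \<longlonglongrightarrow> (\<integral>x. indicator K x * (real ?n * \<psi> x + G x \<bullet> (x - a)) \<partial>lborel)"
    unfolding A_def
  \<comment> \<open>The dominating constant comes from splitting off the change of the factor
    \<open>\<rho> k ^ ?n\<close>: the Lipschitz bound gives \<open>L * D\<close>, Bernoulli's
    inequality gives \<open>real ?n * B\<close>.\<close>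
  proof (rule integral_dominated_convergence[where w="\<lambda>x. (L * D + real ?n * B) * indicator K x"])
    show "(\<lambda>x. indicat_real K x * (real ?n * \<psi> x + G x \<bullet> (x - a))) \<in> borel_measurable lborel"
      using borel_measurable_continuous_onI[OF cG] by measurable
    show "integrable lborel (\<lambda>x. (L * D + real ?n * B) * indicat_real K x)"
      using emeasure_compact_finite[OF K(1)] by simp
    show "AE x in lborel. (\<lambda>k. indicat_real K x * ((\<psi> x - \<rho> k ^ ?n * \<psi> (h k x)) / (1 - \<rho> k)))
         \<longlonglongrightarrow> indicat_real K x * (real ?n * \<psi> x + G x \<bullet> (x - a))"
    proof (rule AE_I2)
      fix x :: 'a
      \<comment> \<open>The scaled function along the ray through \<open>x\<close>; its derivative
        at 1 is the divergence of \<open>\<psi> x *\<^sub>R (x - a)\<close>.\<close>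
      define \<phi> where "\<phi> t = t ^ ?n * \<psi> (a + t *\<^sub>R (x - a))" for t
      have "((\<lambda>t. \<psi> (a + t *\<^sub>R (x - a))) has_real_derivative (G x \<bullet> (x - a))) (at 1)"
      proof -
        have "((\<lambda>t. a + t *\<^sub>R (x - a)) has_derivative (\<lambda>t. t *\<^sub>R (x - a))) (at 1)"
          by (auto intro!: derivative_eq_intros)
        moreover have "(\<psi> has_derivative (\<lambda>h. G x \<bullet> h)) (at (a + 1 *\<^sub>R (x - a)))"
          using C1_with_gradD(2)[OF \<psi>, of x] by simp
        ultimately have "((\<lambda>t. \<psi> (a + t *\<^sub>R (x - a))) has_derivative (\<lambda>t. G x \<bullet> (t *\<^sub>R (x - a)))) (at 1)"
          by (rule has_derivative_compose)
        then show ?thesis by (simp add: has_field_derivative_def mult_commute_abs)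
      qed
      then have "(\<phi> has_real_derivative (real ?n * \<psi> x + G x \<bullet> (x - a))) (at 1)"
        unfolding \<phi>_def by (auto intro!: derivative_eq_intros)
      then have "((\<lambda>t. (\<phi> t - \<phi> 1) / (t - 1)) \<longlongrightarrow> real ?n * \<psi> x + G x \<bullet> (x - a)) (at 1)"
        by (simp add: has_field_derivative_iff)
      moreover have "filterlim \<rho> (at 1) sequentially"
        using \<rho>lim \<rho> by (intro filterlim_atI) (auto simp: less_imp_neq intro!: always_eventually)
      ultimately have "(\<lambda>k. (\<phi> (\<rho> k) - \<phi> 1) / (\<rho> k - 1)) \<longlonglongrightarrow> real ?n * \<psi> x + G x \<bullet> (x - a)"
        by (rule filterlim_compose)
      moreover have "(\<phi> (\<rho> k) - \<phi> 1) / (\<rho> k - 1) = (\<psi> x - \<rho> k ^ ?n * \<psi> (h k x)) / (1 - \<rho> k)" for k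
        by (simp add: \<phi>_def h_def) (metis minus_diff_eq minus_divide_divide)
      ultimately show "(\<lambda>k. indicat_real K x * ((\<psi> x - \<rho> k ^ ?n * \<psi> (h k x)) / (1 - \<rho> k)))
         \<longlonglongrightarrow> indicat_real K x * (real ?n * \<psi> x + G x \<bullet> (x - a))"
        by (intro tendsto_intros) simp
    qed
    fix k
    show "AE x in lborel. norm (indicat_real K x * ((\<psi> x - \<rho> k ^ ?n * \<psi> (h k x)) / (1 - \<rho> k)))
        \<le> (L * D + real ?n * B) * indicat_real K x"
    proof (rule AE_I2)
      fix x :: 'a
      show "norm (indicat_real K x * ((\<psi> x - \<rho> k ^ ?n * \<psi> (h k x)) / (1 - \<rho> k)))
        \<le> (L * D + real ?n * B) * indicat_real K x"
      proof (cases "x \<in> K")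
        case True
        have "\<bar>\<psi> x - \<psi> (h k x)\<bar> \<le> L * norm (x - h k x)" using lip True hK by blast
        also have "x - h k x = (1 - \<rho> k) *\<^sub>R (x - a)" by (simp add: h_def algebra_simps)
        also have "L * norm ((1 - \<rho> k) *\<^sub>R (x - a)) \<le> L * ((1 - \<rho> k) * D)"
          using \<rho>[of k] D[OF True a] \<open>L \<ge> 0\<close> by (auto intro!: mult_left_mono mult_mono)
        finally have 1: "\<bar>\<psi> x - \<psi> (h k x)\<bar> \<le> (1 - \<rho> k) * (L * D)" by (simp add: mult_ac)
        have "1 - \<rho> k ^ ?n \<le> real ?n * (1 - \<rho> k)"
          using Bernoulli_inequality[of "\<rho> k - 1" ?n] \<rho>[of k] by (simp add: algebra_simps)
        moreover have "0 \<le> 1 - \<rho> k ^ ?n" using \<rho>[of k] by (simp add: power_le_one less_imp_le)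
        ultimately have 2: "\<bar>(1 - \<rho> k ^ ?n) * \<psi> (h k x)\<bar> \<le> (real ?n * (1 - \<rho> k)) * B"
          using B[OF hK[OF True]] \<open>B \<ge> 0\<close> unfolding abs_mult by (intro mult_mono) auto
        have "\<psi> x - \<rho> k ^ ?n * \<psi> (h k x) = (\<psi> x - \<psi> (h k x)) + (1 - \<rho> k ^ ?n) * \<psi> (h k x)"
          by (simp add: algebra_simps)
        then have "\<bar>\<psi> x - \<rho> k ^ ?n * \<psi> (h k x)\<bar> \<le> (1 - \<rho> k) * (L * D) + (real ?n * (1 - \<rho> k)) * B"
          using 1 2 by linarith
        also have "\<dots> = (L * D + real ?n * B) * (1 - \<rho> k)" by (simp add: algebra_simps)
        finally show ?thesis using True \<rho>[of k] by (simp add: field_simps)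
      qed simp
    qed
  qed (auto intro: borel_measurable_integrable)
  ultimately have "(\<integral>x. indicator K x * (real ?n * \<psi> x + G x \<bullet> (x - a)) \<partial>lborel) = 0"
    using LIMSEQ_unique by blast
  moreover have "continuous_on K (\<lambda>x. real ?n * \<psi> x + G x \<bullet> (x - a))"
    by (intro continuous_intros c\<psi> cG)
  ultimately show ?thesis
    by (subst LINT_lebesgue_eq_lborel[OF K(1)]) (simp_all add: set_lebesgue_integral_def)
qed

section \<open>Divergence identities on simplices\<close>

lemma convex_hull_insert_cone:
  assumes "F \<noteq> {}" "x \<in> convex hull (insert a F)"
  shows "\<exists>y\<in>convex hull F. \<exists>s\<in>{0..1}. x = a + s *\<^sub>R (y - a)"
proof -
  obtain u v b where "u \<ge> 0" "v \<ge> 0" "u + v = 1" "b \<in> convex hull F" "x = u *\<^sub>R a + v *\<^sub>R b"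
    using assms by (auto simp: convex_hull_insert)
  moreover from this have "u = 1 - v" by simp
  then have "u *\<^sub>R a + v *\<^sub>R b = a + v *\<^sub>R (b - a)"
    by (simp add: scaleR_diff_left scaleR_diff_right)
  ultimately show ?thesis by (intro bexI[of _ b] bexI[of _ v]) auto
qed

text \<open>For each vertex \<open>k\<close> the field \<open>b k x *\<^sub>R (x - k)\<close> has no
  normal component on the boundary: \<open>x - k\<close> is tangential to the facets through
  \<open>k\<close>, and \<open>b k\<close> vanishes on the opposite one. So the cone identity with
  apex \<open>k\<close> applies to the product of \<open>b k\<close> and \<open>\<phi>\<close>, and
  summation over \<open>k\<close> gives the claim.\<close>

lemma simplex_bubble_integration_by_parts:
  fixes V :: "'a::euclidean_space set" and \<phi> :: "'a \<Rightarrow> real"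
  assumes V: "finite V" "card V \<ge> 2"
    and b: "\<And>k. k \<in> V \<Longrightarrow> C1_with_grad (b k) (B k)"
    and b0: "\<And>k x. k \<in> V \<Longrightarrow> x \<in> convex hull (V - {k}) \<Longrightarrow> b k x = 0"
    and \<phi>: "C1_with_grad \<phi> \<Phi>"
  shows "(LINT x:convex hull V|lebesgue. (\<Sum>k\<in>V. b k x *\<^sub>R (x - k)) \<bullet> \<Phi> x)
    = - (LINT x:convex hull V|lebesgue. (\<Sum>k\<in>V. real DIM('a) * b k x + B k x \<bullet> (x - k)) * \<phi> x)"
proof -
  let ?K = "convex hull V"
  have K: "compact ?K" "convex ?K" using V by (auto intro: finite_imp_compact_convex_hull)
  have cb: "continuous_on S (b k)" "continuous_on S (B k)" if "k \<in> V" for k S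
    using C1_with_gradD[OF b[OF that]] by auto
  have c\<phi>: "continuous_on S \<phi>" "continuous_on S \<Phi>" for S
    using C1_with_gradD[OF \<phi>] by auto
  have int: "set_integrable lebesgue ?K f" if "continuous_on ?K f" for f :: "'a \<Rightarrow> real"
    using set_integrable_compact_continuous(2)[OF K(1) that] .
  have zero: "(LINT x:?K|lebesgue. real DIM('a) * (b k x * \<phi> x) + (\<phi> x *\<^sub>R B k x + b k x *\<^sub>R \<Phi> x) \<bullet> (x - k)) = 0"
    if k: "k \<in> V" for k
  proof (rule integral_cone_div_eq_0[OF K, where F = "convex hull (V - {k})"])
    show "k \<in> ?K" using k by (simp add: hull_inc)
    show "convex hull (V - {k}) \<subseteq> ?K" by (simp add: hull_mono)
    have "V - {k} \<noteq> {}"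
      using V k by (metis card_le_Suc0_iff_eq Diff_eq_empty_iff numeral_2_eq_2 not_less_eq_eq singletonD subset_iff)
    then show "\<exists>y\<in>convex hull (V - {k}). \<exists>s\<in>{0..1}. x = k + s *\<^sub>R (y - k)" if "x \<in> ?K" for x
      using convex_hull_insert_cone[of "V - {k}" x k] that k by (simp add: insert_absorb)
    show "C1_with_grad (\<lambda>x. b k x * \<phi> x) (\<lambda>x. \<phi> x *\<^sub>R B k x + b k x *\<^sub>R \<Phi> x)"
      by (rule C1_with_grad_mult[OF b[OF k] \<phi>])
    show "b k y * \<phi> y = 0" if "y \<in> convex hull (V - {k})" for y using b0[OF k that] by simp
  qed
  have "(LINT x:?K|lebesgue. (\<Sum>k\<in>V. b k x *\<^sub>R (x - k)) \<bullet> \<Phi> x)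
     + (LINT x:?K|lebesgue. (\<Sum>k\<in>V. real DIM('a) * b k x + B k x \<bullet> (x - k)) * \<phi> x)
    = (LINT x:?K|lebesgue. (\<Sum>k\<in>V. b k x *\<^sub>R (x - k)) \<bullet> \<Phi> x
      + (\<Sum>k\<in>V. real DIM('a) * b k x + B k x \<bullet> (x - k)) * \<phi> x)"
    by (intro set_integral_add(2)[symmetric] int continuous_intros cb c\<phi>)
  also have "\<dots> = (LINT x:?K|lebesgue. (\<Sum>k\<in>V. real DIM('a) * (b k x * \<phi> x)
      + (\<phi> x *\<^sub>R B k x + b k x *\<^sub>R \<Phi> x) \<bullet> (x - k)))"
  proof -
    have "(\<Sum>k\<in>V. b k x *\<^sub>R (x - k)) \<bullet> \<Phi> x + (\<Sum>k\<in>V. real DIM('a) * b k x + B k x \<bullet> (x - k)) * \<phi> x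
      = (\<Sum>k\<in>V. real DIM('a) * (b k x * \<phi> x) + (\<phi> x *\<^sub>R B k x + b k x *\<^sub>R \<Phi> x) \<bullet> (x - k))" for x
      unfolding inner_sum_left sum_distrib_right sum.distrib[symmetric]
      by (intro sum.cong refl) (simp add: inner_add_left inner_commute[of "x - _"] ring_distribs mult_ac)
    then show ?thesis by simp
  qed
  also have "\<dots> = (\<Sum>k\<in>V. (LINT x:?K|lebesgue. real DIM('a) * (b k x * \<phi> x)
      + (\<phi> x *\<^sub>R B k x + b k x *\<^sub>R \<Phi> x) \<bullet> (x - k)))"
  proof -
    have "\<And>k. k \<in> V \<Longrightarrow> set_integrable lebesgue ?K (\<lambda>x. real DIM('a) * (b k x * \<phi> x)
      + (\<phi> x *\<^sub>R B k x + b k x *\<^sub>R \<Phi> x) \<bullet> (x - k))"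
      by (intro int continuous_intros cb c\<phi>)
    then show ?thesis
      unfolding set_lebesgue_integral_def set_integrable_def scaleR_sum_right
      by (intro Bochner_Integration.integral_sum) auto
  qed
  also have "\<dots> = 0" using zero by simp
  finally show ?thesis by simp
qed

lemma image_affine_convex_hull_rank_one:
  fixes q u :: "'a::euclidean_space"
  shows "(\<lambda>x. x + (c + q \<bullet> x) *\<^sub>R u) ` (convex hull S) = convex hull ((\<lambda>x. x + (c + q \<bullet> x) *\<^sub>R u) ` S)"
proof -
  let ?L = "\<lambda>x. x + (q \<bullet> x) *\<^sub>R u"
  have L: "linear ?L"
    by (rule linearI) (auto simp: algebra_simps inner_simps)
  have eq: "(\<lambda>x. x + (c + q \<bullet> x) *\<^sub>R u) ` S = (+) (c *\<^sub>R u) ` (?L ` S)" for S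
    by (auto simp: image_image algebra_simps)
  show ?thesis
    unfolding eq convex_hull_translation convex_hull_linear_image[OF L, symmetric] ..
qed

text \<open>By the divergence theorem each side is \<open>DIM('a)\<close> times the mean of
  \<open>\<phi>\<close> over the common facet. Surface integrals are avoided by an affine map
  \<open>M\<close> that fixes the facet pointwise and carries \<open>a1\<close> to
  \<open>a2\<close>: the difference of \<open>\<phi> (M x)\<close> and \<open>\<phi> x\<close>
  vanishes on the facet, so the cone identity annihilates it.\<close>

lemma simplex_face_flux_eq:
  fixes F :: "'a::euclidean_space set" and \<phi> :: "'a \<Rightarrow> real"
  assumes F: "finite F" "F \<noteq> {}"
    and l0: "\<And>y. y \<in> F \<Longrightarrow> c + q \<bullet> y = 0" and l1: "c + q \<bullet> a1 = 1" and l2: "c + q \<bullet> a2 \<noteq> 0"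
    and K1: "K1 = convex hull (insert a1 F)" and K2: "K2 = convex hull (insert a2 F)"
    and m1: "measure lebesgue K1 > 0"
    and \<phi>: "C1_with_grad \<phi> \<Phi>"
  shows "(LINT x:K1|lebesgue. real DIM('a) * \<phi> x + \<Phi> x \<bullet> (x - a1)) / measure lebesgue K1
       = (LINT x:K2|lebesgue. real DIM('a) * \<phi> x + \<Phi> x \<bullet> (x - a2)) / measure lebesgue K2"
proof -
  define u where "u = a2 - a1"
  define M where "M x = x + (c + q \<bullet> x) *\<^sub>R u" for x
  \<comment> \<open>\<open>k\<close> equals \<open>c + q \<bullet> a2\<close>; its absolute value is
    the ratio of the volume of \<open>K2\<close> to that of \<open>K1\<close>.\<close>
  define k where "k = 1 + q \<bullet> u"
  have k: "k \<noteq> 0" using l1 l2 by (simp add: k_def u_def inner_diff_right algebra_simps)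
  have Ma: "M a1 = a2" using l1 by (simp add: M_def u_def)
  have MF: "M y = y" if "y \<in> convex hull F" for y
  proof -
    have "convex hull F \<subseteq> {y. q \<bullet> y = - c}"
    proof (rule hull_minimal)
      show "F \<subseteq> {y. q \<bullet> y = - c}" using l0 by fastforce
    qed (rule convex_hyperplane)
    then show ?thesis using that by (auto simp: M_def)
  qed
  have K: "compact K1" "convex K1" "compact K2"
    using F by (auto simp: K1 K2 intro: finite_imp_compact_convex_hull)
  have [measurable]: "K1 \<in> sets borel" "K2 \<in> sets borel" using K by (auto intro: borel_compact)
  have img: "M ` K1 = K2"
    unfolding K1 K2 M_def image_affine_convex_hull_rank_one
    using Ma MF[OF hull_inc] by (auto simp: M_def[symmetric] intro!: arg_cong[of _ _ "\<lambda>S. convex hull S"])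
  have Mdiff: "M x - M y = (x - y) + (q \<bullet> (x - y)) *\<^sub>R u" for x y
    by (simp add: M_def algebra_simps inner_diff_right)
  have "inj M"
  proof (rule injI)
    fix x y assume "M x = M y"
    then have e: "(x - y) + (q \<bullet> (x - y)) *\<^sub>R u = 0" using Mdiff[of x y] by simp
    then have "q \<bullet> ((x - y) + (q \<bullet> (x - y)) *\<^sub>R u) = 0" by simp
    then have "(q \<bullet> (x - y)) * k = 0" by (simp add: k_def inner_add_right algebra_simps)
    then have "q \<bullet> (x - y) = 0" using k by simp
    then show "x = y" using e by simp
  qed
  then have ind: "indicat_real K2 (M x) = indicator K1 x" for x
    by (auto simp: indicator_def img[symmetric] inj_image_mem_iff)
  have cM: "continuous_on UNIV M" unfolding M_def by (intro continuous_intros)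
  have c\<phi>: "continuous_on S \<phi>" "continuous_on S \<Phi>" for S
    using C1_with_gradD[OF \<phi>] by auto
  have meas\<phi>[measurable]: "\<phi> \<in> borel_measurable borel" "\<Phi> \<in> borel_measurable borel"
    using borel_measurable_continuous_onI c\<phi> by blast+
  have subst: "(\<integral>x. indicator K2 x * f x \<partial>lborel) = \<bar>k\<bar> * (\<integral>x. indicator K1 x * f (M x) \<partial>lborel)"
    if [measurable]: "f \<in> borel_measurable borel" for f :: "'a \<Rightarrow> real"
    using integral_lborel_rank_one[of "\<lambda>x. indicator K2 x * f x" q u c] k
    by (simp add: M_def[symmetric] ind k_def)
  have meq: "measure lebesgue K2 = \<bar>k\<bar> * measure lebesgue K1"
    using subst[of "\<lambda>_. 1"] by simp
  define \<psi> where "\<psi> x = \<phi> (M x) - \<phi> x" for x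
  define G where "G x = (\<Phi> (M x) + (\<Phi> (M x) \<bullet> u) *\<^sub>R q) - \<Phi> x" for x
  have "C1_with_grad \<psi> G"
    unfolding C1_with_grad_def
  proof (intro conjI allI)
    have "continuous_on UNIV (\<lambda>x. \<Phi> (M x))"
      using continuous_on_compose2[OF c\<phi>(2) cM] by blast
    then show "continuous_on UNIV G" unfolding G_def by (intro continuous_intros c\<phi>)
    fix x
    have "(M has_derivative (\<lambda>h. h + (q \<bullet> h) *\<^sub>R u)) (at x)"
      unfolding M_def by (auto intro!: derivative_eq_intros)
    from has_derivative_compose[OF this C1_with_gradD(2)[OF \<phi>]]
    have "((\<lambda>x. \<phi> (M x)) has_derivative (\<lambda>h. \<Phi> (M x) \<bullet> (h + (q \<bullet> h) *\<^sub>R u))) (at x)" .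
    from has_derivative_diff[OF this C1_with_gradD(2)[OF \<phi>, of x]]
    have "(\<psi> has_derivative (\<lambda>h. \<Phi> (M x) \<bullet> (h + (q \<bullet> h) *\<^sub>R u) - \<Phi> x \<bullet> h)) (at x)"
      by (simp add: \<psi>_def[abs_def])
    moreover have "(\<lambda>h. \<Phi> (M x) \<bullet> (h + (q \<bullet> h) *\<^sub>R u) - \<Phi> x \<bullet> h) = (\<bullet>) (G x)"
      by (simp add: fun_eq_iff G_def inner_simps algebra_simps)
    ultimately show "(\<psi> has_derivative (\<bullet>) (G x)) (at x)" by simp
  qed
  have "(LINT x:K1|lebesgue. real DIM('a) * \<psi> x + G x \<bullet> (x - a1)) = 0"
  proof (rule integral_cone_div_eq_0[OF K(1,2), where F = "convex hull F"])
    show "a1 \<in> K1" "convex hull F \<subseteq> K1" by (auto simp: K1 hull_inc intro: hull_mono[THEN subsetD])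
    show "\<exists>y\<in>convex hull F. \<exists>s\<in>{0..1}. x = a1 + s *\<^sub>R (y - a1)" if "x \<in> K1" for x
      using convex_hull_insert_cone F that K1 by blast
    show "C1_with_grad \<psi> G" by fact
    show "\<psi> y = 0" if "y \<in> convex hull F" for y using MF[OF that] by (simp add: \<psi>_def)
  qed
  moreover have "real DIM('a) * \<psi> x + G x \<bullet> (x - a1) =
      (real DIM('a) * \<phi> (M x) + \<Phi> (M x) \<bullet> (M x - a2)) - (real DIM('a) * \<phi> x + \<Phi> x \<bullet> (x - a1))" for x
  proof -
    define d where "d = x - a1"
    have "M x - a2 = d + (q \<bullet> d) *\<^sub>R u" using Mdiff[of x a1] Ma by (simp add: d_def)
    then show ?thesis
      unfolding \<psi>_def G_def d_def[symmetric]
      by (simp add: inner_add_left inner_diff_left inner_add_right right_diff_distrib)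
  qed
  moreover have "continuous_on K1 (\<lambda>x. real DIM('a) * \<phi> (M x) + \<Phi> (M x) \<bullet> (M x - a2))"
    "continuous_on K1 (\<lambda>x. real DIM('a) * \<phi> x + \<Phi> x \<bullet> (x - a1))"
    by (intro continuous_intros c\<phi> continuous_on_compose2[OF c\<phi>(1)[of UNIV]]
         continuous_on_compose2[OF c\<phi>(2)[of UNIV]] continuous_on_subset[OF cM]; simp)+
  note co = this
  ultimately have eq: "(LINT x:K1|lebesgue. real DIM('a) * \<phi> (M x) + \<Phi> (M x) \<bullet> (M x - a2))
     = (LINT x:K1|lebesgue. real DIM('a) * \<phi> x + \<Phi> x \<bullet> (x - a1))"
    using set_integral_diff(2)[OF set_integrable_compact_continuous(2)[OF K(1) co(1)]
        set_integrable_compact_continuous(2)[OF K(1) co(2)]] by simp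
  have co2: "continuous_on K2 (\<lambda>x. real DIM('a) * \<phi> x + \<Phi> x \<bullet> (x - a2))"
    by (intro continuous_intros c\<phi>)
  have "(LINT x:K2|lebesgue. real DIM('a) * \<phi> x + \<Phi> x \<bullet> (x - a2))
      = \<bar>k\<bar> * (LINT x:K1|lebesgue. real DIM('a) * \<phi> (M x) + \<Phi> (M x) \<bullet> (M x - a2))"
    unfolding LINT_lebesgue_eq_lborel[OF K(3) co2] LINT_lebesgue_eq_lborel[OF K(1) co(1)]
    unfolding set_lebesgue_integral_def using subst[of "\<lambda>x. real DIM('a) * \<phi> x + \<Phi> x \<bullet> (x - a2)"] by simp
  then show ?thesis using k m1 eq by (simp add: meq)
qed

subsection \<open>A Poincare inequality on convex sets\<close>

text \<open>Undoing a scaling by \<open>t \<ge> 1/2\<close> costs at most the Jacobian factor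
  \<open>2 ^ DIM('a)\<close>.\<close>

lemma nn_integral_convex_combination_le:
  fixes q :: "'a::euclidean_space \<Rightarrow> ennreal"
  assumes [measurable]: "q \<in> borel_measurable borel" and t: "t \<ge> 1/2"
  shows "(\<integral>\<^sup>+y. q (x + t *\<^sub>R y) \<partial>lborel) \<le> 2 ^ DIM('a) * (\<integral>\<^sup>+y. q y \<partial>lborel)"
proof -
  have "1 \<le> (2 * t) ^ DIM('a)" using t by (intro one_le_power) auto
  then have "1 \<le> ennreal (2 ^ DIM('a)) * ennreal (t ^ DIM('a))"
    using t by (simp add: power_mult_distrib ennreal_mult[symmetric])
  then have "(\<integral>\<^sup>+y. q (x + t *\<^sub>R y) \<partial>lborel)
    \<le> (ennreal (2 ^ DIM('a)) * ennreal (t ^ DIM('a))) * (\<integral>\<^sup>+y. q (x + t *\<^sub>R y) \<partial>lborel)"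
    using mult_right_mono by fastforce
  also have "\<dots> = ennreal (2 ^ DIM('a)) * (\<integral>\<^sup>+y. q y \<partial>lborel)"
    using t nn_integral_lborel_affine[of q t x] by (simp add: mult.assoc)
  finally show ?thesis by (simp add: ennreal_power[symmetric])
qed

text \<open>The bound is integrated over all pairs of points. For each \<open>s\<close> one of
  \<open>\<theta> s\<close> and \<open>1 - \<theta> s\<close> is at least 1/2, and substituting in
  the corresponding variable costs only \<open>2 ^ DIM('a)\<close>, so the shape of \<open>K\<close>
  does not enter. Averaging over \<open>y\<close> singles out a good point.\<close>

lemma convex_poincare_nn_integral:
  fixes K :: "'a::euclidean_space set" and p Q :: "'a \<Rightarrow> real" and \<theta> :: "real \<Rightarrow> real"
  assumes K: "compact K" "convex K" and mK: "emeasure lborel K > 0"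
    and [measurable]: "p \<in> borel_measurable borel" "Q \<in> borel_measurable borel" "\<theta> \<in> borel_measurable borel"
    and \<theta>: "\<And>s. s \<in> {0..1} \<Longrightarrow> \<theta> s \<in> {0..1}"
    and fin: "(\<integral>\<^sup>+x. indicator K x * ennreal (Q x) \<partial>lborel) < \<infinity>"
    and bound: "\<And>x y. x \<in> K \<Longrightarrow> y \<in> K \<Longrightarrow> ennreal ((p x - p y)\<^sup>2)
      \<le> (\<integral>\<^sup>+s. indicator {0..1} s * ennreal (Q ((1 - \<theta> s) *\<^sub>R x + \<theta> s *\<^sub>R y)) \<partial>lborel)"
  shows "\<exists>y\<in>K. (\<integral>\<^sup>+x. indicator K x * ennreal ((p x - p y)\<^sup>2) \<partial>lborel)
      \<le> 2 ^ DIM('a) * (\<integral>\<^sup>+x. indicator K x * ennreal (Q x) \<partial>lborel)"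
proof -
  have [measurable]: "K \<in> sets borel" using K by (auto intro: borel_compact)
  let ?z = "\<lambda>s x y. (1 - \<theta> s) *\<^sub>R x + \<theta> s *\<^sub>R y"
  define N where "N = (\<integral>\<^sup>+x. indicator K x * ennreal (Q x) \<partial>lborel)"
  \<comment> \<open>Cut off outside \<open>K\<close>, so that the domain may be enlarged to the
    whole space before each substitution.\<close>
  define q where "q x = indicator K x * ennreal (Q x)" for x
  have [measurable]: "q \<in> borel_measurable borel" unfolding q_def by measurable
  define F where "F y = (\<integral>\<^sup>+x. indicator K x * ennreal ((p x - p y)\<^sup>2) \<partial>lborel)" for y
  have [measurable]: "F \<in> borel_measurable borel" unfolding F_def by measurable
  have emK: "emeasure lborel K < \<infinity>" using emeasure_compact_finite[OF K(1)] by simp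
  have inner: "(\<integral>\<^sup>+y. (\<integral>\<^sup>+x. indicator K y * (indicator K x * q (?z s x y)) \<partial>lborel) \<partial>lborel)
      \<le> emeasure lborel K * (2 ^ DIM('a) * N)" if s: "s \<in> {0..1}" for s
  proof (cases "\<theta> s \<ge> 1/2")
    case True
    have "(\<integral>\<^sup>+y. (\<integral>\<^sup>+x. indicator K y * (indicator K x * q (?z s x y)) \<partial>lborel) \<partial>lborel)
       = (\<integral>\<^sup>+x. (\<integral>\<^sup>+y. indicator K y * (indicator K x * q (?z s x y)) \<partial>lborel) \<partial>lborel)"
      by (rule lborel_pair.Fubini') measurable
    also have "\<dots> \<le> (\<integral>\<^sup>+x. (\<integral>\<^sup>+y. indicator K x * q (?z s x y) \<partial>lborel) \<partial>lborel)"
      by (intro nn_integral_mono) (auto simp: indicator_def)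
    also have "\<dots> = (\<integral>\<^sup>+x. indicator K x * (\<integral>\<^sup>+y. q (?z s x y) \<partial>lborel) \<partial>lborel)"
      by (simp add: nn_integral_cmult)
    also have "\<dots> \<le> (\<integral>\<^sup>+x. indicator K x * (2 ^ DIM('a) * N) \<partial>lborel)"
      using nn_integral_convex_combination_le[OF _ True, of q]
      by (intro nn_integral_mono mult_left_mono) (auto simp: N_def q_def)
    finally show ?thesis by (simp add: nn_integral_multc)
  next
    case False
    have "(\<integral>\<^sup>+y. (\<integral>\<^sup>+x. indicator K y * (indicator K x * q (?z s x y)) \<partial>lborel) \<partial>lborel)
       \<le> (\<integral>\<^sup>+y. (\<integral>\<^sup>+x. indicator K y * q (?z s x y) \<partial>lborel) \<partial>lborel)"
      by (intro nn_integral_mono) (auto simp: indicator_def)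
    also have "\<dots> = (\<integral>\<^sup>+y. indicator K y * (\<integral>\<^sup>+x. q (\<theta> s *\<^sub>R y + (1 - \<theta> s) *\<^sub>R x) \<partial>lborel) \<partial>lborel)"
      by (simp add: nn_integral_cmult add.commute)
    also have "\<dots> \<le> (\<integral>\<^sup>+y. indicator K y * (2 ^ DIM('a) * N) \<partial>lborel)"
      using nn_integral_convex_combination_le[of q "1 - \<theta> s"] False
      by (intro nn_integral_mono mult_left_mono) (auto simp: N_def q_def)
    finally show ?thesis by (simp add: nn_integral_multc)
  qed
  have zK: "?z s x y \<in> K" if "s \<in> {0..1}" "x \<in> K" "y \<in> K" for s x y
    using convexD_alt[OF K(2) that(2,3), of "\<theta> s"] \<theta>[OF that(1)] by simp
  have "(\<integral>\<^sup>+y. indicator K y * F y \<partial>lborel)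
     = (\<integral>\<^sup>+y. (\<integral>\<^sup>+x. indicator K y * (indicator K x * ennreal ((p x - p y)\<^sup>2)) \<partial>lborel) \<partial>lborel)"
    by (simp add: F_def nn_integral_cmult)
  also have "\<dots> \<le> (\<integral>\<^sup>+y. (\<integral>\<^sup>+x. (\<integral>\<^sup>+s. indicator {0..1} s *
       (indicator K y * (indicator K x * q (?z s x y))) \<partial>lborel) \<partial>lborel) \<partial>lborel)"
  proof (intro nn_integral_mono)
    fix x y :: 'a
    show "indicator K y * (indicator K x * ennreal ((p x - p y)\<^sup>2))
      \<le> (\<integral>\<^sup>+s. indicator {0..1} s * (indicator K y * (indicator K x * q (?z s x y))) \<partial>lborel)"
    proof (cases "x \<in> K \<and> y \<in> K")
      case True
      have "(\<integral>\<^sup>+s. indicator {0..1} s * (indicator K y * (indicator K x * q (?z s x y))) \<partial>lborel)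
        = (\<integral>\<^sup>+s. indicator {0..1} s * ennreal (Q (?z s x y)) \<partial>lborel)"
        using True zK by (intro nn_integral_cong) (auto simp: indicator_def q_def)
      then show ?thesis using bound True by simp
    qed auto
  qed
  also have "\<dots> = (\<integral>\<^sup>+y. (\<integral>\<^sup>+s. (\<integral>\<^sup>+x. indicator {0..1} s *
       (indicator K y * (indicator K x * q (?z s x y))) \<partial>lborel) \<partial>lborel) \<partial>lborel)"
    by (intro nn_integral_cong lborel_pair.Fubini') measurable
  also have "\<dots> = (\<integral>\<^sup>+s. (\<integral>\<^sup>+y. (\<integral>\<^sup>+x. indicator {0..1} s *
       (indicator K y * (indicator K x * q (?z s x y))) \<partial>lborel) \<partial>lborel) \<partial>lborel)"
    by (rule lborel_pair.Fubini') measurable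
  also have "\<dots> = (\<integral>\<^sup>+s. indicator {0..1} s * (\<integral>\<^sup>+y. (\<integral>\<^sup>+x.
       (indicator K y * (indicator K x * q (?z s x y))) \<partial>lborel) \<partial>lborel) \<partial>lborel)"
    by (simp add: nn_integral_cmult)
  also have "\<dots> \<le> (\<integral>\<^sup>+s. indicator {0..1::real} s * (emeasure lborel K * (2 ^ DIM('a) * N)) \<partial>lborel)"
  proof (intro nn_integral_mono)
    fix s :: real
    show "indicator {0..1} s * (\<integral>\<^sup>+y. (\<integral>\<^sup>+x. (indicator K y * (indicator K x * q (?z s x y))) \<partial>lborel) \<partial>lborel)
      \<le> indicator {0..1} s * (emeasure lborel K * (2 ^ DIM('a) * N))"
      using inner[of s] by (cases "s \<in> {0..1}") auto
  qed
  also have "\<dots> = (\<integral>\<^sup>+y. indicator K y * (2 ^ DIM('a) * N) \<partial>lborel)"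
    by (simp add: nn_integral_multc)
  finally have le: "(\<integral>\<^sup>+y. indicator K y * F y \<partial>lborel) \<le> (\<integral>\<^sup>+y. indicator K y * (2 ^ DIM('a) * N) \<partial>lborel)" .
  \<comment> \<open>Some value is at most the average: otherwise integration over \<open>K\<close>,
    which has positive measure, would give a strict inequality between finite quantities.\<close>
  have "\<exists>y\<in>K. F y \<le> 2 ^ DIM('a) * N"
  proof (rule ccontr)
    assume "\<not> ?thesis"
    then have gt: "F y > 2 ^ DIM('a) * N" if "y \<in> K" for y using that by force
    have "(\<integral>\<^sup>+y. indicator K y * (2 ^ DIM('a) * N) \<partial>lborel) < (\<integral>\<^sup>+y. indicator K y * F y \<partial>lborel)"
    proof (rule nn_integral_less)
      show "(\<integral>\<^sup>+y. indicator K y * (2 ^ DIM('a) * N) \<partial>lborel) \<noteq> \<infinity>"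
        using emK fin by (simp add: nn_integral_multc N_def ennreal_mult_eq_top_iff power_eq_top_ennreal less_top[symmetric])
      show "AE y in lborel. indicator K y * (2 ^ DIM('a) * N) \<le> indicator K y * F y"
        using gt by (intro AE_I2) (auto simp: indicator_def less_imp_le)
      show "\<not> (AE y in lborel. indicator K y * F y \<le> indicator K y * (2 ^ DIM('a) * N))"
      proof
        assume "AE y in lborel. indicator K y * F y \<le> indicator K y * (2 ^ DIM('a) * N)"
        then have "AE y in lborel. y \<notin> K"
          by (rule AE_mp) (use gt in \<open>auto simp: not_le indicator_def intro!: AE_I2\<close>)
        then have "emeasure lborel K = 0"
          by (subst (asm) AE_iff_measurable[of K]) auto
        then show False using mK by simp
      qed
    qed measurable
    then show False using le by simp
  qed
  then show ?thesis by (simp add: F_def N_def)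
qed

text \<open>The reparametrisation \<open>\<theta>\<close> of the segments is left free: the identity
  serves the piecewise affine interpolant, a smoothstep the weighted inequality on a
  simplex.\<close>

lemma convex_poincare:
  fixes K :: "'a::euclidean_space set" and p Q :: "'a \<Rightarrow> real" and \<theta> :: "real \<Rightarrow> real"
  assumes K: "compact K" "convex K" and mK: "measure lebesgue K > 0"
    and [measurable]: "p \<in> borel_measurable borel" "Q \<in> borel_measurable borel" "\<theta> \<in> borel_measurable borel"
    and \<theta>: "\<And>s. s \<in> {0..1} \<Longrightarrow> \<theta> s \<in> {0..1}"
    and Q: "\<And>x. x \<in> K \<Longrightarrow> Q x \<ge> 0" "set_integrable lebesgue K Q"
    and bound: "\<And>x y. x \<in> K \<Longrightarrow> y \<in> K \<Longrightarrow> ennreal ((p x - p y)\<^sup>2)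
      \<le> (\<integral>\<^sup>+s. indicator {0..1} s * ennreal (Q ((1 - \<theta> s) *\<^sub>R x + \<theta> s *\<^sub>R y)) \<partial>lborel)"
  obtains y where "y \<in> K" "set_integrable lebesgue K (\<lambda>x. (p x - p y)\<^sup>2)"
    "(LINT x:K|lebesgue. (p x - p y)\<^sup>2) \<le> 2 ^ DIM('a) * (LINT x:K|lebesgue. Q x)"
proof -
  have [measurable]: "K \<in> sets borel" using K by (auto intro: borel_compact)
  have mb: "(\<lambda>x. indicat_real K x * Q x) \<in> borel_measurable lborel" by measurable
  have iQ: "integrable lborel (\<lambda>x. indicat_real K x * Q x)"
    using Q(2) integrable_completion[OF mb] by (simp add: set_integrable_def)
  have conv: "(\<integral>\<^sup>+x. indicator K x * ennreal (f x) \<partial>lborel) = (\<integral>\<^sup>+x. ennreal (indicat_real K x * f x) \<partial>lborel)" for f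
    by (intro nn_integral_cong) (auto simp: indicator_def)
  have N: "(\<integral>\<^sup>+x. indicator K x * ennreal (Q x) \<partial>lborel) = ennreal (LINT x:K|lebesgue. Q x)"
    unfolding conv using Q(1) integral_completion[OF mb]
    by (subst nn_integral_eq_integral[OF iQ]) (auto simp: set_lebesgue_integral_def indicator_def)
  have em: "emeasure lborel K > 0"
    using mK by (simp add: measure_def enn2real_positive_iff)
  obtain y where y: "y \<in> K" "(\<integral>\<^sup>+x. indicator K x * ennreal ((p x - p y)\<^sup>2) \<partial>lborel)
      \<le> 2 ^ DIM('a) * (\<integral>\<^sup>+x. indicator K x * ennreal (Q x) \<partial>lborel)"
    using convex_poincare_nn_integral[of K p Q \<theta>] K em \<theta> N bound by auto
  have "2 ^ DIM('a) * ennreal (LINT x:K|lebesgue. Q x) = ennreal (2 ^ DIM('a) * (LINT x:K|lebesgue. Q x))"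
    by (subst ennreal_mult') (auto simp: ennreal_power[symmetric])
  then have le: "(\<integral>\<^sup>+x. ennreal (indicat_real K x * (p x - p y)\<^sup>2) \<partial>lborel) \<le> ennreal (2 ^ DIM('a) * (LINT x:K|lebesgue. Q x))"
    using y(2) by (simp only: N conv[symmetric])
  have mb2: "(\<lambda>x. indicat_real K x * (p x - p y)\<^sup>2) \<in> borel_measurable lborel" by measurable
  have i2: "integrable lborel (\<lambda>x. indicat_real K x * (p x - p y)\<^sup>2)"
    using le by (intro integrableI_nonneg) (auto simp: le_less_trans)
  have Qnn: "0 \<le> (LINT x:K|lebesgue. Q x)"
    unfolding set_lebesgue_integral_def by (rule integral_nonneg_AE) (use Q(1) in \<open>auto simp: indicator_def\<close>)
  have "ennreal (\<integral>x. indicat_real K x * (p x - p y)\<^sup>2 \<partial>lborel) \<le> ennreal (2 ^ DIM('a) * (LINT x:K|lebesgue. Q x))"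
    using le by (subst (asm) nn_integral_eq_integral[OF i2]) auto
  then have "(\<integral>x. indicat_real K x * (p x - p y)\<^sup>2 \<partial>lborel) \<le> 2 ^ DIM('a) * (LINT x:K|lebesgue. Q x)"
    using Qnn by (simp add: ennreal_le_iff)
  with y(1) i2 show ?thesis
    by (intro that[of y]) (auto simp: set_integrable_def set_lebesgue_integral_def integral_completion[OF mb2] integrable_completion[OF mb2])
qed

subsection \<open>Simplicial meshes\<close>

lemma affine_function_extension:
  fixes V :: "'a::euclidean_space set" and val :: "'a \<Rightarrow> real"
  assumes "\<not> affine_dependent V"
  obtains c q where "\<And>v. v \<in> V \<Longrightarrow> c + q \<bullet> v = val v"
proof (cases "V = {}")
  case False
  then obtain a where a: "a \<in> V" by auto
  let ?S = "(\<lambda>x. - a + x) ` (V - {a})"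
  have "independent ?S"
    using assms affine_dependent_iff_dependent[of a "V - {a}"] a by (auto simp: insert_absorb)
  then obtain g :: "'a \<Rightarrow> real" where g: "linear g" "\<And>x. x \<in> ?S \<Longrightarrow> g x = val (x + a) - val a"
    using linear_independent_extend[of ?S "\<lambda>x. val (x + a) - val a"] by blast
  define q where "q = (\<Sum>b\<in>Basis. g b *\<^sub>R b)"
  have gq: "g x = q \<bullet> x" for x
  proof -
    have "g x = g (\<Sum>b\<in>Basis. (x \<bullet> b) *\<^sub>R b)" by (simp add: euclidean_representation)
    also have "\<dots> = (\<Sum>b\<in>Basis. (x \<bullet> b) * g b)"
      by (simp add: linear_sum[OF g(1)] linear_scale[OF g(1)])
    also have "\<dots> = q \<bullet> x"
      unfolding q_def inner_sum_left by (intro sum.cong refl) (simp add: inner_commute mult.commute)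
    finally show ?thesis .
  qed
  have "(val a - q \<bullet> a) + q \<bullet> v = val v" if "v \<in> V" for v
  proof (cases "v = a")
    case False
    then have "- a + v \<in> ?S" using that by auto
    from g(2)[OF this] have "q \<bullet> (- a + v) = val v - val a" unfolding gq by simp
    then show ?thesis by (simp add: inner_diff_right)
  qed simp
  then show ?thesis by (rule that)
qed (auto intro: that)

text \<open>Across the ball, in the direction of \<open>q\<close>, the affine function varies by
  \<open>norm q * (2 * \<rho>)\<close>.\<close>

lemma affine_gradient_bound:
  fixes q :: "'a::euclidean_space"
  assumes "ball x \<rho> \<subseteq> K" "\<rho> > 0" and M: "\<And>y z. y \<in> K \<Longrightarrow> z \<in> K \<Longrightarrow> q \<bullet> y - q \<bullet> z \<le> M"
  shows "norm q * (2 * \<rho>) \<le> M"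
proof (cases "q = 0")
  case True
  then show ?thesis using M[of x x] assms(1,2) by (auto simp: subset_iff)
next
  case False
  \<comment> \<open>The ball is open, so antipodal points are taken at radius
    \<open>s * \<rho>\<close> with \<open>s < 1\<close>, and \<open>s\<close> tends to 1 at the
    end.\<close>
  have "norm q * (2 * (s * \<rho>)) \<le> M" if s: "0 \<le> s" "s < 1" for s
  proof -
    define d where "d = (s * \<rho> / norm q) *\<^sub>R q"
    have "norm d < \<rho>" using False s assms(2) by (simp add: d_def)
    then have "x + d \<in> K" "x - d \<in> K" using assms(1) by (auto simp: dist_norm subset_iff)
    from M[OF this] have "2 * (q \<bullet> d) \<le> M" by (simp add: inner_diff_right inner_add_right)
    moreover have "q \<bullet> d = s * \<rho> * norm q"
      using False by (simp add: d_def dot_square_norm power2_eq_square)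
    ultimately show ?thesis by (simp add: mult_ac)
  qed
  note * = this
  have lim: "((\<lambda>s. norm q * (2 * (s * \<rho>))) \<longlongrightarrow> norm q * (2 * (1 * \<rho>))) (at_left 1)"
    by (intro tendsto_intros)
  have ev: "eventually (\<lambda>s. norm q * (2 * (s * \<rho>)) \<le> M) (at_left (1::real))"
    using * by (intro eventually_at_leftI[of 0]) auto
  show ?thesis
    using tendsto_upperbound[OF lim ev] by simp
qed

lemma convex_hull_inner_diff_le:
  fixes q :: "'a::euclidean_space"
  assumes "\<And>u v. u \<in> V \<Longrightarrow> v \<in> V \<Longrightarrow> q \<bullet> u - q \<bullet> v \<le> M" "y \<in> convex hull V" "z \<in> convex hull V"
  shows "q \<bullet> y - q \<bullet> z \<le> M"
proof -
  have 1: "q \<bullet> y \<le> M + q \<bullet> v" if "v \<in> V" for v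
  proof -
    have "convex hull V \<subseteq> {y. q \<bullet> y \<le> M + q \<bullet> v}"
    proof (rule hull_minimal)
      show "V \<subseteq> {y. q \<bullet> y \<le> M + q \<bullet> v}" using assms(1)[OF _ that] by force
    qed (rule convex_halfspace_le)
    then show ?thesis using assms(2) by auto
  qed
  have "convex hull V \<subseteq> {z. q \<bullet> z \<ge> q \<bullet> y - M}"
  proof (rule hull_minimal)
    show "V \<subseteq> {z. q \<bullet> z \<ge> q \<bullet> y - M}" using 1 by force
  qed (rule convex_halfspace_ge)
  then show ?thesis using assms(3) by auto
qed

lemma convex_hull_affine_le:
  fixes q :: "'a::euclidean_space"
  assumes "\<And>u. u \<in> V \<Longrightarrow> \<bar>c + q \<bullet> u\<bar> \<le> M" "y \<in> convex hull V"
  shows "\<bar>c + q \<bullet> y\<bar> \<le> M"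
proof -
  have "convex hull V \<subseteq> {y. q \<bullet> y \<le> M - c}" "convex hull V \<subseteq> {y. q \<bullet> y \<ge> - M - c}"
    using assms(1) by (intro hull_minimal; force simp: convex_halfspace_ge convex_halfspace_le abs_le_iff)+
  then show ?thesis using assms(2) by force
qed

text \<open>The barycentric coordinate of \<open>u\<close> varies by at most 1 on the simplex, so
  the inscribed ball bounds its gradient by \<open>1 / (2 * \<rho>)\<close>; along the edge it
  varies by exactly 1.\<close>

lemma simplex_edge_ge:
  fixes V :: "'a::euclidean_space set"
  assumes "\<not> affine_dependent V" "u \<in> V" "v \<in> V" "u \<noteq> v" "ball x \<rho> \<subseteq> convex hull V" "\<rho> > 0"
  shows "2 * \<rho> \<le> dist u v"
proof -
  obtain c q where q: "\<And>w. w \<in> V \<Longrightarrow> c + q \<bullet> w = (if w = u then 1 else 0)"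
    using affine_function_extension[OF assms(1), of "\<lambda>w. if w = u then 1 else 0"] by blast
  have "norm q * (2 * \<rho>) \<le> 1"
  proof (rule affine_gradient_bound[OF assms(5,6)])
    fix y z assume yz: "y \<in> convex hull V" "z \<in> convex hull V"
    show "q \<bullet> y - q \<bullet> z \<le> 1"
    proof (rule convex_hull_inner_diff_le[OF _ yz])
      fix a b assume "a \<in> V" "b \<in> V"
      then show "q \<bullet> a - q \<bullet> b \<le> 1" using q[of a] q[of b] by (auto split: if_splits)
    qed
  qed
  moreover have "1 \<le> norm q * dist u v"
    using q[OF assms(2)] q[OF assms(3)] assms(4) norm_cauchy_schwarz[of q "u - v"]
    by (simp add: inner_diff_right dist_norm)
  ultimately have "norm q * (2 * \<rho>) \<le> norm q * dist u v" by linarith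
  moreover have "norm q > 0" using \<open>1 \<le> norm q * dist u v\<close> by (cases "q = 0") auto
  ultimately show ?thesis by simp
qed

section \<open>Full-dimensional simplices and conforming meshes\<close>

lemma full_simplex_interior:
  fixes K :: "'a::euclidean_space set"
  assumes "int DIM('a) simplex K"
  shows "interior K \<noteq> {}" "closure (interior K) = K" "compact K" "convex K" "measure lebesgue K > 0"
proof -
  show c: "compact K" "convex K" using assms compact_simplex convex_simplex by auto
  have ne: "K \<noteq> {}" using assms by force
  have "aff_dim K = DIM('a)" using aff_dim_simplex[OF assms] .
  then have "rel_interior K = interior K"
    by (simp add: rel_interior_interior aff_dim_eq_full)
  then show i: "interior K \<noteq> {}" using rel_interior_eq_empty[OF c(2)] ne by simp
  then show "closure (interior K) = K"
    using convex_closure_interior[OF c(2)] compact_imp_closed[OF c(1)] by simp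
  then obtain x e where "e > 0" "ball x e \<subseteq> K" using i mem_interior by blast
  note e = this
  have "0 < measure lborel (ball x e)" using e(1) by (rule content_ball_pos)
  also have "\<dots> \<le> measure lebesgue K"
    using measure_mono_fmeasurable[OF e(2), of lebesgue] lmeasurable_compact[OF c(1)] by simp
  finally show "measure lebesgue K > 0" .
qed

text \<open>The covered set is a parameter, so that the notion applies to
  \<open>closure \<Omega>\<close> and also to the fine elements inside a single coarse cell.\<close>

definition simplicial_mesh :: "'a::euclidean_space set set \<Rightarrow> 'a set \<Rightarrow> bool" where
  "simplicial_mesh M T \<longleftrightarrow>
     triangulation M \<and> (\<forall>K\<in>M. int DIM('a) simplex K) \<and> \<Union>M = T"

lemma simplicial_meshD:
  assumes "simplicial_mesh M T"
  shows "finite M" "\<And>K. K \<in> M \<Longrightarrow> int DIM('a::euclidean_space) simplex (K :: 'a set)" "\<Union>M = T"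
    "\<And>K K'. K \<in> M \<Longrightarrow> K' \<in> M \<Longrightarrow> K \<inter> K' face_of K"
  using assms by (auto simp: simplicial_mesh_def triangulation_def)

text \<open>If \<open>K'\<close> meets the interior of \<open>K\<close>, the common face is all of
  \<open>K\<close>; then \<open>K\<close> is a face of \<open>K'\<close> of full dimension, hence
  equal to it.\<close>

lemma mesh_interior_disjoint:
  fixes K :: "'a::euclidean_space set"
  assumes M: "simplicial_mesh M T" and K: "K \<in> M" "K' \<in> M" "K \<noteq> K'"
  shows "interior K \<inter> K' = {}"
proof (rule ccontr)
  assume ne: "interior K \<inter> K' \<noteq> {}"
  have f: "K \<inter> K' face_of K" "K' \<inter> K face_of K'" using simplicial_meshD(4)[OF M] K by auto
  have "K \<inter> K' = K"
  proof (rule ccontr)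
    assume "K \<inter> K' \<noteq> K"
    then have "K \<inter> K' \<inter> interior K = {}"
      using face_of_disjoint_interior[OF f(1)] by blast
    then show False using ne interior_subset by blast
  qed
  then have "K face_of K'" using f(2) by (simp add: Int_commute)
  moreover have "aff_dim K = aff_dim K'"
    using aff_dim_simplex simplicial_meshD(2)[OF M] K by metis
  ultimately have "K = K'"
    using face_of_aff_dim_lt[of K' K] full_simplex_interior(4)[OF simplicial_meshD(2)[OF M K(2)]] by force
  then show False using K by simp
qed

lemma full_simplex_vertices:
  fixes K :: "'a::euclidean_space set"
  assumes "int DIM('a) simplex K"
  defines "V \<equiv> {v. v extreme_point_of K}"
  shows "\<not> affine_dependent V" "card V = Suc (DIM('a))" "finite V" "K = convex hull V"
proof -
  obtain C where C: "\<not> affine_dependent C" "int (card C) = int DIM('a) + 1" "K = convex hull C"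
    using assms(1) unfolding simplex_def by blast
  have "V = C" unfolding V_def C(3) using extreme_point_of_convex_hull_affine_independent[OF C(1)] by blast
  then show "\<not> affine_dependent V" "card V = Suc (DIM('a))" "finite V" "K = convex hull V"
    using C aff_independent_finite by auto
qed

text \<open>The affine function vanishing on the facet is kept along with the vertices, since it
  defines the map between the two simplices in \<open>simplex_face_flux_eq\<close>. It is nonzero at
  \<open>a2\<close>, as \<open>K2\<close> would otherwise lie in a hyperplane.\<close>

lemma mesh_facet_neighbours:
  fixes K1 :: "'a::euclidean_space set"
  assumes M: "simplicial_mesh M T" and K: "K1 \<in> M" "K2 \<in> M" "K1 \<noteq> K2"
    and dim: "aff_dim (K1 \<inter> K2) = int DIM('a) - 1"
  obtains F a1 a2 c q where "finite F" "card F = DIM('a)" "a1 \<notin> F" "a2 \<notin> F"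
    "K1 = convex hull (insert a1 F)" "K2 = convex hull (insert a2 F)"
    "\<not> affine_dependent (insert a1 F)" "\<not> affine_dependent (insert a2 F)"
    "\<And>y. y \<in> F \<Longrightarrow> c + q \<bullet> y = 0" "c + q \<bullet> a1 = 1" "c + q \<bullet> a2 \<noteq> 0"
proof -
  define V where "V K = {v. v extreme_point_of K}" for K :: "'a set"
  have V: "\<not> affine_dependent (V K)" "card (V K) = Suc (DIM('a))" "finite (V K)" "K = convex hull (V K)"
    if "K \<in> M" for K
    using full_simplex_vertices[OF simplicial_meshD(2)[OF M that]] by (auto simp: V_def)
  define F where "F = {v. v extreme_point_of (K1 \<inter> K2)}"
  have f: "K1 \<inter> K2 face_of K1" "K1 \<inter> K2 face_of K2"
    using simplicial_meshD(4)[OF M K(1,2)] simplicial_meshD(4)[OF M K(2,1)] by (auto simp: Int_commute)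
  have F1: "F = V K1 \<inter> (K1 \<inter> K2)" "F = V K2 \<inter> (K1 \<inter> K2)"
    unfolding F_def V_def using extreme_point_of_face[OF f(1)] extreme_point_of_face[OF f(2)] by auto
  have Find: "\<not> affine_dependent F" using V(1)[OF K(1)] F1(1) affine_dependent_subset by blast
  have Ffin: "finite F" using F1(1) V(3)[OF K(1)] by simp
  have "compact (K1 \<inter> K2)" "convex (K1 \<inter> K2)"
    using full_simplex_interior(3,4)[OF simplicial_meshD(2)[OF M]] K by (auto intro: convex_Int compact_Int)
  then have hull: "K1 \<inter> K2 = convex hull F" unfolding F_def by (rule Krein_Milman_Minkowski)
  have "int (card F) = DIM('a)"
    using dim aff_dim_affine_independent[OF Find] unfolding hull aff_dim_convex_hull by simp
  then have cF: "card F = DIM('a)" by simp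
  have ex: "\<exists>a. a \<notin> F \<and> V K = insert a F" if "K \<in> {K1, K2}" for K
  proof -
    have KM: "K \<in> M" using that K by auto
    have FV: "F \<subseteq> V K" using that F1 by auto
    have "card (V K - F) = 1" using card_Diff_subset[OF Ffin FV] V(2)[OF KM] cF by simp
    then obtain a where "V K - F = {a}" using card_1_singletonE by blast
    then have "a \<notin> F \<and> V K = insert a F" using FV by auto
    then show ?thesis by blast
  qed
  obtain a1 where a1: "a1 \<notin> F" "V K1 = insert a1 F" using ex[of K1] by auto
  obtain a2 where a2: "a2 \<notin> F" "V K2 = insert a2 F" using ex[of K2] by auto
  have ind1: "\<not> affine_dependent (insert a1 F)" using V(1)[OF K(1)] a1 by simp
  obtain c q where cq: "\<And>v. v \<in> insert a1 F \<Longrightarrow> c + q \<bullet> v = (if v = a1 then 1 else 0)"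
    using affine_function_extension[OF ind1, of "\<lambda>v. if v = a1 then 1 else 0"] by blast
  have z: "c + q \<bullet> y = 0" if "y \<in> F" for y using cq[of y] that a1 by auto
  have o: "c + q \<bullet> a1 = 1" using cq by simp
  have "c + q \<bullet> a2 \<noteq> 0"
  proof
    assume "c + q \<bullet> a2 = 0"
    have "F \<noteq> {}" using cF by auto
    then have "q \<noteq> 0" using o z by (metis all_not_in_conv inner_zero_left zero_neq_one)
    have sub: "insert a2 F \<subseteq> {y. q \<bullet> y = - c}"
      using z \<open>c + q \<bullet> a2 = 0\<close> by fastforce
    have "convex hull (insert a2 F) \<subseteq> {y. q \<bullet> y = - c}"
      using sub by (rule hull_minimal) (rule convex_hyperplane)
    then have "K2 \<subseteq> {y. q \<bullet> y = - c}" using V(4)[OF K(2)] a2 by simp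
    then have "interior K2 \<subseteq> interior {y. q \<bullet> y = - c}" by (rule interior_mono)
    then show False using interior_hyperplane[OF \<open>q \<noteq> 0\<close>]
      full_simplex_interior(1)[OF simplicial_meshD(2)[OF M K(2)]] by auto
  qed
  then show ?thesis
    using that[of F a1 a2 c q] Ffin cF a1 a2 V[OF K(1)] V[OF K(2)] z o by auto
qed

text \<open>Both elements must contain \<open>v\<close>, so that paths stay in the star of
  \<open>v\<close>, whose number of elements is uniformly bounded.\<close>

definition facet_adjacent :: "'a::euclidean_space set set \<Rightarrow> 'a \<Rightarrow> ('a set \<times> 'a set) set" where
  "facet_adjacent M v = {(K, K'). K \<in> M \<and> K' \<in> M \<and> v \<in> K \<and> v \<in> K' \<and> K \<noteq> K' \<and>
     aff_dim (K \<inter> K') = int DIM('a) - 1}"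

lemma negligible_aff_dim_lt:
  fixes S :: "'a::euclidean_space set"
  assumes "aff_dim S < DIM('a)" shows "negligible S"
proof -
  obtain a b where "a \<noteq> 0" "S \<subseteq> {x. a \<bullet> x = b}" using aff_lowdim_subset_hyperplane[OF assms] .
  then show ?thesis using negligible_hyperplane[of a b] negligible_subset by blast
qed

text \<open>A generic segment between two simplices of the star of \<open>v\<close> meets no face of codimension two.\<close>

lemma mesh_star_facet_connected:
  fixes K :: "'a::euclidean_space set"
  assumes M: "simplicial_mesh M T" and T: "convex T"
    and K: "K \<in> M" "K' \<in> M" "v \<in> K" "v \<in> K'"
  shows "(K, K') \<in> (facet_adjacent M v)\<^sup>*"
proof (rule ccontr)
  assume nc: "(K, K') \<notin> (facet_adjacent M v)\<^sup>*"
  define P where "P = {L \<in> M. v \<in> L}"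
  have finP: "finite P" using simplicial_meshD(1)[OF M] by (simp add: P_def)
  \<comment> \<open>A point where the segment passes from the reachable elements \<open>S\<close> to
    the remaining ones \<open>R\<close> of the star will contradict the choice of the
    segment.\<close>
  define S where "S = {L \<in> P. (K, L) \<in> (facet_adjacent M v)\<^sup>*}"
  define R where "R = P - S"
  have KS: "K \<in> S" "K' \<in> R" "K \<noteq> K'" using K nc by (auto simp: S_def R_def P_def)
  have cl: "closed L" if "L \<in> M" for L
    using full_simplex_interior(3)[OF simplicial_meshD(2)[OF M that]] compact_imp_closed by blast
  have "closed (\<Union>(M - P))" using cl simplicial_meshD(1)[OF M] by auto
  moreover have "v \<notin> \<Union>(M - P)" by (auto simp: P_def)
  ultimately obtain e where e: "e > 0" "ball v e \<inter> \<Union>(M - P) = {}"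
    by (metis Compl_iff disjoint_eq_subset_Compl open_Compl openE)
  have near: "\<exists>x. x \<in> interior L \<inter> ball v e" if "L \<in> P" for L
  proof -
    have "v \<in> closure (interior L)"
      using full_simplex_interior(2)[OF simplicial_meshD(2)[OF M]] that by (auto simp: P_def)
    then show ?thesis using e(1) closure_approachable by (metis IntI dist_commute mem_ball)
  qed
  obtain x where x: "x \<in> interior K" "x \<in> ball v e" using near[of K] KS by (auto simp: S_def)
  let ?low = "{(L1, L2) \<in> P \<times> P. L1 \<noteq> L2 \<and> aff_dim (L1 \<inter> L2) \<le> int DIM('a) - 2}"
  \<comment> \<open>The affine hulls of \<open>x\<close> and an intersection of codimension at least
    two have dimension below that of the space, so \<open>y\<close> can be chosen off this null
    set.\<close>
  define Z where "Z = (\<Union>(L1, L2)\<in>?low. affine hull (insert x (L1 \<inter> L2)))"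
  have "negligible Z"
    unfolding Z_def
  proof (intro negligible_Union finite_imageI, goal_cases)
    case 1 then show ?case using finite_subset[of ?low "P \<times> P"] finP by auto
  next
    case (2 t)
    then obtain L1 L2 where "aff_dim (L1 \<inter> L2) \<le> int DIM('a) - 2" "t = affine hull (insert x (L1 \<inter> L2))"
      by auto
    then show ?case by (intro negligible_aff_dim_lt) (auto simp: aff_dim_insert)
  qed
  moreover have "open (interior K' \<inter> ball v e)" "interior K' \<inter> ball v e \<noteq> {}"
    using near[of K'] KS by (auto simp: R_def)
  ultimately obtain y where y: "y \<in> interior K'" "y \<in> ball v e" "y \<notin> Z"
    using open_not_negligible negligible_subset by (metis Int_iff subsetI)
  let ?s = "closed_segment x y"
  have xT: "x \<in> T" "y \<in> T" using x y K interior_subset simplicial_meshD(3)[OF M] by blast+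
  have "?s \<subseteq> T" using closed_segment_subset[OF xT T] .
  moreover have "?s \<subseteq> ball v e" using closed_segment_subset[OF x(2) y(2)] by simp
  ultimately have cover: "?s \<subseteq> \<Union>S \<union> \<Union>R"
    using e(2) simplicial_meshD(3)[OF M] unfolding R_def by (auto simp: S_def) blast
  have "finite S" "finite R" using finP by (auto simp: S_def R_def)
  then have "closed (\<Union>S)" "closed (\<Union>R)"
    using cl by (auto simp: S_def R_def P_def intro!: closed_Union)
  moreover have "\<Union>S \<inter> ?s \<noteq> {}" "\<Union>R \<inter> ?s \<noteq> {}"
    using x y KS interior_subset by blast+
  \<comment> \<open>The segment is connected and covered by two closed sets that both meet it, so it
    contains a point of both.\<close>
  ultimately have "\<Union>S \<inter> \<Union>R \<inter> ?s \<noteq> {}"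
    using connected_closedD[OF connected_segment(1)[of x y], of "\<Union>S" "\<Union>R"] cover by blast
  then obtain p L1 L2 where p: "p \<in> ?s" "p \<in> L1" "p \<in> L2" "L1 \<in> S" "L2 \<in> R" by blast
  have L: "L1 \<in> P" "L2 \<in> P" "L1 \<noteq> L2" "L1 \<in> M" "L2 \<in> M" "v \<in> L1" "v \<in> L2"
    using p by (auto simp: S_def R_def P_def)
  have nadj: "aff_dim (L1 \<inter> L2) \<noteq> int DIM('a) - 1"
  proof
    assume "aff_dim (L1 \<inter> L2) = int DIM('a) - 1"
    then have "(L1, L2) \<in> facet_adjacent M v" using L by (auto simp: facet_adjacent_def)
    then have "L2 \<in> S" using p L by (auto simp: S_def)
    then show False using p by (auto simp: R_def)
  qed
  have "aff_dim (L1 \<inter> L2) < DIM('a)"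
  proof (rule ccontr)
    assume "\<not> ?thesis"
    then have "aff_dim (L1 \<inter> L2) = DIM('a)" using aff_dim_le_DIM[of "L1 \<inter> L2"] by simp
    moreover have "convex (L1 \<inter> L2)"
      using full_simplex_interior(4)[OF simplicial_meshD(2)[OF M]] L by (auto intro: convex_Int)
    ultimately have "interior (L1 \<inter> L2) \<noteq> {}"
      using rel_interior_eq_empty[of "L1 \<inter> L2"] p by (auto simp: rel_interior_interior aff_dim_eq_full)
    then show False using mesh_interior_disjoint[OF M L(4,5,3)] interior_subset by fastforce
  qed
  then have "(L1, L2) \<in> ?low" using L nadj by auto
  then have "y \<notin> affine hull (insert x (L1 \<inter> L2))" using y(3) unfolding Z_def by blast
  moreover have "p \<noteq> x"
  proof
    assume "p = x"
    then have "L1 = K" "L2 = K" using mesh_interior_disjoint[OF M K(1)] x p L by blast+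
    then show False using L by simp
  qed
  \<comment> \<open>As \<open>p\<close> differs from \<open>x\<close>, the line through both
    contains the other end \<open>y\<close>; this puts \<open>y\<close> into
    \<open>Z\<close>.\<close>
  moreover have "y \<in> affine hull {x, p}"
  proof -
    obtain u where u: "p = (1 - u) *\<^sub>R x + u *\<^sub>R y" "0 \<le> u" "u \<le> 1"
      using p(1) by (auto simp: in_segment)
    with \<open>p \<noteq> x\<close> have "u \<noteq> 0" by auto
    then have "y = (1 - 1 / u) *\<^sub>R x + (1 / u) *\<^sub>R p"
      by (simp add: u(1) scaleR_add_right diff_divide_distrib scaleR_diff_left scaleR_diff_right)
    then show ?thesis unfolding affine_hull_2 by force
  qed
  ultimately show False
    using hull_mono[of "{x, p}" "insert x (L1 \<inter> L2)" affine] p by blast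
qed

section \<open>Uniform constants from shape regularity\<close>

lemma shape_regular_volume:
  fixes K :: "(real^'n) set"
  assumes K: "int CARD('n) simplex K" and sr: "shape_regular \<kappa> M" "K \<in> M"
  shows "diameter K > 0" "\<kappa> \<ge> 2"
    "measure lborel (ball (0::real^'n) 1) * (diameter K / \<kappa>) ^ CARD('n) \<le> measure lebesgue K"
    "measure lebesgue K \<le> measure lborel (ball (0::real^'n) 1) * diameter K ^ CARD('n)"
proof -
  let ?w = "measure lborel (ball (0::real^'n) 1)"
  obtain x \<rho> where \<rho>: "\<rho> > 0" "ball x \<rho> \<subseteq> K" "diameter K \<le> \<kappa> * \<rho>"
    using sr unfolding shape_regular_def by blast
  have K': "int DIM(real^'n) simplex K" using K by simp
  have cK: "compact K" using full_simplex_interior(3)[OF K'] .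
  have "diameter (ball x \<rho>) \<le> diameter K"
    using diameter_subset[OF \<rho>(2) compact_imp_bounded[OF cK]] .
  then have d: "2 * \<rho> \<le> diameter K" using \<rho>(1) by simp
  then show dp: "diameter K > 0" using \<rho>(1) by simp
  have "2 * \<rho> \<le> \<kappa> * \<rho>" using d \<rho>(3) by linarith
  then show \<kappa>: "\<kappa> \<ge> 2" using \<rho>(1) by simp
  have w0: "?w \<ge> 0" by simp
  have lm: "K \<in> lmeasurable" using lmeasurable_compact[OF cK] .
  have "diameter K / \<kappa> \<le> \<rho>" using \<rho>(3) \<kappa> by (simp add: field_simps)
  then have "?w * (diameter K / \<kappa>) ^ CARD('n) \<le> ?w * \<rho> ^ CARD('n)"
    using dp \<kappa> by (intro mult_left_mono power_mono) auto
  also have "\<dots> = measure lborel (ball x \<rho>)"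
    using content_ball_conv_unit_ball[of \<rho> x] \<rho>(1) by simp
  also have "\<dots> \<le> measure lebesgue K"
    using measure_mono_fmeasurable[OF \<rho>(2) _ lm] by simp
  finally show "?w * (diameter K / \<kappa>) ^ CARD('n) \<le> measure lebesgue K" .
  have xK: "x \<in> K" using \<rho> by auto
  have "K \<subseteq> cball x (diameter K)"
    using diameter_bounded_bound[OF compact_imp_bounded[OF cK] xK] by auto
  then have "measure lebesgue K \<le> measure lborel (cball x (diameter K))"
    using measure_mono_fmeasurable[of K "cball x (diameter K)" lebesgue] lm by auto
  also have "\<dots> = ?w * diameter K ^ CARD('n)"
    using content_ball_conv_unit_ball[of "diameter K" x] dp by (simp add: content_cball_conv_ball)
  finally show "measure lebesgue K \<le> ?w * diameter K ^ CARD('n)" .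
qed

text \<open>The elements at \<open>v\<close> may differ in size. Each is shrunk towards
  \<open>v\<close> by the factor that gives its inscribed ball the common radius
  \<open>e / \<kappa>\<close>. The shrunken balls stay in their elements, hence are disjoint, and
  lie within distance \<open>e\<close> of \<open>v\<close>; comparing volumes yields
  \<open>\<kappa> ^ CARD('n)\<close>.\<close>

lemma mesh_star_card:
  fixes M :: "(real^'n) set set"
  assumes M: "simplicial_mesh M T" and sr: "shape_regular \<kappa> M" and \<kappa>: "\<kappa> \<ge> 2"
  shows "real (card {K \<in> M. v \<in> K}) \<le> \<kappa> ^ CARD('n)"
proof (cases "{K \<in> M. v \<in> K} = {}")
  case True
  show ?thesis unfolding True using \<kappa> by simp
next
  case False
  let ?P = "{K \<in> M. v \<in> K}"
  let ?w = "measure lborel (ball (0::real^'n) 1)"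
  have fin: "finite ?P" using simplicial_meshD(1)[OF M] by simp
  have "\<forall>K\<in>?P. \<exists>x \<rho>. \<rho> > 0 \<and> ball x \<rho> \<subseteq> K \<and> diameter K \<le> \<kappa> * \<rho>"
    using sr unfolding shape_regular_def by blast
  then obtain X R where XR: "\<And>K. K \<in> ?P \<Longrightarrow> R K > 0 \<and> ball (X K) (R K) \<subseteq> K \<and> diameter K \<le> \<kappa> * R K"
    by metis
  have simp: "int CARD('n) simplex K" "int DIM(real^'n) simplex K" if "K \<in> ?P" for K
    using simplicial_meshD(2)[OF M] that by auto
  \<comment> \<open>The minimum makes every shrinking factor \<open>e / (\<kappa> * R K)\<close> at
    most 1, so that convexity keeps the images inside the elements.\<close>
  define e where "e = Min ((\<lambda>K. \<kappa> * R K) ` ?P)"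
  have e: "e > 0" "\<And>K. K \<in> ?P \<Longrightarrow> e \<le> \<kappa> * R K"
    using fin False XR \<kappa> by (auto simp: e_def)
  define B where "B K = ball (v + (e / (\<kappa> * R K)) *\<^sub>R (X K - v)) (e / \<kappa>)" for K
  have Bsub: "B K \<subseteq> K \<and> B K \<subseteq> cball v e" if K: "K \<in> ?P" for K
  proof -
    have R: "R K > 0" "ball (X K) (R K) \<subseteq> K" "diameter K \<le> \<kappa> * R K" using XR[OF K] by auto
    define t where "t = e / (\<kappa> * R K)"
    have t: "0 < t" "t \<le> 1" "t * R K = e / \<kappa>" "t * (\<kappa> * R K) = e" using R e K \<kappa> by (auto simp: t_def)
    have cv: "convex K" "bounded K" "v \<in> K"
      using full_simplex_interior(3,4)[OF simp(2)[OF K]] K compact_imp_bounded by auto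
    have "z \<in> K \<and> z \<in> cball v e" if "z \<in> B K" for z
    proof -
      \<comment> \<open>The preimage of \<open>z\<close> under the shrinking, which lies in the
        inscribed ball of \<open>K\<close>.\<close>
      define y where "y = v + (1 / t) *\<^sub>R (z - v)"
      have zy: "z = (1 - t) *\<^sub>R v + t *\<^sub>R y" using t(1) by (simp add: y_def algebra_simps)
      have "y - X K = (1 / t) *\<^sub>R (z - (v + t *\<^sub>R (X K - v)))" using t(1) by (simp add: y_def algebra_simps)
      then have "norm (y - X K) = (1 / t) * norm (z - (v + t *\<^sub>R (X K - v)))" using t(1) by simp
      also have "\<dots> < (1 / t) * (t * R K)"
        using that t(1,3) by (intro mult_strict_left_mono) (auto simp: B_def t_def[symmetric] dist_norm norm_minus_commute)
      finally have "y \<in> K" using R(2) t(1) by (auto simp: dist_norm norm_minus_commute)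
      then have "z \<in> K" using convexD_alt[OF cv(1,3)] t zy by simp
      moreover have "z - v = t *\<^sub>R (y - v)" by (simp add: zy algebra_simps)
      then have "norm (z - v) \<le> t * diameter K"
        using diameter_bounded_bound[OF cv(2) \<open>y \<in> K\<close> cv(3)] t(1) by (simp add: dist_norm)
      then have "norm (z - v) \<le> e" using R(3) t(1,4) mult_left_mono[of "diameter K" "\<kappa> * R K" t] by linarith
      ultimately show ?thesis by (simp add: dist_norm norm_minus_commute)
    qed
    then show ?thesis by blast
  qed
  have disj: "disjoint_family_on B ?P"
    unfolding disjoint_family_on_def
  proof (intro ballI impI)
    fix K L assume KL: "K \<in> ?P" "L \<in> ?P" "K \<noteq> L"
    have "B K \<subseteq> interior K" using Bsub[OF KL(1)] by (simp add: interior_maximal B_def)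
    then show "B K \<inter> B L = {}"
      using mesh_interior_disjoint[OF M _ _ KL(3)] KL(1,2) Bsub[OF KL(2)] by blast
  qed
  have Bm: "measure lebesgue (B K) = ?w * (e / \<kappa>) ^ CARD('n)" for K
    using content_ball_conv_unit_ball[of "e / \<kappa>" "v + (e / (\<kappa> * R K)) *\<^sub>R (X K - v)"] e(1) \<kappa>
    by (simp add: B_def)
  have "real (card ?P) * (?w * (e / \<kappa>) ^ CARD('n)) = (\<Sum>K\<in>?P. measure lebesgue (B K))"
    by (simp add: Bm)
  also have "\<dots> = measure lebesgue (\<Union>K\<in>?P. B K)"
  proof (rule measure_finite_Union[symmetric])
    show "B ` ?P \<subseteq> sets lebesgue" by (auto simp: B_def)
    show "emeasure lebesgue (B K) \<noteq> \<infinity>" if "K \<in> ?P" for K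
      using emeasure_bounded_finite[of "B K"] by (simp add: B_def)
  qed (rule fin disj)+
  also have "\<dots> \<le> measure lebesgue (cball v e)"
    using Bsub by (intro measure_mono_fmeasurable) (auto simp: B_def intro!: sets.finite_UN fin)
  also have "\<dots> = ?w * e ^ CARD('n)"
    using content_ball_conv_unit_ball[of e v] e by (simp add: content_cball_conv_ball)
  finally have "(?w * e ^ CARD('n)) * real (card ?P) \<le> (?w * e ^ CARD('n)) * \<kappa> ^ CARD('n)"
    using \<kappa> by (simp add: power_divide field_simps)
  moreover have "?w * e ^ CARD('n) > 0" using e content_ball_pos[of 1 "0::real^'n"] by simp
  ultimately show ?thesis by (simp only: mult_le_cancel_left_pos)
qed

text \<open>In dimension at least two a common facet has an edge. Its length is bounded below by the
  inscribed ball of \<open>K1\<close> and above by the diameter of \<open>K2\<close>.\<close>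

lemma facet_adjacent_diameter_le:
  fixes M :: "(real^'n) set set"
  assumes n: "CARD('n) \<ge> 2" and M: "simplicial_mesh M T" and sr: "shape_regular \<kappa> M"
    and adj: "(K1, K2) \<in> facet_adjacent M v"
  shows "diameter K1 \<le> \<kappa> * diameter K2"
proof -
  have K: "K1 \<in> M" "K2 \<in> M" "K1 \<noteq> K2" "aff_dim (K1 \<inter> K2) = int DIM(real^'n) - 1"
    using adj by (auto simp: facet_adjacent_def)
  from mesh_facet_neighbours[OF M this]
  obtain F a1 a2 where F: "finite F" "card F = DIM(real^'n)"
    "K1 = convex hull (insert a1 F)" "K2 = convex hull (insert a2 F)" "\<not> affine_dependent (insert a1 F)"
    by metis
  obtain u v where uv: "u \<in> F" "v \<in> F" "u \<noteq> v"
    using F(2) n by (metis DIM_cart DIM_real card_2_iff' card_le_Suc0_iff_eq F(1) mult.right_neutral not_less_eq_eq numeral_2_eq_2)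
  obtain x \<rho> where \<rho>: "\<rho> > 0" "ball x \<rho> \<subseteq> K1" "diameter K1 \<le> \<kappa> * \<rho>"
    using sr K(1) unfolding shape_regular_def by blast
  have \<kappa>: "\<kappa> \<ge> 2" using shape_regular_volume(2)[OF _ sr K(1)] simplicial_meshD(2)[OF M K(1)] by simp
  have "2 * \<rho> \<le> dist u v"
    using simplex_edge_ge[OF F(5) _ _ uv(3)] uv \<rho> F(3) by blast
  also have "\<dots> \<le> diameter K2"
  proof (rule diameter_bounded_bound)
    show "bounded K2" using full_simplex_interior(3)[OF simplicial_meshD(2)[OF M K(2)]] compact_imp_bounded by blast
    show "u \<in> K2" "v \<in> K2" using uv F(4) by (auto simp: hull_inc)
  qed
  finally have "\<rho> \<le> diameter K2" using \<rho>(1) by linarith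
  then have "\<kappa> * \<rho> \<le> \<kappa> * diameter K2" using \<kappa> by simp
  then show ?thesis using \<rho>(3) by linarith
qed

subsection \<open>Integrals over meshes\<close>

lemma set_lebesgue_integral_const:
  "(LINT x:K|lebesgue. a) = measure lebesgue K * (a :: real)"
  by (simp add: set_lebesgue_integral_def)

lemma set_integral_negligible_superset:
  fixes f :: "'a::euclidean_space \<Rightarrow> 'b::euclidean_space"
  assumes "set_integrable lebesgue U f" "U \<subseteq> S" "negligible (S - U)"
  shows "set_integrable lebesgue S f" "(LINT x:S|lebesgue. f x) = (LINT x:U|lebesgue. f x)"
proof -
  have "negligible {x \<in> S - U. f x \<noteq> 0}" "negligible {x \<in> U - S. f x \<noteq> 0}"
    using assms(2,3) by (auto intro: negligible_subset[of "S - U"])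
  then show *: "set_integrable lebesgue S f"
    using absolutely_integrable_spike_set_eq[of S U f] assms(1) by blast
  show "(LINT x:S|lebesgue. f x) = (LINT x:U|lebesgue. f x)"
    unfolding set_lebesgue_integral_eq_integral(2)[OF *] set_lebesgue_integral_eq_integral(2)[OF assms(1)]
    using integral_subset_negligible[OF assms(2,3)] by metis
qed

lemma set_integral_interior:
  fixes f :: "'a::euclidean_space \<Rightarrow> 'b::euclidean_space"
  assumes "compact K" "convex K" "set_integrable lebesgue K f"
  shows "set_integrable lebesgue (interior K) f" "(LINT x:interior K|lebesgue. f x) = (LINT x:K|lebesgue. f x)"
proof -
  show i: "set_integrable lebesgue (interior K) f"
    by (rule set_integrable_subset[OF assms(3) _ interior_subset]) auto
  have "K - interior K \<subseteq> frontier K"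
    using closure_subset by (auto simp: frontier_def)
  then have "negligible (K - interior K)"
    using negligible_convex_frontier[OF assms(2)] negligible_subset by blast
  then show "(LINT x:interior K|lebesgue. f x) = (LINT x:K|lebesgue. f x)"
    using set_integral_negligible_superset(2)[OF i interior_subset] by simp
qed

text \<open>\<open>S\<close> is used for \<open>\<Omega>\<close>, for a coarse cell and for the
  interior of a cell. It differs from the union of the element interiors only by parts of element
  boundaries, which are null sets.\<close>

lemma mesh_set_integral:
  fixes f :: "'a::euclidean_space \<Rightarrow> 'b::euclidean_space"
  assumes M: "simplicial_mesh M T" and S: "S \<subseteq> T" "\<And>K. K \<in> M \<Longrightarrow> interior K \<subseteq> S"
    and f: "\<And>K. K \<in> M \<Longrightarrow> set_integrable lebesgue (interior K) f"
  shows "set_integrable lebesgue S f" "(LINT x:S|lebesgue. f x) = (\<Sum>K\<in>M. LINT x:interior K|lebesgue. f x)"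
proof -
  let ?U = "\<Union>K\<in>M. interior K"
  have fin: "finite M" using simplicial_meshD(1)[OF M] .
  have cc: "compact K" "convex K" if "K \<in> M" for K
    using full_simplex_interior(3,4)[OF simplicial_meshD(2)[OF M that]] by auto
  have "S - ?U \<subseteq> (\<Union>K\<in>M. frontier K)"
  proof
    fix x assume x: "x \<in> S - ?U"
    then obtain K where "K \<in> M" "x \<in> K" using S(1) simplicial_meshD(3)[OF M] by auto
    then have "x \<in> frontier K" using x closure_subset by (auto simp: frontier_def)
    then show "x \<in> (\<Union>K\<in>M. frontier K)" using \<open>K \<in> M\<close> by auto
  qed
  moreover have "negligible (\<Union>K\<in>M. frontier K)"
    using fin cc by (auto intro!: negligible_Union negligible_convex_frontier)
  ultimately have neg: "negligible (S - ?U)" by (rule negligible_subset[rotated])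
  have iU: "set_integrable lebesgue ?U f"
    by (rule set_integrable_UN[OF fin f]) auto
  have "(LINT x:?U|lebesgue. f x) = (\<Sum>K\<in>M. LINT x:interior K|lebesgue. f x)"
  proof (rule set_integral_finite_UN_AE[OF fin])
    fix K L assume "K \<in> M" "L \<in> M"
    then have "x \<in> interior K \<and> x \<in> interior L \<longrightarrow> K = L" for x
      using mesh_interior_disjoint[OF M] interior_subset by blast
    then show "AE x in lebesgue. x \<in> interior K \<and> x \<in> interior L \<longrightarrow> K = L" by simp
  qed (use f in auto)
  then show "set_integrable lebesgue S f" "(LINT x:S|lebesgue. f x) = (\<Sum>K\<in>M. LINT x:interior K|lebesgue. f x)"
    using set_integral_negligible_superset[OF iU _ neg] S(2) by auto
qed

text \<open>Piecewise data are prescribed on open elements only, so the values of \<open>F\<close>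
  on element boundaries never matter.\<close>

lemma mesh_piecewise_integral:
  fixes F :: "'a::euclidean_space \<Rightarrow> 'b::euclidean_space"
  assumes M: "simplicial_mesh M T" and S: "S \<subseteq> T" "\<And>K. K \<in> M \<Longrightarrow> interior K \<subseteq> S" and N: "N \<subseteq> M"
    and f: "\<And>K. K \<in> N \<Longrightarrow> set_integrable lebesgue (interior K) (f K)"
    and Ff: "\<And>K x. K \<in> N \<Longrightarrow> x \<in> interior K \<Longrightarrow> F x = f K x"
    and F0: "\<And>K x. K \<in> M - N \<Longrightarrow> x \<in> interior K \<Longrightarrow> F x = 0"
  shows "set_integrable lebesgue S F" "(LINT x:S|lebesgue. F x) = (\<Sum>K\<in>N. LINT x:interior K|lebesgue. f K x)"
proof -
  have eq: "set_integrable lebesgue (interior K) F \<longleftrightarrow> set_integrable lebesgue (interior K) (f K)"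
    "(LINT x:interior K|lebesgue. F x) = (LINT x:interior K|lebesgue. f K x)" if "K \<in> N" for K
  proof -
    have "(\<lambda>x. indicat_real (interior K) x *\<^sub>R F x) = (\<lambda>x. indicat_real (interior K) x *\<^sub>R f K x)"
      using Ff[OF that] by (auto simp: indicator_def fun_eq_iff)
    then show "set_integrable lebesgue (interior K) F \<longleftrightarrow> set_integrable lebesgue (interior K) (f K)"
      "(LINT x:interior K|lebesgue. F x) = (LINT x:interior K|lebesgue. f K x)"
      by (simp_all add: set_integrable_def set_lebesgue_integral_def)
  qed
  have z: "set_integrable lebesgue (interior K) F"
    "(LINT x:interior K|lebesgue. F x) = 0" if "K \<in> M - N" for K
  proof -
    have "(\<lambda>x. indicat_real (interior K) x *\<^sub>R F x) = (\<lambda>x. 0)"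
      using F0[OF that] by (auto simp: indicator_def fun_eq_iff)
    then show "set_integrable lebesgue (interior K) F" "(LINT x:interior K|lebesgue. F x) = 0"
      by (auto simp: set_integrable_def set_lebesgue_integral_def)
  qed
  have i: "set_integrable lebesgue (interior K) F" if "K \<in> M" for K
    using eq(1) f z(1) that by blast
  show "set_integrable lebesgue S F" using mesh_set_integral(1)[OF M S i] .
  have "(LINT x:S|lebesgue. F x) = (\<Sum>K\<in>M. LINT x:interior K|lebesgue. F x)"
    using mesh_set_integral(2)[OF M S i] .
  also have "\<dots> = (\<Sum>K\<in>N. LINT x:interior K|lebesgue. F x)"
    using simplicial_meshD(1)[OF M] N z(2) by (intro sum.mono_neutral_right) auto
  finally show "(LINT x:S|lebesgue. F x) = (\<Sum>K\<in>N. LINT x:interior K|lebesgue. f K x)"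
    using eq(2) by simp
qed

text \<open>This excludes slits: from a boundary point, moving along \<open>e\<close> leads into the
  open set above the graph, which misses \<open>\<Omega>\<close>. As the mesh covers
  \<open>closure \<Omega>\<close>, this is what places the element interiors inside
  \<open>\<Omega>\<close>.\<close>

lemma lipschitz_boundary_interior_closure:
  assumes "lipschitz_boundary \<Omega>" "open \<Omega>"
  shows "interior (closure \<Omega>) = \<Omega>"
proof
  show "\<Omega> \<subseteq> interior (closure \<Omega>)" by (rule interior_maximal[OF closure_subset assms(2)])
  show "interior (closure \<Omega>) \<subseteq> \<Omega>"
  proof (rule ccontr)
    assume "\<not> interior (closure \<Omega>) \<subseteq> \<Omega>"
    then obtain x where x: "x \<in> interior (closure \<Omega>)" "x \<notin> \<Omega>" by auto
    then have "x \<in> frontier \<Omega>"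
      using assms(2) interior_subset by (auto simp: frontier_def interior_open)
    then obtain e \<rho> L g where g: "norm e = 1" "\<rho> > 0" "L-lipschitz_on UNIV (g :: real^'a \<Rightarrow> real)"
        "\<And>y. y \<in> ball x \<rho> \<Longrightarrow> y \<in> \<Omega> \<longleftrightarrow> y \<bullet> e < g (y - (y \<bullet> e) *\<^sub>R e)"
      using assms(1) unfolding lipschitz_boundary_def by blast
    obtain s where s: "s > 0" "ball x s \<subseteq> closure \<Omega>" using x(1) mem_interior by blast
    define t where "t = min \<rho> s / 2"
    have t: "t > 0" "t < \<rho>" "t < s" using g(2) s(1) by (auto simp: t_def)
    have ee: "e \<bullet> e = 1" using g(1) by (simp add: dot_square_norm)
    define y where "y = x + t *\<^sub>R e"
    have yp: "y - (y \<bullet> e) *\<^sub>R e = x - (x \<bullet> e) *\<^sub>R e" "y \<bullet> e = x \<bullet> e + t"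
      by (auto simp: y_def inner_add_left ee algebra_simps)
    have yb: "y \<in> ball x \<rho>" "y \<in> ball x s" using t g(1) by (auto simp: y_def dist_norm)
    have gx: "x \<bullet> e \<ge> g (x - (x \<bullet> e) *\<^sub>R e)" using g(4)[of x] g(2) x(2) by auto
    define U where "U = {y. y \<bullet> e > g (y - (y \<bullet> e) *\<^sub>R e)} \<inter> ball x \<rho>"
    have "continuous_on UNIV g" using g(3) lipschitz_on_continuous_on by blast
    then have "continuous_on UNIV (\<lambda>y. g (y - (y \<bullet> e) *\<^sub>R e))"
      by (rule continuous_on_compose2) (auto intro!: continuous_intros)
    then have "open U" unfolding U_def
      by (intro open_Int open_Collect_less continuous_intros) auto
    moreover have "y \<in> U" using yp yb gx t(1) by (simp add: U_def)
    moreover have "U \<inter> \<Omega> = {}" using g(4) by (fastforce simp: U_def)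
    ultimately have "y \<notin> closure \<Omega>" using open_Int_closure_eq_empty by blast
    then show False using yb s(2) by auto
  qed
qed

section \<open>Square-integrable functions\<close>

lemma L2_inner_integrable:
  fixes f g :: "real^'n \<Rightarrow> 'b::euclidean_space"
  assumes "L2 A f" "L2 A g"
  shows "set_integrable lebesgue A (\<lambda>x. f x \<bullet> g x)"
  unfolding set_integrable_def
proof (rule Bochner_Integration.integrable_bound)
  show "integrable lebesgue (\<lambda>x. indicat_real A x *\<^sub>R (norm (f x))\<^sup>2 + indicat_real A x *\<^sub>R (norm (g x))\<^sup>2)"
    using assms by (auto simp: L2_def set_integrable_def)
  have "(\<lambda>x. (indicat_real A x *\<^sub>R f x) \<bullet> (indicat_real A x *\<^sub>R g x)) \<in> borel_measurable lebesgue"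
    using assms by (intro borel_measurable_inner) (auto simp: L2_def set_borel_measurable_def)
  moreover have "(\<lambda>x. (indicat_real A x *\<^sub>R f x) \<bullet> (indicat_real A x *\<^sub>R g x)) = (\<lambda>x. indicat_real A x *\<^sub>R (f x \<bullet> g x))"
    by (auto simp: indicator_def fun_eq_iff)
  ultimately show "(\<lambda>x. indicat_real A x *\<^sub>R (f x \<bullet> g x)) \<in> borel_measurable lebesgue" by simp
  have "\<bar>f x \<bullet> g x\<bar> \<le> (norm (f x))\<^sup>2 + (norm (g x))\<^sup>2" for x
  proof -
    have "\<bar>f x \<bullet> g x\<bar> \<le> norm (f x) * norm (g x)" by (rule Cauchy_Schwarz_ineq2)
    also have "\<dots> \<le> (norm (f x))\<^sup>2 + (norm (g x))\<^sup>2"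
      using sum_squares_bound[of "norm (f x)" "norm (g x)"] mult_nonneg_nonneg[OF norm_ge_zero norm_ge_zero, of "f x" "g x"] by linarith
    finally show ?thesis .
  qed
  then show "AE x in lebesgue. norm (indicat_real A x *\<^sub>R (f x \<bullet> g x))
      \<le> norm (indicat_real A x *\<^sub>R (norm (f x))\<^sup>2 + indicat_real A x *\<^sub>R (norm (g x))\<^sup>2)"
    by (auto simp: indicator_def)
qed

lemma L2_diff:
  fixes f g :: "real^'n \<Rightarrow> 'b::euclidean_space"
  assumes "L2 A f" "L2 A g"
  shows "L2 A (\<lambda>x. f x - g x)"
proof -
  have "set_borel_measurable lebesgue A (\<lambda>x. f x - g x)"
    using assms by (auto simp: L2_def set_borel_measurable_def scaleR_diff_right)
  moreover have "set_integrable lebesgue A (\<lambda>x. ((norm (f x))\<^sup>2 + (norm (g x))\<^sup>2) - 2 * (f x \<bullet> g x))"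
    using assms L2_inner_integrable[OF assms]
    by (intro set_integral_diff set_integral_add set_integrable_mult_right) (auto simp: L2_def)
  moreover have "((norm (f x))\<^sup>2 + (norm (g x))\<^sup>2) - 2 * (f x \<bullet> g x) = (norm (f x - g x))\<^sup>2" for x
    by (simp add: power2_norm_eq_inner inner_diff_left inner_diff_right inner_commute)
  ultimately show ?thesis by (simp add: L2_def)
qed

lemma L2_subset:
  assumes "L2 A f" "B \<subseteq> A" "B \<in> sets lebesgue"
  shows "L2 B f"
proof -
  have "(\<lambda>x. indicat_real B x *\<^sub>R (indicat_real A x *\<^sub>R f x)) \<in> borel_measurable lebesgue"
    using borel_measurable_scaleR[OF borel_measurable_indicator[OF assms(3)]] assms(1)
    unfolding L2_def set_borel_measurable_def by blast
  moreover have "(\<lambda>x. indicat_real B x *\<^sub>R (indicat_real A x *\<^sub>R f x)) = (\<lambda>x. indicat_real B x *\<^sub>R f x)"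
    using assms(2) by (auto simp: indicator_def fun_eq_iff)
  ultimately show ?thesis
    using assms set_integrable_subset[of lebesgue A "\<lambda>x. (norm (f x))\<^sup>2" B]
    by (auto simp: L2_def set_borel_measurable_def)
qed

lemma L2_Cauchy_Schwarz:
  fixes f g :: "real^'n \<Rightarrow> 'b::euclidean_space"
  assumes f: "L2 A f" and g: "L2 A g"
  shows "(LINT x:A|lebesgue. f x \<bullet> g x)\<^sup>2
    \<le> (LINT x:A|lebesgue. (norm (f x))\<^sup>2) * (LINT x:A|lebesgue. (norm (g x))\<^sup>2)"
proof -
  define a b c where "a = (LINT x:A|lebesgue. (norm (f x))\<^sup>2)" and "b = (LINT x:A|lebesgue. f x \<bullet> g x)"
    and "c = (LINT x:A|lebesgue. (norm (g x))\<^sup>2)"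
  have i: "set_integrable lebesgue A (\<lambda>x. (norm (f x))\<^sup>2)" "set_integrable lebesgue A (\<lambda>x. (norm (g x))\<^sup>2)"
    "set_integrable lebesgue A (\<lambda>x. f x \<bullet> g x)"
    using f g L2_inner_integrable by (auto simp: L2_def)
  have quad: "0 \<le> a + t\<^sup>2 * c - 2 * t * b" for t
  proof -
    have "0 \<le> (LINT x:A|lebesgue. (norm (f x - t *\<^sub>R g x))\<^sup>2)"
      unfolding set_lebesgue_integral_def by (rule integral_nonneg_AE) auto
    also have "\<dots> = (LINT x:A|lebesgue. ((norm (f x))\<^sup>2 + t\<^sup>2 * (norm (g x))\<^sup>2) - 2 * t * (f x \<bullet> g x))"
    proof -
      have "(norm (f x - t *\<^sub>R g x))\<^sup>2 = ((norm (f x))\<^sup>2 + t\<^sup>2 * (norm (g x))\<^sup>2) - 2 * t * (f x \<bullet> g x)" for x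
        unfolding power2_norm_eq_inner
        by (simp add: inner_diff_left inner_diff_right inner_commute power2_eq_square algebra_simps)
      then show ?thesis by simp
    qed
    also have "\<dots> = a + t\<^sup>2 * c - 2 * t * b"
      using i by (simp add: a_def b_def c_def set_integral_diff set_integral_add)
    finally show ?thesis .
  qed
  have c0: "c \<ge> 0" unfolding c_def set_lebesgue_integral_def by (rule integral_nonneg_AE) auto
  have "b\<^sup>2 \<le> a * c"
  proof (cases "c = 0")
    case True
    have "b = 0"
    proof (rule ccontr)
      assume "b \<noteq> 0"
      \<comment> \<open>For \<open>c = 0\<close> the quadratic is affine in \<open>t\<close> and
        equals -1 at this value.\<close>
      then show False using quad[of "(a + 1) / (2 * b)"] True by (simp add: field_simps)
    qed
    then show ?thesis using True by simp
  next
    case False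
    then have "c > 0" using c0 by simp
    then show ?thesis using quad[of "b / c"] by (simp add: field_simps power2_eq_square)
  qed
  then show ?thesis by (simp add: a_def b_def c_def)
qed

lemma L2_compact_continuous:
  fixes f :: "real^'n \<Rightarrow> 'b::euclidean_space"
  assumes "compact K" "continuous_on K f"
  shows "L2 K f"
proof -
  have "set_integrable lebesgue K f" "set_integrable lebesgue K (\<lambda>x. (norm (f x))\<^sup>2)"
    using assms by (auto intro!: set_integrable_compact_continuous(2) continuous_intros)
  then show ?thesis by (auto simp: L2_def set_integrable_def set_borel_measurable_def)
qed

lemma L2_piecewise_continuous:
  fixes f :: "real^'n \<Rightarrow> 'b::euclidean_space"
  assumes M: "simplicial_mesh M T" and S: "S \<subseteq> T" "\<And>K. K \<in> M \<Longrightarrow> interior K \<subseteq> S"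
    and f: "\<And>K. K \<in> M \<Longrightarrow> \<exists>q. continuous_on UNIV q \<and> (\<forall>x\<in>interior K. f x = q x)"
  shows "L2 S f"
proof -
  obtain q where q: "\<And>K. K \<in> M \<Longrightarrow> continuous_on UNIV (q K)" "\<And>K x. K \<in> M \<Longrightarrow> x \<in> interior K \<Longrightarrow> f x = q K x"
    using f by metis
  have i: "set_integrable lebesgue (interior K) (q K)" "set_integrable lebesgue (interior K) (\<lambda>x. (norm (q K x))\<^sup>2)"
    if "K \<in> M" for K
  proof -
    have K: "compact K" "convex K" and "continuous_on K (q K)"
      using full_simplex_interior(3,4)[OF simplicial_meshD(2)[OF M that]] continuous_on_subset[OF q(1)[OF that]]
      by auto
    then have "set_integrable lebesgue K (q K)" "set_integrable lebesgue K (\<lambda>x. (norm (q K x))\<^sup>2)"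
      by (auto intro!: set_integrable_compact_continuous(2) continuous_intros)
    then show "set_integrable lebesgue (interior K) (q K)" "set_integrable lebesgue (interior K) (\<lambda>x. (norm (q K x))\<^sup>2)"
      using set_integral_interior(1)[OF K] by blast+
  qed
  have "set_integrable lebesgue S f"
    by (rule mesh_piecewise_integral(1)[OF M S order_refl i(1)]) (auto simp: q)
  moreover have "set_integrable lebesgue S (\<lambda>x. (norm (f x))\<^sup>2)"
    by (rule mesh_piecewise_integral(1)[OF M S order_refl i(2)]) (auto simp: q)
  ultimately show ?thesis by (auto simp: L2_def set_integrable_def set_borel_measurable_def)
qed

subsection \<open>Discrete gradients\<close>

text \<open>The first equation of the mixed method: a discrete \<open>\<delta>\<close> with this
  property is the discrete codifferential of \<open>w\<close>. The divergence \<open>z\<close> is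
  quantified because \<open>weak_d\<close> is a relation, insensitive to null sets.\<close>

definition discrete_gradient :: "fe_family \<Rightarrow> nat \<Rightarrow> (real^'n) set \<Rightarrow> (real^'n) set set
    \<Rightarrow> (real^'n \<Rightarrow> real^'n) \<Rightarrow> (real^'n \<Rightarrow> real) \<Rightarrow> bool" where
  "discrete_gradient fam r \<Omega> \<T> \<delta> w \<longleftrightarrow>
     (\<forall>\<tau> z. \<tau> \<in> Lambda_nm1_h fam r \<Omega> \<T> \<and> weak_d \<Omega> \<tau> z \<and> L2 \<Omega> z \<longrightarrow>
        l2_inner \<Omega> \<delta> \<tau> = l2_inner \<Omega> z w)"

text \<open>The test field is glued from \<open>\<beta> K\<close> on the elements of
  \<open>S\<close> and zero elsewhere. The premise \<open>parts\<close> is the continuity of normal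
  components in integrated form: it makes the glued \<open>z\<close> the weak divergence, so that
  the field is admissible.\<close>

lemma discrete_gradient_test:
  fixes \<Omega> :: "(real^'n) set"
  assumes M: "simplicial_mesh \<T> (closure \<Omega>)" and int\<Omega>: "\<And>K. K \<in> \<T> \<Longrightarrow> interior K \<subseteq> \<Omega>"
    and r: "r \<ge> 1" and S: "S \<subseteq> \<T>"
    and dg: "discrete_gradient fam r \<Omega> \<T> \<delta> w" and \<delta>: "L2 \<Omega> \<delta>"
    and w: "\<And>K. K \<in> \<T> \<Longrightarrow> continuous_on UNIV (p K)" "\<And>K x. K \<in> \<T> \<Longrightarrow> x \<in> interior K \<Longrightarrow> w x = p K x"
    and \<beta>: "\<And>K. K \<in> S \<Longrightarrow> local_sigma fam r (\<beta> K)" "\<And>K. K \<in> S \<Longrightarrow> continuous_on UNIV (\<beta> K)"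
      "\<And>K. K \<in> S \<Longrightarrow> continuous_on UNIV (z K)"
    and parts: "\<And>\<phi> G. C1_with_grad \<phi> G \<Longrightarrow>
      (\<Sum>K\<in>S. LINT x:K|lebesgue. \<beta> K x \<bullet> G x) = - (\<Sum>K\<in>S. LINT x:K|lebesgue. z K x * \<phi> x)"
  shows "(\<Sum>K\<in>S. LINT x:interior K|lebesgue. \<delta> x \<bullet> \<beta> K x) = (\<Sum>K\<in>S. LINT x:K|lebesgue. z K x * p K x)"
proof -
  have fin: "finite S" using S simplicial_meshD(1)[OF M] finite_subset by blast
  have cc: "compact K" "convex K" if "K \<in> \<T>" for K
    using full_simplex_interior(3,4)[OF simplicial_meshD(2)[OF M that]] by auto
  \<comment> \<open>Interiors of distinct elements are disjoint, so at most one summand is nonzero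
    at any point.\<close>
  define \<tau> where "\<tau> x = (\<Sum>K\<in>S. indicat_real (interior K) x *\<^sub>R \<beta> K x)" for x
  define zz where "zz x = (\<Sum>K\<in>S. indicat_real (interior K) x * z K x)" for x
  have ind: "indicat_real (interior L) x = (if L = K then 1 else 0)"
    if "K \<in> \<T>" "L \<in> \<T>" "x \<in> interior K" for K L x
    using mesh_interior_disjoint[OF M that(1,2)] that(3) interior_subset by (auto simp: indicator_def)
  have \<tau>S: "\<tau> x = \<beta> K x" and zS: "zz x = z K x" if K: "K \<in> S" "x \<in> interior K" for K x
  proof -
    have *: "indicat_real (interior L) x = (if L = K then 1 else 0)" if "L \<in> S" for L
      by (rule ind) (use that K S in auto)
    show "\<tau> x = \<beta> K x" "zz x = z K x"
      using K(1) fin by (simp_all add: \<tau>_def zz_def * if_distrib[of "\<lambda>c. c *\<^sub>R _"] if_distrib[of "\<lambda>c. c * _"] cong: if_cong)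
  qed
  have \<tau>0: "\<tau> x = 0" and z0: "zz x = 0" if K: "K \<in> \<T> - S" "x \<in> interior K" for K x
  proof -
    have *: "indicat_real (interior L) x = 0" if "L \<in> S" for L
      using ind[of K L x] that K S subsetD[OF S that] by (cases "L = K") auto
    show "\<tau> x = 0" "zz x = 0" by (simp_all add: \<tau>_def zz_def *)
  qed
  have sub: "\<Omega> \<subseteq> closure \<Omega>" by (rule closure_subset)
  have L2\<tau>: "L2 \<Omega> \<tau>"
  proof (rule L2_piecewise_continuous[OF M sub int\<Omega>])
    fix K assume "K \<in> \<T>"
    then show "\<exists>q. continuous_on UNIV q \<and> (\<forall>x\<in>interior K. \<tau> x = q x)"
      using \<tau>S \<tau>0 \<beta>(2) by (cases "K \<in> S") (blast, intro exI[of _ "\<lambda>_. 0"], auto)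
  qed
  have L2z: "L2 \<Omega> zz"
  proof (rule L2_piecewise_continuous[OF M sub int\<Omega>])
    fix K assume "K \<in> \<T>"
    then show "\<exists>q. continuous_on UNIV q \<and> (\<forall>x\<in>interior K. zz x = q x)"
      using zS z0 \<beta>(3) by (cases "K \<in> S") (blast, intro exI[of _ "\<lambda>_. 0"], auto)
  qed
  have cint: "set_integrable lebesgue (interior K) f" "(LINT x:interior K|lebesgue. f x) = (LINT x:K|lebesgue. f x)"
    if "K \<in> S" "continuous_on UNIV f" for K and f :: "real^'n \<Rightarrow> real"
  proof -
    have "K \<in> \<T>" using that S by auto
    then have "set_integrable lebesgue K f"
      using set_integrable_compact_continuous(2) cc(1) continuous_on_subset[OF that(2)] by blast
    then show "set_integrable lebesgue (interior K) f" "(LINT x:interior K|lebesgue. f x) = (LINT x:K|lebesgue. f x)"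
      using set_integral_interior cc \<open>K \<in> \<T>\<close> by blast+
  qed
  have wd: "weak_d \<Omega> \<tau> zz"
    unfolding weak_d_def
  proof (intro allI impI)
    fix \<phi> G assume "test_fun \<Omega> \<phi> G"
    then have C: "C1_with_grad \<phi> G" by (auto simp: test_fun_def C1_with_grad_def)
    note c\<phi> = C1_with_gradD(1,3)[OF C]
    have "(LINT x:\<Omega>|lebesgue. \<tau> x \<bullet> G x) = (\<Sum>K\<in>S. LINT x:interior K|lebesgue. \<beta> K x \<bullet> G x)"
      by (rule mesh_piecewise_integral(2)[OF M sub int\<Omega> S])
         (auto simp: \<tau>S \<tau>0 intro!: cint continuous_intros \<beta> c\<phi>)
    also have "\<dots> = (\<Sum>K\<in>S. LINT x:K|lebesgue. \<beta> K x \<bullet> G x)"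
      by (intro sum.cong refl cint continuous_intros \<beta> c\<phi>)
    also have "\<dots> = - (\<Sum>K\<in>S. LINT x:K|lebesgue. z K x * \<phi> x)" using parts[OF C] .
    also have "(\<Sum>K\<in>S. LINT x:K|lebesgue. z K x * \<phi> x) = (\<Sum>K\<in>S. LINT x:interior K|lebesgue. z K x * \<phi> x)"
      by (intro sum.cong refl cint(2)[symmetric] continuous_intros \<beta> c\<phi>)
    also have "\<dots> = (LINT x:\<Omega>|lebesgue. zz x * \<phi> x)"
      by (rule mesh_piecewise_integral(2)[OF M sub int\<Omega> S, symmetric])
         (auto simp: zS z0 intro!: cint continuous_intros \<beta> c\<phi>)
    finally show "(LINT x:\<Omega>|lebesgue. \<tau> x \<bullet> G x) = - (LINT x:\<Omega>|lebesgue. zz x * \<phi> x)" .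
  qed
  have "\<tau> \<in> Lambda_nm1_h fam r \<Omega> \<T>"
    unfolding Lambda_nm1_h_def H_Lambda_def
  proof (intro CollectI conjI ballI)
    fix K assume K: "K \<in> \<T>"
    show "\<exists>q. local_sigma fam r q \<and> (\<forall>x\<in>interior K. \<tau> x = q x)"
    proof (cases "K \<in> S")
      case True
      then show ?thesis using \<tau>S \<beta>(1) by blast
    next
      case False
      have "local_sigma fam r (\<lambda>x. 0 :: real^'n)"
        using local_sigma_P_minus_imp[of r "\<lambda>_. 0" "\<lambda>_. 0" fam] r by (simp add: poly_fun_const)
      then show ?thesis using \<tau>0 False K by blast
    qed
  qed (use L2\<tau> L2z wd in auto)
  then have "l2_inner \<Omega> \<delta> \<tau> = l2_inner \<Omega> zz w"
    using dg wd L2z unfolding discrete_gradient_def by blast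
  moreover have "l2_inner \<Omega> zz w = (\<Sum>K\<in>S. LINT x:interior K|lebesgue. z K x * p K x)"
    unfolding l2_inner_def inner_real_def
  proof (rule mesh_piecewise_integral(2)[OF M sub int\<Omega> S])
    fix K assume "K \<in> S"
    then show "set_integrable lebesgue (interior K) (\<lambda>x. z K x * p K x)"
      using w(1)[of K] S by (intro cint continuous_intros \<beta>) auto
  qed (use zS z0 w(2) S in auto)
  moreover have "\<dots> = (\<Sum>K\<in>S. LINT x:K|lebesgue. z K x * p K x)"
    using w(1) S by (intro sum.cong refl cint continuous_intros \<beta>) auto
  moreover have "l2_inner \<Omega> \<delta> \<tau> = (\<Sum>K\<in>S. LINT x:interior K|lebesgue. \<delta> x \<bullet> \<beta> K x)"
    unfolding l2_inner_def
  proof (rule mesh_piecewise_integral(2)[OF M sub int\<Omega> S])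
    fix K assume K: "K \<in> S"
    then have KT: "K \<in> \<T>" using S by auto
    have "L2 K (\<beta> K)"
      using L2_compact_continuous[OF cc(1)[OF KT]] continuous_on_subset[OF \<beta>(2)[OF K]] by blast
    then have "L2 (interior K) (\<beta> K)" by (rule L2_subset) (auto simp: interior_subset)
    moreover have "L2 (interior K) \<delta>" using L2_subset[OF \<delta> int\<Omega>[OF KT]] by simp
    ultimately show "set_integrable lebesgue (interior K) (\<lambda>x. \<delta> x \<bullet> \<beta> K x)"
      by (intro L2_inner_integrable)
  qed (use \<tau>S \<tau>0 in auto)
  ultimately show ?thesis by simp
qed

text \<open>The test field is the lowest order Raviart-Thomas function of the facet, built from the
  radial fields at the two opposite vertices with opposite signs. Division by the volumes makes the
  fluxes match and turns the divergence term into \<open>CARD('n)\<close> times the difference of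
  the means.\<close>

lemma facet_jump_bound:
  fixes \<Omega> :: "(real^'n) set"
  assumes M: "simplicial_mesh \<T> (closure \<Omega>)" and int\<Omega>: "\<And>K. K \<in> \<T> \<Longrightarrow> interior K \<subseteq> \<Omega>"
    and r: "r \<ge> 1"
    and dg: "discrete_gradient fam r \<Omega> \<T> \<delta> w" and \<delta>: "L2 \<Omega> \<delta>"
    and w: "\<And>K. K \<in> \<T> \<Longrightarrow> continuous_on UNIV (p K)" "\<And>K x. K \<in> \<T> \<Longrightarrow> x \<in> interior K \<Longrightarrow> w x = p K x"
    and K: "K1 \<in> \<T>" "K2 \<in> \<T>" "K1 \<noteq> K2" "aff_dim (K1 \<inter> K2) = int DIM(real^'n) - 1"
  defines "m \<equiv> \<lambda>K. (LINT x:K|lebesgue. p K x) / measure lebesgue K"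
    and "d \<equiv> \<lambda>K. (LINT x:interior K|lebesgue. (norm (\<delta> x))\<^sup>2)"
  shows "(m K1 - m K2)\<^sup>2 \<le> (d K1 + d K2) *
     ((diameter K1)\<^sup>2 / measure lebesgue K1 + (diameter K2)\<^sup>2 / measure lebesgue K2)"
proof -
  obtain F a1 a2 c q where F: "finite F" "card F = DIM(real^'n)" "a1 \<notin> F" "a2 \<notin> F"
    "K1 = convex hull (insert a1 F)" "K2 = convex hull (insert a2 F)"
    "\<And>y. y \<in> F \<Longrightarrow> c + q \<bullet> y = 0" "c + q \<bullet> a1 = 1" "c + q \<bullet> a2 \<noteq> 0"
    using mesh_facet_neighbours[OF M K] by metis
  have Fne: "F \<noteq> {}" using F(2) by auto
  have cc: "compact K" "convex K" and mp: "measure lebesgue K > 0" if "K \<in> \<T>" for K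
    using full_simplex_interior(3,4,5)[OF simplicial_meshD(2)[OF M that]] by auto
  define \<beta> where "\<beta> K x = (if K = K1 then (1 / measure lebesgue K1) *\<^sub>R (x - a1)
      else (- 1 / measure lebesgue K2) *\<^sub>R (x - a2))" for K x
  define z where "z K x = (if K = K1 then real CARD('n) / measure lebesgue K1
      else - (real CARD('n) / measure lebesgue K2))" for K and x :: "real^'n"
  have c\<beta>: "continuous_on UNIV (\<beta> K)" "continuous_on UNIV (z K)" for K
    unfolding \<beta>_def z_def by (cases "K = K1"; simp; intro continuous_intros)+
  have flux: "(LINT x:K1|lebesgue. real CARD('n) * \<phi> x + G x \<bullet> (x - a1)) / measure lebesgue K1
       = (LINT x:K2|lebesgue. real CARD('n) * \<phi> x + G x \<bullet> (x - a2)) / measure lebesgue K2"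
    if "C1_with_grad \<phi> G" for \<phi> G
    using simplex_face_flux_eq[OF F(1) Fne F(7,8,9,5,6) mp[OF K(1)] that] by simp
  have test: "(\<Sum>K\<in>{K1, K2}. LINT x:interior K|lebesgue. \<delta> x \<bullet> \<beta> K x)
      = (\<Sum>K\<in>{K1, K2}. LINT x:K|lebesgue. z K x * p K x)"
  proof (rule discrete_gradient_test[OF M int\<Omega> r _ dg \<delta> w])
    fix L assume "L \<in> {K1, K2}"
    have "local_sigma fam r (\<lambda>x. (- (k *\<^sub>R a)) + k *\<^sub>R x)" for k and a :: "real^'n"
      using r by (intro local_sigma_P_minus_imp poly_fun_const)
    from this[of "1 / measure lebesgue K1" a1] this[of "- 1 / measure lebesgue K2" a2]
    show "local_sigma fam r (\<beta> L)"
      unfolding \<beta>_def by (cases "L = K1") (simp_all add: algebra_simps)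
  next
    fix \<phi> G assume C: "C1_with_grad \<phi> (G :: real^'n \<Rightarrow> real^'n)"
    note c\<phi> = C1_with_gradD(1,3)[OF C]
    have i: "set_integrable lebesgue L (\<lambda>x. real CARD('n) * \<phi> x)" "set_integrable lebesgue L (\<lambda>x. G x \<bullet> (x - a))"
      if "L \<in> \<T>" for L a
      by (intro set_integrable_compact_continuous(2) cc[OF that] continuous_intros c\<phi>; fail)
         (intro set_integrable_compact_continuous(2) cc[OF that] continuous_intros c\<phi>)
    have "(LINT x:K1|lebesgue. \<beta> K1 x \<bullet> G x) = (LINT x:K1|lebesgue. G x \<bullet> (x - a1)) / measure lebesgue K1"
      unfolding \<beta>_def by (simp add: inner_commute)
    moreover have "(LINT x:K2|lebesgue. \<beta> K2 x \<bullet> G x) = - ((LINT x:K2|lebesgue. G x \<bullet> (x - a2)) / measure lebesgue K2)"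
    proof -
      have "\<beta> K2 x \<bullet> G x = (- 1 / measure lebesgue K2) * (G x \<bullet> (x - a2))" for x
        using K(3) by (simp add: \<beta>_def inner_commute)
      note eq = this
      show ?thesis unfolding eq set_integral_mult_right by simp
    qed
    moreover have "(LINT x:K1|lebesgue. z K1 x * \<phi> x) = (LINT x:K1|lebesgue. real CARD('n) * \<phi> x) / measure lebesgue K1"
      unfolding z_def by simp
    moreover have "(LINT x:K2|lebesgue. z K2 x * \<phi> x) = - ((LINT x:K2|lebesgue. real CARD('n) * \<phi> x) / measure lebesgue K2)"
    proof -
      have "z K2 x * \<phi> x = (- 1 / measure lebesgue K2) * (real CARD('n) * \<phi> x)" for x
        using K(3) by (simp add: z_def)
      note eq = this
      show ?thesis unfolding eq set_integral_mult_right by simp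
    qed
    moreover note flux[OF C, unfolded set_integral_add(2)[OF i[OF K(1)]] set_integral_add(2)[OF i[OF K(2)]] add_divide_distrib]
    ultimately show "(\<Sum>K\<in>{K1, K2}. LINT x:K|lebesgue. \<beta> K x \<bullet> G x) = - (\<Sum>K\<in>{K1, K2}. LINT x:K|lebesgue. z K x * \<phi> x)"
      using K(3) by simp
  qed (use K c\<beta> in auto)
  have zp: "(\<Sum>K\<in>{K1, K2}. LINT x:K|lebesgue. z K x * p K x) = real CARD('n) * (m K1 - m K2)"
    using K(3) by (simp add: z_def m_def right_diff_distrib)
  define s where "s K = (diameter K)\<^sup>2 / measure lebesgue K" for K :: "(real^'n) set"
  have s0: "s K \<ge> 0" for K by (simp add: s_def)
  have d0: "d K \<ge> 0" for K
    unfolding d_def set_lebesgue_integral_def by (rule integral_nonneg_AE) auto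
  have one: "(LINT x:interior L|lebesgue. \<delta> x \<bullet> \<beta> L x)\<^sup>2 \<le> d L * s L" if L: "L \<in> {K1, K2}" for L
  proof -
    have LT: "L \<in> \<T>" using K L by auto
    have b: "L2 L (\<beta> L)"
      using L2_compact_continuous[OF cc(1)[OF LT]] continuous_on_subset[OF c\<beta>(1)] by blast
    then have bi: "L2 (interior L) (\<beta> L)" by (rule L2_subset) (auto simp: interior_subset)
    have "(LINT x:interior L|lebesgue. \<delta> x \<bullet> \<beta> L x)\<^sup>2 \<le> d L * (LINT x:interior L|lebesgue. (norm (\<beta> L x))\<^sup>2)"
      unfolding d_def using L2_Cauchy_Schwarz[OF L2_subset[OF \<delta> int\<Omega>[OF LT]] bi] by simp
    also have "(LINT x:interior L|lebesgue. (norm (\<beta> L x))\<^sup>2) = (LINT x:L|lebesgue. (norm (\<beta> L x))\<^sup>2)"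
      by (rule set_integral_interior(2)[OF cc[OF LT]]) (use b in \<open>simp add: L2_def\<close>)
    \<comment> \<open>On \<open>L\<close> the field is \<open>x - a\<close> for a vertex
      \<open>a\<close>, up to sign, divided by the volume; hence the weight
      \<open>s L\<close>.\<close>
    also have "\<dots> \<le> (LINT x:L|lebesgue. (diameter L / measure lebesgue L)\<^sup>2)"
    proof (rule set_integral_mono)
      show "set_integrable lebesgue L (\<lambda>x. (norm (\<beta> L x))\<^sup>2)" using b by (simp add: L2_def)
      show "set_integrable lebesgue L (\<lambda>x. (diameter L / measure lebesgue L)\<^sup>2)"
        by (intro set_integrable_compact_continuous(2) cc LT continuous_intros)
      fix x assume x: "x \<in> L"
      obtain a where a: "a \<in> L" "norm (\<beta> L x) = norm (x - a) / measure lebesgue L"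
      proof (cases "L = K1")
        case True
        then show ?thesis using that[of a1] F(5) mp[OF K(1)] by (simp add: \<beta>_def hull_inc)
      next
        case False
        then have "L = K2" using L by auto
        then show ?thesis using that[of a2] F(6) mp[OF K(2)] K(3) by (simp add: \<beta>_def hull_inc)
      qed
      have "norm (x - a) \<le> diameter L"
        using diameter_bounded_bound[OF compact_imp_bounded[OF cc(1)[OF LT]] x a(1)] by (simp add: dist_norm)
      then show "(norm (\<beta> L x))\<^sup>2 \<le> (diameter L / measure lebesgue L)\<^sup>2"
        using mp[OF LT] by (intro power_mono) (auto simp: a(2) divide_right_mono)
    qed
    also have "\<dots> = s L"
      unfolding set_lebesgue_integral_const using mp[OF LT] by (simp add: s_def power_divide power2_eq_square)
    finally show ?thesis using d0[of L] by (simp add: mult_left_mono)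
  qed
  let ?I = "\<lambda>L. LINT x:interior L|lebesgue. \<delta> x \<bullet> \<beta> L x"
  have I: "\<bar>?I L\<bar> \<le> sqrt (d L) * sqrt (s L)" if "L \<in> {K1, K2}" for L
    using one[OF that] by (metis real_sqrt_abs real_sqrt_le_iff real_sqrt_mult)
  have "real CARD('n) * (m K1 - m K2) = ?I K1 + ?I K2"
    using test zp K(3) by simp
  then have "\<bar>real CARD('n) * (m K1 - m K2)\<bar> \<le> sqrt (d K1) * sqrt (s K1) + sqrt (d K2) * sqrt (s K2)"
    using I[of K1] I[of K2] by auto
  moreover have "\<bar>m K1 - m K2\<bar> \<le> \<bar>real CARD('n) * (m K1 - m K2)\<bar>"
    by (simp add: abs_mult mult_le_cancel_right1 Suc_le_eq)
  ultimately have "\<bar>m K1 - m K2\<bar> \<le> sqrt (d K1) * sqrt (s K1) + sqrt (d K2) * sqrt (s K2)" by linarith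
  then have "(m K1 - m K2)\<^sup>2 \<le> (sqrt (d K1) * sqrt (s K1) + sqrt (d K2) * sqrt (s K2))\<^sup>2"
    by (rule abs_le_square_iff[THEN iffD1, OF order_trans]) simp
  \<comment> \<open>Cauchy-Schwarz for two terms: the sides differ by the square of a
    determinant.\<close>
  also have "\<dots> \<le> ((sqrt (d K1))\<^sup>2 + (sqrt (d K2))\<^sup>2) * ((sqrt (s K1))\<^sup>2 + (sqrt (s K2))\<^sup>2)"
    using sum_squares_ge_zero[of 0 "sqrt (d K1) * sqrt (s K2) - sqrt (d K2) * sqrt (s K1)"]
    by (simp add: power2_eq_square algebra_simps)
  finally show ?thesis using d0 s0 by (simp add: s_def)
qed

section \<open>Weighted Poincare inequality on a simplex\<close>

lemma barycentric_coordinates: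
  fixes V :: "'a::euclidean_space set"
  assumes V: "\<not> affine_dependent V"
  obtains c q where
    "\<And>k l. k \<in> V \<Longrightarrow> l \<in> V \<Longrightarrow> c k + q k \<bullet> l = (if l = k then 1 else (0::real))"
    "\<And>k x. k \<in> V \<Longrightarrow> x \<in> convex hull (V - {k}) \<Longrightarrow> c k + q k \<bullet> x = 0"
    "\<And>k x. k \<in> V \<Longrightarrow> x \<in> convex hull V \<Longrightarrow> 0 \<le> c k + q k \<bullet> x"
    "\<And>x. x \<in> convex hull V \<Longrightarrow> (\<Sum>k\<in>V. c k + q k \<bullet> x) = 1"
    "\<And>x. x \<in> convex hull V \<Longrightarrow> (\<Sum>k\<in>V. (c k + q k \<bullet> x) *\<^sub>R k) = x"
proof -
  have fin: "finite V" using V aff_independent_finite by blast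
  have "\<exists>cq. \<forall>l\<in>V. fst cq + snd cq \<bullet> l = (if l = k then 1 else (0::real))" for k
    by (rule affine_function_extension[OF V, of "\<lambda>l. if l = k then 1 else 0"]) fastforce
  then obtain cq where "\<And>k. \<forall>l\<in>V. fst (cq k) + snd (cq k) \<bullet> l = (if l = k then 1 else (0::real))"
    using choice[of "\<lambda>k cq. \<forall>l\<in>V. fst cq + snd cq \<bullet> l = (if l = k then 1 else (0::real))"] by auto
  moreover define c q where "c k = fst (cq k)" and "q k = snd (cq k)" for k
  ultimately have cq: "c k + q k \<bullet> l = (if l = k then 1 else (0::real))" if "l \<in> V" for k l
    using that by simp
  have comb: "c k + q k \<bullet> x = u k" if "k \<in> V" "x = (\<Sum>l\<in>V. u l *\<^sub>R l)" "sum u V = 1" for k x u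
  proof -
    have "c k + q k \<bullet> x = (\<Sum>l\<in>V. u l * c k) + (\<Sum>l\<in>V. u l * (q k \<bullet> l))"
      using that by (simp add: sum_distrib_right[symmetric] inner_sum_right)
    also have "\<dots> = (\<Sum>l\<in>V. u l * (c k + q k \<bullet> l))" by (simp add: sum.distrib distrib_left)
    also have "\<dots> = (\<Sum>l\<in>V. if l = k then u l else 0)" by (intro sum.cong) (auto simp: cq)
    also have "\<dots> = u k" using fin that(1) by simp
    finally show ?thesis .
  qed
  have hull: "\<exists>u. (\<forall>l\<in>V. 0 \<le> u l) \<and> sum u V = 1 \<and> x = (\<Sum>l\<in>V. u l *\<^sub>R l)" if "x \<in> convex hull V" for x
    using that convex_hull_finite[OF fin] by auto
  show ?thesis
  proof (rule that)
    show "c k + q k \<bullet> l = (if l = k then 1 else (0::real))" if "l \<in> V" for k l using cq that .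
    show "c k + q k \<bullet> x = 0" if "k \<in> V" "x \<in> convex hull (V - {k})" for k x
    proof -
      have sub: "V - {k} \<subseteq> {x. q k \<bullet> x = - c k}" using cq[of _ k] by fastforce
      have "convex hull (V - {k}) \<subseteq> {x. q k \<bullet> x = - c k}"
        using sub by (rule hull_minimal) (rule convex_hyperplane)
      then show ?thesis using that by auto
    qed
    fix x assume "x \<in> convex hull V"
    then obtain u where u: "\<And>l. l \<in> V \<Longrightarrow> 0 \<le> u l" "sum u V = 1" "x = (\<Sum>l\<in>V. u l *\<^sub>R l)" using hull by blast
    have cu: "c k + q k \<bullet> x = u k" if "k \<in> V" for k using comb[OF that u(3,2)] .
    show "0 \<le> c k + q k \<bullet> x" if "k \<in> V" for k using cu u(1) that by simp
    show "(\<Sum>k\<in>V. c k + q k \<bullet> x) = 1" using u(2) by (simp add: cu)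
    show "(\<Sum>k\<in>V. (c k + q k \<bullet> x) *\<^sub>R k) = x"
    proof -
      have "(\<Sum>k\<in>V. (c k + q k \<bullet> x) *\<^sub>R k) = (\<Sum>k\<in>V. u k *\<^sub>R k)" by (intro sum.cong refl) (simp add: cu)
      then show ?thesis using u(3) by simp
    qed
  qed
qed

text \<open>Jensen's inequality on the unit interval, in the form demanded by
  \<open>convex_poincare\<close>. It expresses that the variance of \<open>g\<close>, whose mean is
  \<open>f 1 - f 0\<close>, is nonnegative.\<close>

lemma square_diff_le_integral:
  fixes f g :: "real \<Rightarrow> real"
  assumes f: "\<And>s. s \<in> {0..1} \<Longrightarrow> (f has_real_derivative g s) (at s within {0..1})"
    and g: "continuous_on {0..1} g" and q: "continuous_on {0..1} q" "\<And>s. s \<in> {0..1} \<Longrightarrow> (g s)\<^sup>2 \<le> q s"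
  shows "ennreal ((f 0 - f 1)\<^sup>2) \<le> (\<integral>\<^sup>+s. indicator {0..1} s * ennreal (q s) \<partial>lborel)"
proof -
  have gi: "(g has_integral (f 1 - f 0)) {0..1}"
    using f by (intro fundamental_theorem_of_calculus) (auto simp: has_real_derivative_iff_has_vector_derivative)
  have i: "(\<lambda>s. (g s)\<^sup>2) integrable_on {0..1}" "g integrable_on {0..1}" "q integrable_on {0..1}"
    by (intro integrable_continuous_real continuous_intros g q)+
  define c where "c = f 1 - f 0"
  have "0 \<le> integral {0..1} (\<lambda>s. (g s - c)\<^sup>2)"
    by (intro integral_nonneg integrable_continuous_real continuous_intros g) auto
  also have "(\<lambda>s. (g s - c)\<^sup>2) = (\<lambda>s. ((g s)\<^sup>2 - (2 * c) * g s) + c\<^sup>2)"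
    by (auto simp: power2_eq_square algebra_simps fun_eq_iff)
  also have "integral {0..1} \<dots> = integral {0..1} (\<lambda>s. (g s)\<^sup>2) - (2 * c) * c + c\<^sup>2"
  proof -
    have "(g has_integral c) {0..1}" using gi by (simp add: c_def)
    from has_integral_add[OF has_integral_diff[OF integrable_integral[OF i(1)] has_integral_mult_right[OF this, of "2 * c"]]
        has_integral_const_real[of "c\<^sup>2" 0 1]]
    show ?thesis by (simp add: integral_unique)
  qed
  finally have "c\<^sup>2 \<le> integral {0..1} (\<lambda>s. (g s)\<^sup>2)" by (simp add: power2_eq_square)
  then have "(f 0 - f 1)\<^sup>2 \<le> integral {0..1} (\<lambda>s. (g s)\<^sup>2)" by (simp add: c_def power2_commute)
  also have "\<dots> \<le> integral {0..1} q"
    using i q(2) by (intro integral_le) auto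
  finally have le: "(f 0 - f 1)\<^sup>2 \<le> integral {0..1} q" .
  have q0: "q s \<ge> 0" if "s \<in> {0..1}" for s using q(2)[OF that] zero_le_power2[of "g s"] by linarith
  have qi: "integrable lborel (\<lambda>s. indicator {0..1} s *\<^sub>R q s)"
    using borel_integrable_compact[OF _ q(1)] by simp
  have "integral {0..1} q = (\<integral>s. indicator {0..1} s * q s \<partial>lborel)"
    using set_borel_integral_eq_integral(2)[of "{0..1}" q] qi by (simp add: set_integrable_def set_lebesgue_integral_def)
  then have "ennreal (integral {0..1} q) = (\<integral>\<^sup>+s. ennreal (indicator {0..1} s * q s) \<partial>lborel)"
    using qi q0 by (simp add: nn_integral_eq_integral indicator_def)
  also have "\<dots> = (\<integral>\<^sup>+s. indicator {0..1} s * ennreal (q s) \<partial>lborel)"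
    by (intro nn_integral_cong) (auto simp: indicator_def)
  finally show ?thesis using le by (metis ennreal_leI)
qed

lemma set_integral_mean_minimal:
  fixes f :: "'a::euclidean_space \<Rightarrow> real"
  assumes K: "compact K" "measure lebesgue K > 0" and f: "continuous_on K f"
  defines "m \<equiv> (LINT x:K|lebesgue. f x) / measure lebesgue K"
  shows "(LINT x:K|lebesgue. (f x - m)\<^sup>2) \<le> (LINT x:K|lebesgue. (f x - c)\<^sup>2)"
proof -
  have i: "set_integrable lebesgue K g" if "continuous_on K g" for g :: "'a \<Rightarrow> real"
    using set_integrable_compact_continuous(2)[OF K(1) that] .
  have exp: "(LINT x:K|lebesgue. (f x - a)\<^sup>2) = (LINT x:K|lebesgue. (f x)\<^sup>2) - 2 * a * (measure lebesgue K * m) + measure lebesgue K * a\<^sup>2" for a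
  proof -
    have "(LINT x:K|lebesgue. (f x - a)\<^sup>2) = (LINT x:K|lebesgue. ((f x)\<^sup>2 - (2 * a) * f x) + a\<^sup>2)"
      by (simp add: power2_eq_square algebra_simps)
    also have "\<dots> = ((LINT x:K|lebesgue. (f x)\<^sup>2) - (LINT x:K|lebesgue. (2 * a) * f x)) + (LINT x:K|lebesgue. a\<^sup>2)"
      by (subst set_integral_add(2) set_integral_diff(2); (intro i continuous_intros f)?)+ simp
    finally show ?thesis using K(2) by (simp add: set_lebesgue_integral_const m_def)
  qed
  have "0 \<le> measure lebesgue K * (m - c)\<^sup>2" by simp
  then show ?thesis unfolding exp by (simp add: power2_eq_square algebra_simps)
qed

text \<open>The weight below vanishes on the boundary, and along a straight segment it is only comparable to
  \<open>t (1 - t)\<close>; the reparametrisation \<open>t = s\<^sup>2 (3 - 2 s)\<close> compensates this.\<close>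

lemma smoothstep_bound:
  fixes s x y :: real
  assumes s: "s \<in> {0..1}" and xy: "x \<ge> 0" "y \<ge> 0"
  defines "t \<equiv> s\<^sup>2 * (3 - 2 * s)"
  shows "t \<in> {0..1}" "(6 * s * (1 - s) * (y - x))\<^sup>2 \<le> (12 * (x + y)) * ((1 - t) * x + t * y)"
proof -
  have 1: "1 - t = (1 - s)\<^sup>2 * (1 + 2 * s)" by (simp add: t_def power2_eq_square algebra_simps)
  have t0: "0 \<le> t" using s by (auto simp: t_def)
  moreover have t1: "0 \<le> 1 - t" unfolding 1 using s by auto
  ultimately show "t \<in> {0..1}" by simp
  have "t * (1 - t) = (s * (1 - s))\<^sup>2 * ((3 - 2 * s) * (1 + 2 * s))"
    unfolding 1 by (simp add: t_def power_mult_distrib)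
  moreover have "(3 - 2 * s) * (1 + 2 * s) = 3 + 4 * (s * (1 - s))" by (simp add: algebra_simps)
  moreover have "s * (1 - s) \<ge> 0" using s by auto
  ultimately have "t * (1 - t) \<ge> (s * (1 - s))\<^sup>2 * 3"
    by (simp add: mult_left_mono)
  then have a: "(6 * s * (1 - s))\<^sup>2 \<le> 12 * (t * (1 - t))"
    by (simp add: power_mult_distrib)
  have "(y - x)\<^sup>2 \<le> (x + y)\<^sup>2" using xy by (simp add: power2_eq_square algebra_simps)
  with a have "(6 * s * (1 - s))\<^sup>2 * (y - x)\<^sup>2 \<le> 12 * (t * (1 - t)) * (x + y)\<^sup>2"
    using t0 t1 by (intro mult_mono) auto
  also have "\<dots> = (12 * (x + y)) * (t * ((1 - t) * x) + (1 - t) * (t * y))"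
    by (simp add: power2_eq_square algebra_simps)
  also have "\<dots> \<le> (12 * (x + y)) * ((1 - t) * x + t * y)"
  proof (intro mult_left_mono add_mono)
    show "t * ((1 - t) * x) \<le> (1 - t) * x" using t0 t1 xy by (intro mult_left_le_one_le) auto
    show "(1 - t) * (t * y) \<le> t * y" using t0 t1 xy by (intro mult_left_le_one_le) auto
  qed (use xy in auto)
  finally show "(6 * s * (1 - s) * (y - x))\<^sup>2 \<le> (12 * (x + y)) * ((1 - t) * x + t * y)"
    by (simp add: power_mult_distrib)
qed

text \<open>Only barycentric coordinates enter, so the constant is the same for all simplices of a
  dimension. The direction \<open>y - x\<close> is expanded in the vectors from the current point of
  the segment to the vertices, and Cauchy-Schwarz over the vertices leaves exactly the weight at the
  current point with the derivatives, which is \<open>Q\<close>.\<close>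

lemma simplex_weighted_poincare:
  fixes K :: "'a::euclidean_space set" and p :: "'a \<Rightarrow> real"
  assumes V: "\<not> affine_dependent V" "K = convex hull V" and mK: "measure lebesgue K > 0"
    and p: "C1_with_grad p G"
    and l: "\<And>k x. k \<in> V \<Longrightarrow> x \<in> K \<Longrightarrow> 0 \<le> c k + q k \<bullet> x"
      "\<And>x. x \<in> K \<Longrightarrow> (\<Sum>k\<in>V. c k + q k \<bullet> x) = 1"
      "\<And>x. x \<in> K \<Longrightarrow> (\<Sum>k\<in>V. (c k + q k \<bullet> x) *\<^sub>R k) = x"
  defines "Q \<equiv> \<lambda>x. \<Sum>k\<in>V. (c k + q k \<bullet> x) * ((k - x) \<bullet> G x)\<^sup>2"
    and "m \<equiv> (LINT x:K|lebesgue. p x) / measure lebesgue K"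
  shows "(LINT x:K|lebesgue. (p x - m)\<^sup>2) \<le> 24 * 2 ^ DIM('a) * (LINT x:K|lebesgue. Q x)"
proof -
  have fin: "finite V" using V aff_independent_finite by blast
  have K: "compact K" "convex K" using fin V(2) by (auto intro: finite_imp_compact_convex_hull)
  note cp = C1_with_gradD(1,3)[OF p]
  have cQ: "continuous_on S Q" for S unfolding Q_def by (intro continuous_intros cp)
  have Q0: "Q x \<ge> 0" if "x \<in> K" for x
    unfolding Q_def using l(1)[OF _ that] by (intro sum_nonneg mult_nonneg_nonneg) auto
  \<comment> \<open>The speed \<open>6 * s * (1 - s)\<close> vanishes at both ends of the segment,
    where the weights may vanish too.\<close>
  define \<theta> where "\<theta> s = s\<^sup>2 * (3 - 2 * s)" for s :: real
  have bound: "ennreal ((p x - p y)\<^sup>2)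
      \<le> (\<integral>\<^sup>+s. indicator {0..1} s * ennreal (24 * Q ((1 - \<theta> s) *\<^sub>R x + \<theta> s *\<^sub>R y)) \<partial>lborel)"
    if x: "x \<in> K" and y: "y \<in> K" for x y
  proof -
    define Z where "Z s = (1 - \<theta> s) *\<^sub>R x + \<theta> s *\<^sub>R y" for s
    define g where "g s = 6 * s * (1 - s) * (G (Z s) \<bullet> (y - x))" for s
    have cZ: "continuous_on S Z" for S unfolding Z_def \<theta>_def by (intro continuous_intros)
    have Zd: "(Z has_derivative (\<lambda>h. h *\<^sub>R ((6 * s * (1 - s)) *\<^sub>R (y - x)))) (at s within A)" for s A
    proof -
      have "Z = (\<lambda>s. x + \<theta> s *\<^sub>R (y - x))" by (auto simp: Z_def algebra_simps)
      moreover have "(\<theta> has_derivative (\<lambda>h. h * (6 * s * (1 - s)))) (at s within A)"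
        unfolding \<theta>_def by (auto intro!: derivative_eq_intros simp: power2_eq_square algebra_simps)
      ultimately show ?thesis by (auto intro!: derivative_eq_intros)
    qed
    have "((\<lambda>s. p (Z s)) has_real_derivative g s) (at s within {0..1})" for s
      using has_derivative_compose[OF Zd C1_with_gradD(2)[OF p, of "Z s" UNIV]]
      by (simp add: has_field_derivative_def g_def mult_commute_abs mult_ac)
    moreover have "continuous_on {0..1} g"
      unfolding g_def by (intro continuous_intros continuous_on_compose2[OF cp(1)[of UNIV] cZ]) auto
    moreover have "continuous_on {0..1} (\<lambda>s. 24 * Q (Z s))"
      by (intro continuous_intros continuous_on_compose2[OF cQ[of UNIV] cZ]) auto
    moreover have "(g s)\<^sup>2 \<le> 24 * Q (Z s)" if s: "s \<in> {0..1}" for s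
    proof -
      let ?l = "\<lambda>k x. c k + q k \<bullet> x"
      have lZ: "?l k (Z s) = (1 - \<theta> s) * ?l k x + \<theta> s * ?l k y" for k
        by (simp add: Z_def inner_add_right algebra_simps)
      have \<theta>01: "\<theta> s \<in> {0..1}" using smoothstep_bound(1)[OF s, of 0 0] by (simp add: \<theta>_def)
      have ZK: "Z s \<in> K" using convexD_alt[OF K(2) x y, of "\<theta> s"] \<theta>01 by (simp add: Z_def)
      define a where "a k = sqrt (12 * (?l k x + ?l k y))" for k
      define b where "b k = sqrt (?l k (Z s)) * \<bar>(k - Z s) \<bullet> G (Z s)\<bar>" for k
      \<comment> \<open>The coefficients sum to zero, so \<open>Z s\<close> may be subtracted from
        every vertex.\<close>
      have "y - x = (\<Sum>k\<in>V. (?l k y - ?l k x) *\<^sub>R (k - Z s))"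
      proof -
        have "(\<Sum>k\<in>V. (?l k y - ?l k x) *\<^sub>R (k - Z s)) = ((\<Sum>k\<in>V. ?l k y *\<^sub>R k) - (\<Sum>k\<in>V. ?l k x *\<^sub>R k))
          - ((\<Sum>k\<in>V. ?l k y) *\<^sub>R Z s - (\<Sum>k\<in>V. ?l k x) *\<^sub>R Z s)"
          by (simp only: scaleR_diff_left scaleR_diff_right sum_subtractf scaleR_sum_left)
        then show ?thesis by (simp only: l(2,3)[OF x] l(2,3)[OF y]) simp
      qed
      then have "G (Z s) \<bullet> (y - x) = (\<Sum>k\<in>V. (?l k y - ?l k x) * ((k - Z s) \<bullet> G (Z s)))"
        by (simp only: inner_sum_right inner_scaleR_right inner_commute[of "G (Z s)"])
      then have "\<bar>g s\<bar> = \<bar>\<Sum>k\<in>V. (6 * s * (1 - s) * (?l k y - ?l k x)) * ((k - Z s) \<bullet> G (Z s))\<bar>"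
        by (simp add: g_def sum_distrib_left mult.assoc)
      also have "\<dots> \<le> (\<Sum>k\<in>V. \<bar>6 * s * (1 - s) * (?l k y - ?l k x)\<bar> * \<bar>(k - Z s) \<bullet> G (Z s)\<bar>)"
        using sum_abs[of "\<lambda>k. (6 * s * (1 - s) * (?l k y - ?l k x)) * ((k - Z s) \<bullet> G (Z s))" V] by (simp add: abs_mult)
      also have "\<dots> \<le> (\<Sum>k\<in>V. a k * b k)"
      proof (rule sum_mono)
        fix k assume k: "k \<in> V"
        have "\<bar>6 * s * (1 - s) * (?l k y - ?l k x)\<bar> = sqrt ((6 * s * (1 - s) * (?l k y - ?l k x))\<^sup>2)" by simp
        also have "\<dots> \<le> sqrt ((12 * (?l k x + ?l k y)) * ?l k (Z s))"
          using smoothstep_bound(2)[OF s l(1)[OF k x] l(1)[OF k y]] unfolding lZ \<theta>_def by (rule real_sqrt_le_mono)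
        finally show "\<bar>6 * s * (1 - s) * (?l k y - ?l k x)\<bar> * \<bar>(k - Z s) \<bullet> G (Z s)\<bar> \<le> a k * b k"
          unfolding a_def b_def by (simp add: real_sqrt_mult mult_right_mono mult.assoc[symmetric])
      qed
      finally have "(g s)\<^sup>2 \<le> (\<Sum>k\<in>V. a k * b k)\<^sup>2"
        by (rule abs_le_square_iff[THEN iffD1, OF order_trans]) simp
      also have "\<dots> \<le> (\<Sum>k\<in>V. (a k)\<^sup>2) * (\<Sum>k\<in>V. (b k)\<^sup>2)"
        by (rule Cauchy_Schwarz_ineq_sum)
      also have "(\<Sum>k\<in>V. (a k)\<^sup>2) = (\<Sum>k\<in>V. 12 * (?l k x + ?l k y))"
      proof (intro sum.cong refl)
        fix k assume k: "k \<in> V"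
        have "0 \<le> 12 * (?l k x + ?l k y)"
          using add_nonneg_nonneg[OF l(1)[OF k x] l(1)[OF k y]] by (rule mult_nonneg_nonneg[rotated]) simp
        then show "(a k)\<^sup>2 = 12 * (?l k x + ?l k y)" by (simp only: a_def real_sqrt_pow2)
      qed
      \<comment> \<open>Twice 12, as the coordinates of \<open>x\<close> and those of
        \<open>y\<close> each sum to 1.\<close>
      also have "\<dots> = 24" using l(2)[OF x] l(2)[OF y] by (simp add: sum_distrib_left[symmetric] sum.distrib)
      also have "(\<Sum>k\<in>V. (b k)\<^sup>2) = Q (Z s)"
        unfolding Q_def b_def using l(1)[OF _ ZK] by (intro sum.cong) (auto simp: power_mult_distrib)
      finally show ?thesis .
    qed
    ultimately have "ennreal ((p (Z 0) - p (Z 1))\<^sup>2) \<le> (\<integral>\<^sup>+s. indicator {0..1} s * ennreal (24 * Q (Z s)) \<partial>lborel)"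
      by (intro square_diff_le_integral[where g = g]) auto
    then show ?thesis by (simp add: Z_def \<theta>_def)
  qed
  have mb: "p \<in> borel_measurable borel" "(\<lambda>x. 24 * Q x) \<in> borel_measurable borel" "\<theta> \<in> borel_measurable borel"
    using cp cQ by (auto intro!: borel_measurable_continuous_onI continuous_intros simp: \<theta>_def)
  have \<theta>01: "\<theta> s \<in> {0..1}" if "s \<in> {0..1}" for s using smoothstep_bound(1)[OF that, of 0 0] by (simp add: \<theta>_def)
  have Qi: "set_integrable lebesgue K (\<lambda>x. 24 * Q x)"
    by (intro set_integrable_compact_continuous(2) K continuous_intros cQ)
  have Q24: "24 * Q x \<ge> 0" if "x \<in> K" for x using Q0[OF that] by simp
  obtain y where "y \<in> K" "(LINT x:K|lebesgue. (p x - p y)\<^sup>2) \<le> 2 ^ DIM('a) * (LINT x:K|lebesgue. 24 * Q x)"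
    using convex_poincare[OF K mK mb \<theta>01 Q24 Qi bound] by blast
  moreover have "(LINT x:K|lebesgue. (p x - m)\<^sup>2) \<le> (LINT x:K|lebesgue. (p x - p y)\<^sup>2)"
    unfolding m_def by (rule set_integral_mean_minimal[OF K(1) mK cp(2)])
  ultimately show ?thesis by simp
qed

lemma poly_fun_continuous_on:
  assumes "poly_fun r p" shows "continuous_on S p"
  by (rule poly_fun_C1_with_grad[OF assms]) (rule C1_with_gradD(3))

text \<open>The bubble field with \<open>b k = - (k \<bullet> \<nabla>p) \<lambda>\<^sub>k\<close> lies in \<open>P\<^sub>r\<^sup>-\<close>, hence in both families. Pairing it with \<open>\<nabla>p\<close> gives
  the variance of the numbers \<open>k \<bullet> \<nabla>p\<close> with respect to the barycentric weights.\<close>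

lemma element_mean_bound:
  fixes \<Omega> :: "(real^'n) set"
  assumes M: "simplicial_mesh \<T> (closure \<Omega>)" and int\<Omega>: "\<And>K. K \<in> \<T> \<Longrightarrow> interior K \<subseteq> \<Omega>"
    and r: "r \<ge> 1"
    and dg: "discrete_gradient fam r \<Omega> \<T> \<delta> w" and \<delta>: "L2 \<Omega> \<delta>"
    and w: "\<And>K. K \<in> \<T> \<Longrightarrow> poly_fun (r - 1) (p K)" "\<And>K x. K \<in> \<T> \<Longrightarrow> x \<in> interior K \<Longrightarrow> w x = p K x"
    and K: "K \<in> \<T>"
  defines "m \<equiv> \<lambda>K. (LINT x:K|lebesgue. p K x) / measure lebesgue K"
    and "d \<equiv> \<lambda>K. (LINT x:interior K|lebesgue. (norm (\<delta> x))\<^sup>2)"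
  shows "(LINT x:K|lebesgue. (p K x - m K)\<^sup>2) \<le> 24 * 2 ^ CARD('n) * ((diameter K)\<^sup>2 * d K)"
proof -
  have cw: "continuous_on UNIV (p L)" if "L \<in> \<T>" for L
    using poly_fun_continuous_on[OF w(1)[OF that]] .
  have sK: "int DIM(real^'n) simplex K" using simplicial_meshD(2)[OF M K] .
  have cc: "compact K" "convex K" and mp: "measure lebesgue K > 0"
    using full_simplex_interior(3,4,5)[OF sK] by auto
  define V where "V = {v. v extreme_point_of K}"
  have V: "\<not> affine_dependent V" "card V = Suc (DIM(real^'n))" "finite V" "K = convex hull V"
    using full_simplex_vertices[OF sK] by (auto simp: V_def)
  have VK: "k \<in> K" if "k \<in> V" for k using V(4) that by (metis hull_inc)
  have cV: "card V \<ge> 2" using V(2) by (simp add: Suc_le_eq)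
  obtain G where G: "C1_with_grad (p K) G" "\<And>v c u. poly_fun (r - 1) (\<lambda>x. (v \<bullet> G x) * (c + u \<bullet> x))"
    by (rule poly_fun_C1_with_grad[OF w(1)[OF K]], rule that) blast+
  obtain c q where l: "\<And>k l. k \<in> V \<Longrightarrow> l \<in> V \<Longrightarrow> c k + q k \<bullet> l = (if l = k then 1 else (0::real))"
    "\<And>k x. k \<in> V \<Longrightarrow> x \<in> convex hull (V - {k}) \<Longrightarrow> c k + q k \<bullet> x = 0"
    "\<And>k x. k \<in> V \<Longrightarrow> x \<in> convex hull V \<Longrightarrow> 0 \<le> c k + q k \<bullet> x"
    "\<And>x. x \<in> convex hull V \<Longrightarrow> (\<Sum>k\<in>V. c k + q k \<bullet> x) = 1"
    "\<And>x. x \<in> convex hull V \<Longrightarrow> (\<Sum>k\<in>V. (c k + q k \<bullet> x) *\<^sub>R k) = x"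
    by (rule barycentric_coordinates[OF V(1)], rule that) blast+
  define b where "b k x = ((- k) \<bullet> G x) * (c k + q k \<bullet> x)" for k x
  have bp: "poly_fun (r - 1) (b k)" for k unfolding b_def by (rule G(2))
  have "\<exists>B. C1_with_grad (b k) B" for k
    by (rule poly_fun_C1_with_grad[OF bp[of k]]) blast
  then obtain B where B: "\<And>k. C1_with_grad (b k) (B k)" by metis
  have cb: "continuous_on S (b k)" "continuous_on S (B k)" for S k using C1_with_gradD[OF B] by auto
  note cG = C1_with_gradD(1)[OF G(1)]
  define \<beta> where "\<beta> x = (\<Sum>k\<in>V. b k x *\<^sub>R (x - k))" for x
  define z where "z x = (\<Sum>k\<in>V. real DIM(real^'n) * b k x + B k x \<bullet> (x - k))" for x
  have b0: "b k x = 0" if "k \<in> V" "x \<in> convex hull (V - {k})" for k x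
    using l(2)[OF that] by (simp add: b_def)
  have parts: "(LINT x:K|lebesgue. \<beta> x \<bullet> \<Phi> x) = - (LINT x:K|lebesgue. z x * \<phi> x)"
    if "C1_with_grad \<phi> \<Phi>" for \<phi> \<Phi>
    unfolding \<beta>_def z_def V(4) by (rule simplex_bubble_integration_by_parts[OF V(3) cV B b0 that])
  have c\<beta>: "continuous_on S \<beta>" "continuous_on S z" for S
    unfolding \<beta>_def z_def by (intro continuous_intros cb)+
  have ls: "local_sigma fam r \<beta>"
  proof -
    have "poly_fun (r - 1) (\<lambda>x. (\<Sum>k\<in>V. (- k $ i) * b k x))" for i
      by (intro poly_fun_sum poly_fun_cmult bp)
    then have "local_sigma fam r (\<lambda>x. (\<Sum>k\<in>V. b k x *\<^sub>R (- k)) + (\<Sum>k\<in>V. b k x) *\<^sub>R x)"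
      using r by (intro local_sigma_P_minus_imp poly_fun_sum bp) (simp_all add: mult.commute)
    moreover have "\<beta> = (\<lambda>x. (\<Sum>k\<in>V. b k x *\<^sub>R (- k)) + (\<Sum>k\<in>V. b k x) *\<^sub>R x)"
      by (simp add: \<beta>_def fun_eq_iff scaleR_diff_right sum_subtractf scaleR_sum_left sum_negf)
    ultimately show ?thesis by simp
  qed
  have test: "(LINT x:interior K|lebesgue. \<delta> x \<bullet> \<beta> x) = (LINT x:K|lebesgue. z x * p K x)"
  proof -
    have "(\<Sum>L\<in>{K}. LINT x:interior L|lebesgue. \<delta> x \<bullet> \<beta> x) = (\<Sum>L\<in>{K}. LINT x:L|lebesgue. z x * p L x)"
      by (rule discrete_gradient_test[OF M int\<Omega> r _ dg \<delta> cw w(2)]) (use K ls c\<beta> parts in auto)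
    then show ?thesis by simp
  qed
  define Q where "Q x = (\<Sum>k\<in>V. (c k + q k \<bullet> x) * ((k - x) \<bullet> G x)\<^sup>2)" for x
  have cQ: "continuous_on S Q" for S unfolding Q_def by (intro continuous_intros cG)
  have Q0: "Q x \<ge> 0" if "x \<in> K" for x
    unfolding Q_def using l(3) that V(4) by (intro sum_nonneg mult_nonneg_nonneg) auto
  have pt: "\<beta> x \<bullet> G x = Q x \<and> (norm (\<beta> x))\<^sup>2 \<le> (diameter K)\<^sup>2 * Q x" if x: "x \<in> K" for x
  proof -
    let ?l = "\<lambda>k. c k + q k \<bullet> x"
    have l1: "(\<Sum>k\<in>V. ?l k) = 1" and lx: "(\<Sum>k\<in>V. ?l k *\<^sub>R k) = x" and l0: "\<And>k. k \<in> V \<Longrightarrow> 0 \<le> ?l k"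
      using l(3,4,5) x V(4) by auto
    have zero: "(\<Sum>k\<in>V. ?l k *\<^sub>R (k - x)) = 0"
    proof -
      have "(\<Sum>k\<in>V. ?l k *\<^sub>R (k - x)) = (\<Sum>k\<in>V. ?l k *\<^sub>R k) - (\<Sum>k\<in>V. ?l k) *\<^sub>R x"
        by (simp only: scaleR_diff_right sum_subtractf scaleR_sum_left)
      then show ?thesis by (simp only: l1 lx) simp
    qed
    \<comment> \<open>The vectors \<open>k - x\<close> have weighted mean zero, so
      \<open>k \<bullet> G x\<close> may be replaced by \<open>(k - x) \<bullet> G x\<close> in the
      coefficients: the common term \<open>x \<bullet> G x\<close> drops out.\<close>
    have \<beta>eq: "\<beta> x = (\<Sum>k\<in>V. (?l k * ((k - x) \<bullet> G x)) *\<^sub>R (k - x))"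
    proof -
      have "b k x *\<^sub>R (x - k) = (?l k * ((k - x) \<bullet> G x)) *\<^sub>R (k - x) + (x \<bullet> G x) *\<^sub>R (?l k *\<^sub>R (k - x))" for k
      proof -
        have "b k x *\<^sub>R (x - k) = (- b k x) *\<^sub>R (k - x)" by (simp add: scaleR_diff_right)
        also have "- b k x = ?l k * ((k - x) \<bullet> G x) + (x \<bullet> G x) * ?l k"
          unfolding b_def inner_diff_left inner_minus_left right_diff_distrib by simp
        finally show ?thesis
          by (simp only: scaleR_scaleR scaleR_add_left[of "?l k * ((k - x) \<bullet> G x)"])
      qed
      then have "\<beta> x = (\<Sum>k\<in>V. (?l k * ((k - x) \<bullet> G x)) *\<^sub>R (k - x)) + (x \<bullet> G x) *\<^sub>R (\<Sum>k\<in>V. ?l k *\<^sub>R (k - x))"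
        unfolding \<beta>_def by (simp only: sum.distrib scaleR_sum_right)
      then show ?thesis by (simp only: zero) simp
    qed
    have 1: "\<beta> x \<bullet> G x = Q x"
      unfolding \<beta>eq Q_def inner_sum_left by (intro sum.cong refl) (simp only: inner_scaleR_left power2_eq_square mult.assoc)
    have "norm (\<beta> x) \<le> (\<Sum>k\<in>V. norm ((?l k * ((k - x) \<bullet> G x)) *\<^sub>R (k - x)))"
      unfolding \<beta>eq by (rule norm_sum)
    also have "\<dots> \<le> (\<Sum>k\<in>V. sqrt (?l k) * (sqrt (?l k) * \<bar>(k - x) \<bullet> G x\<bar>) * diameter K)"
    proof (rule sum_mono)
      fix k assume k: "k \<in> V"
      have "norm (k - x) \<le> diameter K"
        using diameter_bounded_bound[OF compact_imp_bounded[OF cc(1)] VK[OF k] x] by (simp add: dist_norm)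
      moreover have "sqrt (?l k) * (sqrt (?l k) * \<bar>(k - x) \<bullet> G x\<bar>) = \<bar>?l k * ((k - x) \<bullet> G x)\<bar>"
        using l0[OF k] by (simp only: abs_mult mult.assoc[symmetric] real_sqrt_mult_self abs_of_nonneg)
      ultimately show "norm ((?l k * ((k - x) \<bullet> G x)) *\<^sub>R (k - x)) \<le> sqrt (?l k) * (sqrt (?l k) * \<bar>(k - x) \<bullet> G x\<bar>) * diameter K"
        by (simp only: norm_scaleR) (intro mult_left_mono, auto)
    qed
    also have "\<dots> = diameter K * (\<Sum>k\<in>V. sqrt (?l k) * (sqrt (?l k) * \<bar>(k - x) \<bullet> G x\<bar>))"
      unfolding sum_distrib_right[symmetric] by (rule mult.commute)
    finally have "(norm (\<beta> x))\<^sup>2 \<le> (diameter K * (\<Sum>k\<in>V. sqrt (?l k) * (sqrt (?l k) * \<bar>(k - x) \<bullet> G x\<bar>)))\<^sup>2"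
      by (rule power_mono) simp
    also have "\<dots> \<le> (diameter K)\<^sup>2 * ((\<Sum>k\<in>V. (sqrt (?l k))\<^sup>2) * (\<Sum>k\<in>V. (sqrt (?l k) * \<bar>(k - x) \<bullet> G x\<bar>)\<^sup>2))"
      unfolding power_mult_distrib[of "diameter K"] by (intro mult_left_mono Cauchy_Schwarz_ineq_sum) simp
    also have "(\<Sum>k\<in>V. (sqrt (?l k))\<^sup>2) = 1" using l0 l1 by simp
    also have "(\<Sum>k\<in>V. (sqrt (?l k) * \<bar>(k - x) \<bullet> G x\<bar>)\<^sup>2) = Q x"
      unfolding Q_def using l0 by (intro sum.cong) (auto simp: power_mult_distrib)
    finally show ?thesis using 1 by simp
  qed
  define E where "E = (LINT x:K|lebesgue. Q x)"
  have "(LINT x:K|lebesgue. \<beta> x \<bullet> G x) = E"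
    unfolding E_def using pt by (intro set_lebesgue_integral_cong) (auto simp: fmeasurableD[OF lmeasurable_compact[OF cc(1)]])
  \<comment> \<open>The test identity yields the integral of \<open>z x * p K x\<close>; integration
    by parts with \<open>p K\<close> itself as test function turns it into
    \<open>- E\<close>.\<close>
  then have t2: "(LINT x:interior K|lebesgue. \<delta> x \<bullet> \<beta> x) = - E"
    using test parts[OF G(1)] by simp
  have d0: "d K \<ge> 0" unfolding d_def set_lebesgue_integral_def by (rule integral_nonneg_AE) auto
  have E0: "E \<ge> 0" unfolding E_def set_lebesgue_integral_def
    by (rule integral_nonneg_AE) (use Q0 in \<open>auto simp: indicator_def\<close>)
  have b2: "L2 K \<beta>" using L2_compact_continuous[OF cc(1) c\<beta>(1)] .
  then have bi: "L2 (interior K) \<beta>" by (rule L2_subset) (auto simp: interior_subset)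
  have "E\<^sup>2 = (LINT x:interior K|lebesgue. \<delta> x \<bullet> \<beta> x)\<^sup>2" by (simp add: t2)
  also have "\<dots> \<le> d K * (LINT x:interior K|lebesgue. (norm (\<beta> x))\<^sup>2)"
    unfolding d_def using L2_Cauchy_Schwarz[OF L2_subset[OF \<delta> int\<Omega>[OF K]] bi] by simp
  also have "(LINT x:interior K|lebesgue. (norm (\<beta> x))\<^sup>2) = (LINT x:K|lebesgue. (norm (\<beta> x))\<^sup>2)"
    by (rule set_integral_interior(2)[OF cc]) (use b2 in \<open>simp add: L2_def\<close>)
  also have "d K * \<dots> \<le> d K * (LINT x:K|lebesgue. (diameter K)\<^sup>2 * Q x)"
    using pt b2 by (intro mult_left_mono d0 set_integral_mono set_integrable_compact_continuous(2) cc continuous_intros cQ c\<beta>)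
      auto
  \<comment> \<open>\<open>E\<close> occurs on both sides because the norm of \<open>\<beta>\<close>
    is controlled by its own pairing with \<open>G\<close>; one factor cancels.\<close>
  finally have "E * E \<le> ((diameter K)\<^sup>2 * d K) * E"
    by (simp add: E_def power2_eq_square mult_ac)
  then have "E \<le> (diameter K)\<^sup>2 * d K"
    using E0 d0 by (cases "E = 0") (auto simp: mult_le_cancel_right)
  moreover have "(LINT x:K|lebesgue. (p K x - m K)\<^sup>2) \<le> 24 * 2 ^ DIM(real^'n) * E"
    unfolding m_def E_def Q_def
    using simplex_weighted_poincare[OF V(1,4) mp G(1), of c q] l(3,4,5) V(4) by blast
  ultimately show ?thesis by simp (smt (verit) mult_left_mono zero_le_power)
qed

subsection \<open>Nodal interpolation of element means\<close>

text \<open>Compare the length of the interval between \<open>f 0\<close> and \<open>f 1\<close> with the lengths of the images of the pieces.\<close>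

lemma piecewise_lipschitz_endpoint_bound:
  fixes f :: "real \<Rightarrow> real" and J :: "'i \<Rightarrow> real set"
  assumes I: "finite I" and cont: "continuous_on {0..1} f" and cover: "{0..1} \<subseteq> (\<Union>i\<in>I. J i)"
    and J: "\<And>i. i \<in> I \<Longrightarrow> closed (J i)" "\<And>i. i \<in> I \<Longrightarrow> convex (J i)"
    and L: "\<And>i. i \<in> I \<Longrightarrow> L i \<ge> 0"
      "\<And>i s t. i \<in> I \<Longrightarrow> s \<in> J i \<inter> {0..1} \<Longrightarrow> t \<in> J i \<inter> {0..1} \<Longrightarrow> \<bar>f s - f t\<bar> \<le> L i * \<bar>s - t\<bar>"
  shows "\<bar>f 0 - f 1\<bar> \<le> (\<Sum>i\<in>I. L i * measure lborel (J i \<inter> {0..1}))"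
proof -
  have piece: "f ` (J i \<inter> {0..1}) \<in> fmeasurable lborel \<and>
      measure lborel (f ` (J i \<inter> {0..1})) \<le> L i * measure lborel (J i \<inter> {0..1})" if i: "i \<in> I" for i
  proof (cases "J i \<inter> {0..1} = {}")
    case True
    then show ?thesis by simp
  next
    case False
    have c: "compact (J i \<inter> {0..1})" "convex (J i \<inter> {0..1})"
      using J[OF i] by (auto intro: closed_Int_compact convex_Int convex_real_interval)
    then have "connected (J i \<inter> {0..1})" using convex_connected by blast
    with c(1) obtain a b where ab1: "J i \<inter> {0..1} = {a..b}"
      using connected_compact_interval_1[of "J i \<inter> {0..1}"] by blast
    with False have ab: "J i \<inter> {0..1} = {a..b}" "a \<le> b" by auto
    have cf: "continuous_on {a..b} f" using cont ab(1) continuous_on_subset by blast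
    obtain c d where cd: "f ` {a..b} = {c..d}" "c \<le> d"
      using continuous_image_closed_interval[OF ab(2) cf] by blast
    then obtain s t where st: "s \<in> {a..b}" "t \<in> {a..b}" "f s = d" "f t = c"
      by (metis atLeastAtMost_iff imageE order_refl)
    have "d - c \<le> L i * \<bar>s - t\<bar>" using L(2)[OF i, of s t] st ab(1) by auto
    also have "\<dots> \<le> L i * (b - a)" using st L(1)[OF i] by (intro mult_left_mono) auto
    finally show ?thesis using ab cd by (simp add: fmeasurable_compact)
  qed
  define lo hi where "lo = min (f 0) (f 1)" and "hi = max (f 0) (f 1)"
  have "{lo..hi} \<subseteq> f ` {0..1}"
  proof -
    have "connected (f ` {0..1})" by (intro connected_continuous_image cont connected_Icc)
    moreover have "lo \<in> f ` {0..1}" "hi \<in> f ` {0..1}" by (auto simp: lo_def hi_def min_def max_def)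
    ultimately show ?thesis using connected_contains_Icc by blast
  qed
  also have "\<dots> \<subseteq> (\<Union>i\<in>I. f ` (J i \<inter> {0..1}))" using cover by blast
  finally have sub: "{lo..hi} \<subseteq> (\<Union>i\<in>I. f ` (J i \<inter> {0..1}))" .
  have "\<bar>f 0 - f 1\<bar> = measure lborel {lo..hi}" by (auto simp: lo_def hi_def min_def max_def)
  also have "\<dots> \<le> measure lborel (\<Union>i\<in>I. f ` (J i \<inter> {0..1}))"
    using sub piece I by (intro measure_mono_fmeasurable fmeasurable.finite_UN) auto
  also have "\<dots> \<le> (\<Sum>i\<in>I. measure lborel (f ` (J i \<inter> {0..1})))"
    using I by (rule measure_UNION_le) (use piece fmeasurableD in blast)
  also have "\<dots> \<le> (\<Sum>i\<in>I. L i * measure lborel (J i \<inter> {0..1}))"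
    using piece by (intro sum_mono) auto
  finally show ?thesis .
qed

lemma affine_eq_on_convex_hull:
  fixes q q' :: "'a::euclidean_space"
  assumes "\<And>v. v \<in> S \<Longrightarrow> c + q \<bullet> v = c' + q' \<bullet> v" "x \<in> convex hull S"
  shows "c + q \<bullet> x = c' + q' \<bullet> x"
proof -
  have sub: "S \<subseteq> {y. (q - q') \<bullet> y = c' - c}"
    using assms(1) by (fastforce simp: inner_diff_left)
  have "convex hull S \<subseteq> {y. (q - q') \<bullet> y = c' - c}"
    using sub by (rule hull_minimal) (rule convex_hyperplane)
  then show ?thesis using assms(2) by (auto simp: inner_diff_left)
qed

text \<open>The extreme points of a face are those of the simplex that lie in it, so the common face
  passes vertices from one element to the other.\<close>

lemma mesh_vertices_agree:
  fixes K :: "'a::euclidean_space set"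
  assumes M: "simplicial_mesh M T" and K: "K \<in> M" "K' \<in> M" and v: "v extreme_point_of K" "v \<in> K'"
  shows "v extreme_point_of K'"
proof -
  have f: "K \<inter> K' face_of K" "K \<inter> K' face_of K'"
    using simplicial_meshD(4)[OF M K] simplicial_meshD(4)[OF M K(2,1)] by (auto simp: Int_commute)
  have "v \<in> K" using v(1) by (simp add: extreme_point_of_def)
  then have "v extreme_point_of (K \<inter> K')" using extreme_point_of_face[OF f(1)] v by simp
  then show ?thesis using extreme_point_of_face[OF f(2)] by simp
qed

text \<open>Two elements meet in the hull of their common vertices, where both affine functions take
  the same values. So \<open>W\<close> does not depend on the element chosen for a point.\<close>

lemma mesh_nodal_interpolant:
  fixes M :: "'a::euclidean_space set set" and val :: "'a \<Rightarrow> real"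
  assumes M: "simplicial_mesh M T"
  obtains W c q where "\<And>K x. K \<in> M \<Longrightarrow> x \<in> K \<Longrightarrow> W x = c K + q K \<bullet> x"
    "\<And>K v. K \<in> M \<Longrightarrow> v extreme_point_of K \<Longrightarrow> c K + q K \<bullet> v = val v"
proof -
  define V where "V K = {v. v extreme_point_of K}" for K :: "'a set"
  have "\<exists>cq. \<forall>v\<in>V K. fst cq + snd cq \<bullet> v = val v" if "K \<in> M" for K
    using full_simplex_vertices(1)[OF simplicial_meshD(2)[OF M that]] unfolding V_def[symmetric]
    by (rule affine_function_extension[of "V K" val]) fastforce
  then have "\<exists>cq. \<forall>K\<in>M. \<forall>v\<in>V K. fst (cq K) + snd (cq K) \<bullet> v = val v"
    by (intro bchoice) blast
  then obtain cq where cq: "\<forall>K\<in>M. \<forall>v\<in>V K. fst (cq K) + snd (cq K) \<bullet> v = val v" ..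
  define c q where "c K = fst (cq K)" and "q K = snd (cq K)" for K
  have vert: "c K + q K \<bullet> v = val v" if "K \<in> M" "v extreme_point_of K" for K v
    using cq that by (simp add: c_def q_def V_def)
  have agree: "c K + q K \<bullet> x = c K' + q K' \<bullet> x" if K: "K \<in> M" "K' \<in> M" and x: "x \<in> K" "x \<in> K'" for K K' x
  proof (rule affine_eq_on_convex_hull)
    have f: "K \<inter> K' face_of K" "K \<inter> K' face_of K'"
      using simplicial_meshD(4)[OF M K] simplicial_meshD(4)[OF M K(2,1)] by (auto simp: Int_commute)
    have "compact (K \<inter> K')" "convex (K \<inter> K')"
      using full_simplex_interior(3,4)[OF simplicial_meshD(2)[OF M]] K by (auto intro: convex_Int compact_Int)
    then have "K \<inter> K' = convex hull {v. v extreme_point_of (K \<inter> K')}" by (rule Krein_Milman_Minkowski)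
    then show "x \<in> convex hull {v. v extreme_point_of (K \<inter> K')}" using x by simp
    fix v assume "v \<in> {v. v extreme_point_of (K \<inter> K')}"
    then have "v extreme_point_of K" "v extreme_point_of K'"
      using extreme_point_of_face[OF f(1)] extreme_point_of_face[OF f(2)] by auto
    then show "c K + q K \<bullet> v = c K' + q K' \<bullet> v" using vert K by simp
  qed
  define W where "W x = (let K = SOME K. K \<in> M \<and> x \<in> K in c K + q K \<bullet> x)" for x
  have "W x = c K + q K \<bullet> x" if "K \<in> M" "x \<in> K" for K x
  proof -
    have "(SOME K. K \<in> M \<and> x \<in> K) \<in> M \<and> x \<in> (SOME K. K \<in> M \<and> x \<in> K)"
      by (rule someI[of "\<lambda>K. K \<in> M \<and> x \<in> K" K]) (use that in auto)
    then show ?thesis unfolding W_def Let_def using agree that by blast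
  qed
  then show ?thesis using vert by (rule that)
qed

text \<open>The interpolant is only piecewise smooth, and a segment may run inside a common face,
  where no gradient is defined. Its variation is therefore bounded through the parts of the segment
  in each element, which may overlap, followed by Cauchy-Schwarz in the segment parameter.\<close>

lemma mesh_affine_poincare:
  fixes M :: "'a::euclidean_space set set" and W :: "'a \<Rightarrow> real"
  assumes M: "simplicial_mesh M T" and T: "compact T" "convex T" "measure lebesgue T > 0"
    and W: "\<And>K x. K \<in> M \<Longrightarrow> x \<in> K \<Longrightarrow> W x = c K + q K \<bullet> x"
  obtains y where "y \<in> T" "set_integrable lebesgue T (\<lambda>x. (W x - W y)\<^sup>2)"
    "(LINT x:T|lebesgue. (W x - W y)\<^sup>2)
      \<le> 2 ^ DIM('a) * ((diameter T)\<^sup>2 * (\<Sum>K\<in>M. (norm (q K))\<^sup>2 * measure lebesgue K))"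
proof -
  have fin: "finite M" and UM: "\<Union>M = T" using simplicial_meshD(1,3)[OF M] by auto
  have cc: "compact K" "convex K" "closed K" if "K \<in> M" for K
    using full_simplex_interior(3,4)[OF simplicial_meshD(2)[OF M that]] compact_imp_closed by auto
  define D where "D = diameter T"
  have D0: "D \<ge> 0" using T(1) by (simp add: D_def diameter_ge_0 compact_imp_bounded)
  \<comment> \<open>All elements containing \<open>x\<close> contribute, which covers segments in
    common faces; the overcounting takes place on a null set.\<close>
  define G where "G x = (\<Sum>K\<in>M. norm (q K) * indicat_real K x)" for x
  define Q where "Q x = (D * G x)\<^sup>2" for x
  have G0: "G x \<ge> 0" for x unfolding G_def by (intro sum_nonneg) auto
  have [measurable]: "K \<in> sets borel" if "K \<in> M" for K using cc(1)[OF that] by (rule borel_compact)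
  have Gm[measurable]: "G \<in> borel_measurable borel"
    unfolding G_def by (intro borel_measurable_sum borel_measurable_times) auto
  then have Qm: "Q \<in> borel_measurable borel" unfolding Q_def by measurable
  have contW: "continuous_on T W"
  proof -
    have "continuous_on (\<Union>K\<in>M. id K) W"
    proof (rule continuous_on_closed_Union[OF fin])
      fix K assume K: "K \<in> M"
      show "closed (id K)" using cc K by simp
      have "continuous_on K (\<lambda>x. c K + q K \<bullet> x)" by (intro continuous_intros)
      then show "continuous_on (id K) W" using W[OF K] by (simp cong: continuous_on_cong)
    qed
    then show ?thesis using UM by simp
  qed
  \<comment> \<open>\<open>W\<close> is unspecified off \<open>T\<close>; the cutoff makes it Borel
    measurable.\<close>
  define W' where "W' x = (if x \<in> T then W x else 0)" for x
  have W'm: "W' \<in> borel_measurable borel"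
    unfolding W'_def using borel_measurable_continuous_on_if[OF borel_compact[OF T(1)] contW, of "\<lambda>_. 0"] by simp
  have bound: "ennreal ((W' x - W' y)\<^sup>2)
      \<le> (\<integral>\<^sup>+s. indicator {0..1} s * ennreal (Q ((1 - id s) *\<^sub>R x + id s *\<^sub>R y)) \<partial>lborel)"
    if x: "x \<in> T" and y: "y \<in> T" for x y
  proof -
    define Z where "Z s = (1 - s) *\<^sub>R x + s *\<^sub>R y" for s :: real
    have cZ: "continuous_on S Z" for S unfolding Z_def by (intro continuous_intros)
    have Zm[measurable]: "Z \<in> borel_measurable borel" using cZ by (rule borel_measurable_continuous_onI)
    have ZT: "Z s \<in> T" if "s \<in> {0..1}" for s
      using convexD_alt[OF T(2) x y, of s] that by (simp add: Z_def)
    define J where "J K = Z -` K" for K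
    have Jm: "J K \<in> sets borel" if "K \<in> M" for K
      unfolding J_def using measurable_sets_borel[OF Zm] that by auto
    have Zd: "Z s - Z t = (s - t) *\<^sub>R (y - x)" for s t by (simp add: Z_def algebra_simps)
    have ndx: "norm (y - x) \<le> D"
      using diameter_bounded_bound[OF compact_imp_bounded[OF T(1)] y x] by (simp add: D_def dist_norm)
    have "\<bar>W (Z 0) - W (Z 1)\<bar> \<le> (\<Sum>K\<in>M. (norm (q K) * D) * measure lborel (J K \<inter> {0..1}))"
    proof (rule piecewise_lipschitz_endpoint_bound[OF fin])
      show "continuous_on {0..1} (\<lambda>s. W (Z s))"
        by (rule continuous_on_compose2[OF contW cZ]) (use ZT in auto)
      show "{0..1} \<subseteq> (\<Union>K\<in>M. J K)" using ZT UM by (fastforce simp: J_def)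
      fix K assume K: "K \<in> M"
      show "closed (J K)" unfolding J_def using cc(3)[OF K] cZ[of UNIV] by (simp add: closed_vimage)
      show "convex (J K)" unfolding convex_alt
      proof (intro ballI allI impI)
        fix s t u assume st: "s \<in> J K" "t \<in> J K" and u: "0 \<le> u \<and> u \<le> (1::real)"
        have "Z ((1 - u) *\<^sub>R s + u *\<^sub>R t) = (1 - u) *\<^sub>R Z s + u *\<^sub>R Z t"
          by (simp add: Z_def algebra_simps)
        then show "(1 - u) *\<^sub>R s + u *\<^sub>R t \<in> J K"
          using convexD_alt[OF cc(2)[OF K], of "Z s" "Z t" u] st u by (simp add: J_def)
      qed
      show "0 \<le> norm (q K) * D" using D0 by simp
      fix s t assume st: "s \<in> J K \<inter> {0..1}" "t \<in> J K \<inter> {0..1}"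
      have "W (Z s) - W (Z t) = q K \<bullet> (Z s - Z t)"
        using st W[OF K] by (simp add: J_def inner_diff_right)
      then have "\<bar>W (Z s) - W (Z t)\<bar> \<le> norm (q K) * norm (Z s - Z t)"
        using Cauchy_Schwarz_ineq2 by simp
      also have "\<dots> \<le> norm (q K) * (\<bar>s - t\<bar> * D)"
        unfolding Zd using ndx by (auto intro!: mult_left_mono)
      finally show "\<bar>W (Z s) - W (Z t)\<bar> \<le> norm (q K) * D * \<bar>s - t\<bar>" by (simp add: mult_ac)
    qed
    then have "ennreal \<bar>W x - W y\<bar> \<le> ennreal (\<Sum>K\<in>M. (norm (q K) * D) * measure lborel (J K \<inter> {0..1}))"
      by (intro ennreal_leI) (simp add: Z_def)
    also have "\<dots> = (\<Sum>K\<in>M. ennreal (norm (q K) * D) * emeasure lborel (J K \<inter> {0..1}))"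
    proof -
      have "emeasure lborel (J K \<inter> {0..1}) = ennreal (measure lborel (J K \<inter> {0..1}))" for K
        by (rule emeasure_eq_ennreal_measure)
           (metis bounded_Int bounded_closed_interval emeasure_bounded_finite less_top top.not_eq_extremum infinity_ennreal_def)
      then show ?thesis using D0
        by (subst sum_ennreal[symmetric]) (auto simp: ennreal_mult intro!: sum.cong)
    qed
    also have "\<dots> = (\<Sum>K\<in>M. \<integral>\<^sup>+s. ennreal (norm (q K) * D) * indicator (J K \<inter> {0..1}) s \<partial>lborel)"
      using Jm by (intro sum.cong refl nn_integral_cmult_indicator[symmetric]) auto
    also have "\<dots> = (\<integral>\<^sup>+s. (\<Sum>K\<in>M. ennreal (norm (q K) * D) * indicator (J K \<inter> {0..1}) s) \<partial>lborel)"
      using Jm by (intro nn_integral_sum[symmetric]) auto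
    \<comment> \<open>The indicator is doubled so that one copy becomes the factor of norm one in
      Cauchy-Schwarz.\<close>
    also have "\<dots> = (\<integral>\<^sup>+s. indicator {0..1} s * (indicator {0..1} s * ennreal (D * G (Z s))) \<partial>lborel)"
    proof (rule nn_integral_cong)
      fix s :: real
      have "(\<Sum>K\<in>M. ennreal (norm (q K) * D) * indicator (J K \<inter> {0..1}) s)
        = (\<Sum>K\<in>M. ennreal (indicator {0..1} s * (D * (norm (q K) * indicat_real K (Z s)))))"
        by (intro sum.cong refl) (auto simp: indicator_def J_def mult.commute)
      also have "\<dots> = ennreal (\<Sum>K\<in>M. indicator {0..1} s * (D * (norm (q K) * indicat_real K (Z s))))"
        using D0 by (intro sum_ennreal) auto
      also have "\<dots> = ennreal (indicator {0..1} s * (D * G (Z s)))"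
        by (simp add: G_def sum_distrib_left)
      also have "\<dots> = indicator {0..1} s * (indicator {0..1} s * ennreal (D * G (Z s)))"
        by (auto simp: indicator_def)
      finally show "(\<Sum>K\<in>M. ennreal (norm (q K) * D) * indicator (J K \<inter> {0..1}) s)
        = indicator {0..1} s * (indicator {0..1} s * ennreal (D * G (Z s)))" .
    qed
    finally have "(ennreal \<bar>W x - W y\<bar>)\<^sup>2 \<le> (\<integral>\<^sup>+s. indicator {0..1} s * (indicator {0..1} s * ennreal (D * G (Z s))) \<partial>lborel)\<^sup>2"
      by (rule power_mono) simp
    also have "\<dots> \<le> (\<integral>\<^sup>+s. (indicator {0..1::real} s)\<^sup>2 \<partial>lborel) * (\<integral>\<^sup>+s. (indicator {0..1} s * ennreal (D * G (Z s)))\<^sup>2 \<partial>lborel)"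
      by (rule Cauchy_Schwarz_nn_integral) measurable
    also have "(\<integral>\<^sup>+s. (indicator {0..1::real} s)\<^sup>2 \<partial>lborel) = (\<integral>\<^sup>+s. indicator {0..1::real} s \<partial>lborel)"
      by (intro nn_integral_cong) (auto simp: indicator_def)
    also have "\<dots> = 1" by simp
    also have "(\<integral>\<^sup>+s. (indicator {0..1} s * ennreal (D * G (Z s)))\<^sup>2 \<partial>lborel) = (\<integral>\<^sup>+s. indicator {0..1} s * ennreal (Q (Z s)) \<partial>lborel)"
      using D0 G0 by (intro nn_integral_cong) (auto simp: indicator_def Q_def ennreal_power)
    finally show ?thesis using x y by (simp add: ennreal_power W'_def Z_def)
  qed
  have Gint: "G x = norm (q K)" if "K \<in> M" "x \<in> interior K" for K x
  proof -
    have "indicat_real L x = (if L = K then 1 else 0)" if "L \<in> M" for L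
      using mesh_interior_disjoint[OF M \<open>K \<in> M\<close> that] \<open>x \<in> interior K\<close> interior_subset by (auto simp: indicator_def)
    then show ?thesis unfolding G_def using fin that(1) by (simp add: if_distrib[of "\<lambda>c. _ * c"] cong: if_cong)
  qed
  have constint: "set_integrable lebesgue (interior K) (\<lambda>x. (D * norm (q K))\<^sup>2)"
    "(LINT x:interior K|lebesgue. (D * norm (q K))\<^sup>2) = D\<^sup>2 * ((norm (q K))\<^sup>2 * measure lebesgue K)" if "K \<in> M" for K
  proof -
    have i: "set_integrable lebesgue K (\<lambda>x. (D * norm (q K))\<^sup>2)"
      by (rule set_integrable_compact_continuous(2)[OF cc(1)[OF that]]) (intro continuous_intros)
    show "set_integrable lebesgue (interior K) (\<lambda>x. (D * norm (q K))\<^sup>2)"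
      using set_integral_interior(1)[OF cc(1,2)[OF that] i] .
    show "(LINT x:interior K|lebesgue. (D * norm (q K))\<^sup>2) = D\<^sup>2 * ((norm (q K))\<^sup>2 * measure lebesgue K)"
      unfolding set_integral_interior(2)[OF cc(1,2)[OF that] i]
      unfolding set_lebesgue_integral_const
      by (simp add: power_mult_distrib mult_ac)
  qed
  have intT: "interior K \<subseteq> T" if "K \<in> M" for K using UM that interior_subset by blast
  have Qi: "set_integrable lebesgue T Q" "(LINT x:T|lebesgue. Q x) = (\<Sum>K\<in>M. D\<^sup>2 * ((norm (q K))\<^sup>2 * measure lebesgue K))"
  proof -
    have e: "Q x = (D * norm (q K))\<^sup>2" if "K \<in> M" "x \<in> interior K" for K x using Gint[OF that] by (simp add: Q_def)
    show "set_integrable lebesgue T Q"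
      by (rule mesh_piecewise_integral(1)[OF M order_refl intT order_refl constint(1)]) (auto simp: e)
    have "(LINT x:T|lebesgue. Q x) = (\<Sum>K\<in>M. LINT x:interior K|lebesgue. (D * norm (q K))\<^sup>2)"
      by (rule mesh_piecewise_integral(2)[OF M order_refl intT order_refl constint(1)]) (auto simp: e)
    then show "(LINT x:T|lebesgue. Q x) = (\<Sum>K\<in>M. D\<^sup>2 * ((norm (q K))\<^sup>2 * measure lebesgue K))"
      using constint(2) by simp
  qed
  have Q0: "Q x \<ge> 0" for x by (simp add: Q_def)
  have idm: "(id :: real \<Rightarrow> real) \<in> borel_measurable borel" by simp
  have id01: "id s \<in> {0..1::real}" if "s \<in> {0..1}" for s using that by simp
  obtain y where y: "y \<in> T" "set_integrable lebesgue T (\<lambda>x. (W' x - W' y)\<^sup>2)"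
    "(LINT x:T|lebesgue. (W' x - W' y)\<^sup>2) \<le> 2 ^ DIM('a) * (LINT x:T|lebesgue. Q x)"
    using convex_poincare[OF T W'm Qm idm id01 Q0 Qi(1) bound] .
  have eq: "(\<lambda>x. indicat_real T x *\<^sub>R (W' x - W' y)\<^sup>2) = (\<lambda>x. indicat_real T x *\<^sub>R (W x - W y)\<^sup>2)"
    using y(1) by (auto simp: indicator_def W'_def fun_eq_iff)
  have LQ: "(LINT x:T|lebesgue. Q x) = (diameter T)\<^sup>2 * (\<Sum>K\<in>M. (norm (q K))\<^sup>2 * measure lebesgue K)"
    unfolding Qi(2) by (simp add: sum_distrib_left D_def)
  show ?thesis
  proof (rule that[OF y(1)])
    show "set_integrable lebesgue T (\<lambda>x. (W x - W y)\<^sup>2)"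
      using y(2) unfolding set_integrable_def eq .
    show "(LINT x:T|lebesgue. (W x - W y)\<^sup>2)
        \<le> 2 ^ DIM('a) * ((diameter T)\<^sup>2 * (\<Sum>K\<in>M. (norm (q K))\<^sup>2 * measure lebesgue K))"
      using y(3) unfolding LQ unfolding set_lebesgue_integral_def eq .
  qed
qed

section \<open>Oscillation of element means on vertex stars\<close>

lemma relpow_invariant_bound:
  fixes f :: "'a \<Rightarrow> real"
  assumes "\<And>x y. (x, y) \<in> R \<Longrightarrow> \<bar>f x - f y\<bar> \<le> B" "(x, y) \<in> R ^^ j"
  shows "\<bar>f x - f y\<bar> \<le> real j * B"
  using assms(2)
proof (induction j arbitrary: y)
  case (Suc j)
  then obtain z where "(x, z) \<in> R ^^ j" "(z, y) \<in> R" by auto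
  then have "\<bar>f x - f z\<bar> \<le> real j * B" "\<bar>f z - f y\<bar> \<le> B" using Suc assms(1) by auto
  then show ?case by (simp add: algebra_simps)
qed simp

text \<open>In a finite relation a path can be taken with at most as many steps as there are pairs.
  The star has at most \<open>nat \<lceil>\<kappa> ^ CARD('n)\<rceil>\<close> elements, hence the
  square.\<close>

lemma facet_adjacent_relpow:
  fixes M :: "(real^'n) set set"
  assumes M: "simplicial_mesh M T" and T: "convex T" and sr: "shape_regular \<kappa> M" and \<kappa>: "\<kappa> \<ge> 2"
    and K: "K \<in> M" "K' \<in> M" "v \<in> K" "v \<in> K'"
  obtains j where "j \<le> (nat \<lceil>\<kappa> ^ CARD('n)\<rceil>)\<^sup>2" "(K, K') \<in> facet_adjacent M v ^^ j"
proof -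
  let ?P = "{K \<in> M. v \<in> K}"
  have fin: "finite ?P" using simplicial_meshD(1)[OF M] by simp
  have sub: "facet_adjacent M v \<subseteq> ?P \<times> ?P" by (auto simp: facet_adjacent_def)
  then have finR: "finite (facet_adjacent M v)" using fin finite_subset by blast
  have "real (card ?P) \<le> \<kappa> ^ CARD('n)" by (rule mesh_star_card[OF M sr \<kappa>])
  then have "card ?P \<le> nat \<lceil>\<kappa> ^ CARD('n)\<rceil>" by linarith
  moreover have "card (facet_adjacent M v) \<le> card ?P * card ?P"
    using card_mono[OF _ sub] fin by (simp add: card_cartesian_product)
  ultimately have "card (facet_adjacent M v) \<le> (nat \<lceil>\<kappa> ^ CARD('n)\<rceil>)\<^sup>2"
    unfolding power2_eq_square using mult_le_mono le_trans by blast
  moreover have "(K, K') \<in> (\<Union>j\<in>{j. j \<le> card (facet_adjacent M v)}. facet_adjacent M v ^^ j)"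
    using mesh_star_facet_connected[OF M T K] rtrancl_finite_eq_relpow[OF finR] by simp
  then obtain j where "j \<le> card (facet_adjacent M v)" "(K, K') \<in> facet_adjacent M v ^^ j" by auto
  ultimately show ?thesis using that[of j] by linarith
qed

lemma star_diameter_comparable:
  fixes M :: "(real^'n) set set"
  assumes n: "CARD('n) \<ge> 2" and M: "simplicial_mesh M T" and T: "convex T"
    and sr: "shape_regular \<kappa> M" and \<kappa>: "\<kappa> \<ge> 2"
    and K: "K \<in> M" "K' \<in> M" "v \<in> K" "v \<in> K'"
  shows "diameter K \<le> \<kappa> ^ ((nat \<lceil>\<kappa> ^ CARD('n)\<rceil>)\<^sup>2) * diameter K'"
proof -
  obtain j where j: "j \<le> (nat \<lceil>\<kappa> ^ CARD('n)\<rceil>)\<^sup>2" "(K, K') \<in> facet_adjacent M v ^^ j"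
    using facet_adjacent_relpow[OF M T sr \<kappa> K] .
  have "diameter K \<le> \<kappa> ^ j * diameter K'"
    using j(2)
  proof (induction j arbitrary: K')
    case (Suc j)
    then obtain L where L: "(K, L) \<in> facet_adjacent M v ^^ j" "(L, K') \<in> facet_adjacent M v" by auto
    have "diameter K \<le> \<kappa> ^ j * diameter L" using Suc.IH[OF L(1)] .
    also have "\<dots> \<le> \<kappa> ^ j * (\<kappa> * diameter K')"
      using facet_adjacent_diameter_le[OF n M sr L(2)] \<kappa> by (intro mult_left_mono) auto
    finally show ?case by (simp add: mult_ac)
  qed simp
  also have "\<dots> \<le> \<kappa> ^ ((nat \<lceil>\<kappa> ^ CARD('n)\<rceil>)\<^sup>2) * diameter K'"
    using j(1) \<kappa> shape_regular_volume(1)[OF _ sr K(2)] simplicial_meshD(2)[OF M K(2)]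
    by (intro mult_right_mono power_increasing) auto
  finally show ?thesis .
qed

text \<open>By shape regularity the quotient behaves like the diameter to the power
  \<open>2 - CARD('n)\<close>, which is not positive, so a lower bound for the diameter of
  \<open>K'\<close> suffices. The factor \<open>\<kappa> ^ CARD('n)\<close> comes from the inscribed
  ball of \<open>K'\<close>.\<close>

lemma star_volume_comparable:
  fixes M :: "(real^'n) set set"
  assumes n: "CARD('n) \<ge> 2" and M: "simplicial_mesh M T" and T: "convex T"
    and sr: "shape_regular \<kappa> M" and \<kappa>: "\<kappa> \<ge> 2"
    and K: "K \<in> M" "K' \<in> M" "v \<in> K" "v \<in> K'"
  defines "A \<equiv> \<kappa> ^ ((nat \<lceil>\<kappa> ^ CARD('n)\<rceil>)\<^sup>2)"
  shows "(diameter K')\<^sup>2 / measure lebesgue K'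
    \<le> (\<kappa> ^ CARD('n) * A ^ (CARD('n) - 2)) * ((diameter K)\<^sup>2 / measure lebesgue K)"
proof -
  let ?n = "CARD('n)"
  define w where "w = measure lborel (ball (0::real^'n) 1)"
  have w: "w > 0" unfolding w_def by (rule content_ball_pos) simp
  have A1: "A \<ge> 1" unfolding A_def using \<kappa> by (intro one_le_power) auto
  have sK: "int CARD('n) simplex K" "int CARD('n) simplex K'" using simplicial_meshD(2)[OF M] K by auto
  note v = shape_regular_volume[OF sK(1) sr K(1), folded w_def]
    and v' = shape_regular_volume[OF sK(2) sr K(2), folded w_def]
  have mp: "measure lebesgue K > 0" using full_simplex_interior(5) simplicial_meshD(2)[OF M K(1)] by blast
  have le: "diameter K \<le> A * diameter K'" unfolding A_def by (rule star_diameter_comparable[OF n M T sr \<kappa> K])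
  have sp: "h ^ ?n = h\<^sup>2 * h ^ (?n - 2)" for h :: real
    using n by (metis le_add_diff_inverse power_add)
  have "(diameter K')\<^sup>2 / measure lebesgue K' \<le> (diameter K')\<^sup>2 / (w * (diameter K' / \<kappa>) ^ ?n)"
    using v'(3)
  proof (rule divide_left_mono)
    have pos: "0 < w * (diameter K' / \<kappa>) ^ ?n" using v'(1) w \<kappa> by simp
    show "0 < measure lebesgue K' * (w * (diameter K' / \<kappa>) ^ ?n)"
      by (rule mult_pos_pos[OF less_le_trans[OF pos v'(3)] pos])
  qed simp
  also have "\<dots> = \<kappa> ^ ?n / (w * diameter K' ^ (?n - 2))"
    using v'(1) \<kappa> w by (simp add: power_divide sp[of "diameter K'"])
  also have "\<dots> \<le> \<kappa> ^ ?n * (A ^ (?n - 2) / (w * diameter K ^ (?n - 2)))"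
  proof -
    have "diameter K ^ (?n - 2) \<le> A ^ (?n - 2) * diameter K' ^ (?n - 2)"
      using power_mono[OF le, of "?n - 2"] v(1) by (simp add: power_mult_distrib)
    then have "1 / (w * diameter K' ^ (?n - 2)) \<le> A ^ (?n - 2) / (w * diameter K ^ (?n - 2))"
      using v(1) v'(1) w by (simp add: field_simps)
    then have "\<kappa> ^ ?n * (1 / (w * diameter K' ^ (?n - 2))) \<le> \<kappa> ^ ?n * (A ^ (?n - 2) / (w * diameter K ^ (?n - 2)))"
      using \<kappa> by (intro mult_left_mono) auto
    then show ?thesis by simp
  qed
  also have "\<dots> = (\<kappa> ^ ?n * A ^ (?n - 2)) * ((diameter K)\<^sup>2 / (w * diameter K ^ ?n))"
    using v(1) by (simp add: sp[of "diameter K"])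
  also have "\<dots> \<le> (\<kappa> ^ ?n * A ^ (?n - 2)) * ((diameter K)\<^sup>2 / measure lebesgue K)"
  proof (intro mult_left_mono divide_left_mono)
    show "measure lebesgue K \<le> w * diameter K ^ ?n" by (rule v(4))
    show "0 < w * diameter K ^ ?n * measure lebesgue K" using w mp v(1) by simp
  qed (use \<kappa> A1 in auto)
  finally show ?thesis .
qed

text \<open>For paths of at most \<open>N\<close> steps this is \<open>2 * N\<^sup>2\<close> times
  the factor of \<open>star_volume_comparable\<close>: squaring a sum of \<open>N\<close> jumps
  gives the square, and the 2 accounts for the two elements at each facet.\<close>

definition star_const :: "real \<Rightarrow> nat \<Rightarrow> real" where
  "star_const \<kappa> n = 2 * real ((nat \<lceil>\<kappa> ^ n\<rceil>)\<^sup>2) ^ 2 * (\<kappa> ^ n * (\<kappa> ^ ((nat \<lceil>\<kappa> ^ n\<rceil>)\<^sup>2)) ^ (n - 2))"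

text \<open>The difference telescopes along a path of facet neighbours inside the star. All jumps
  share one bound \<open>B\<close>, because the weights of all elements of the star are compared
  with that of \<open>K\<close>.\<close>

lemma star_mean_oscillation:
  fixes M :: "(real^'n) set set" and m d :: "(real^'n) set \<Rightarrow> real"
  assumes n: "CARD('n) \<ge> 2" and M: "simplicial_mesh M T" and T: "convex T"
    and sr: "shape_regular \<kappa> M" and \<kappa>: "\<kappa> \<ge> 2" and d: "\<And>K. K \<in> M \<Longrightarrow> d K \<ge> 0"
    and jump: "\<And>K1 K2. K1 \<in> M \<Longrightarrow> K2 \<in> M \<Longrightarrow> K1 \<noteq> K2 \<Longrightarrow> aff_dim (K1 \<inter> K2) = int CARD('n) - 1 \<Longrightarrow>
      (m K1 - m K2)\<^sup>2 \<le> (d K1 + d K2) *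
         ((diameter K1)\<^sup>2 / measure lebesgue K1 + (diameter K2)\<^sup>2 / measure lebesgue K2)"
    and K: "K \<in> M" "K' \<in> M" "v \<in> K" "v \<in> K'"
  shows "(m K - m K')\<^sup>2 \<le> star_const \<kappa> CARD('n) *
     ((diameter K)\<^sup>2 / measure lebesgue K * (\<Sum>L | L \<in> M \<and> v \<in> L. d L))"
proof -
  define N where "N = (nat \<lceil>\<kappa> ^ CARD('n)\<rceil>)\<^sup>2"
  define C where "C = \<kappa> ^ CARD('n) * (\<kappa> ^ N) ^ (CARD('n) - 2)"
  define s where "s L = (diameter L)\<^sup>2 / measure lebesgue L" for L :: "(real^'n) set"
  define D where "D = (\<Sum>L | L \<in> M \<and> v \<in> L. d L)"
  have s0: "s L \<ge> 0" for L by (simp add: s_def)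
  have C0: "C \<ge> 0" using \<kappa> by (simp add: C_def)
  have fin: "finite {L. L \<in> M \<and> v \<in> L}" using simplicial_meshD(1)[OF M] by simp
  have D0: "D \<ge> 0" unfolding D_def using d by (intro sum_nonneg) auto
  have sle: "s L \<le> C * s K" if "L \<in> M" "v \<in> L" for L
    using star_volume_comparable[OF n M T sr \<kappa> K(1) that(1) K(3) that(2)] by (simp add: s_def C_def N_def)
  define B where "B = sqrt (D * (2 * (C * s K)))"
  have step: "\<bar>m K1 - m K2\<bar> \<le> B" if "(K1, K2) \<in> facet_adjacent M v" for K1 K2
  proof -
    have KK: "K1 \<in> M" "K2 \<in> M" "v \<in> K1" "v \<in> K2" "K1 \<noteq> K2" "aff_dim (K1 \<inter> K2) = int CARD('n) - 1"
      using that by (auto simp: facet_adjacent_def)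
    have "(m K1 - m K2)\<^sup>2 \<le> (d K1 + d K2) * (s K1 + s K2)"
      using jump[OF KK(1,2,5,6)] by (simp add: s_def)
    also have "\<dots> \<le> D * (2 * (C * s K))"
    proof (rule mult_mono)
      have "d K1 + d K2 = sum d {K1, K2}" using KK(5) by simp
      also have "\<dots> \<le> D" unfolding D_def using fin KK d by (intro sum_mono2) auto
      finally show "d K1 + d K2 \<le> D" .
      show "s K1 + s K2 \<le> 2 * (C * s K)" using sle[OF KK(1,3)] sle[OF KK(2,4)] by linarith
    qed (use D0 s0 in auto)
    finally show ?thesis unfolding B_def by (metis real_sqrt_abs real_sqrt_le_iff)
  qed
  have B0: "B \<ge> 0" unfolding B_def using D0 C0 s0 by simp
  obtain j where j: "j \<le> N" "(K, K') \<in> facet_adjacent M v ^^ j"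
    using facet_adjacent_relpow[OF M T sr \<kappa> K, folded N_def] .
  have "\<bar>m K - m K'\<bar> \<le> real j * B" by (rule relpow_invariant_bound[OF step j(2)])
  also have "\<dots> \<le> real N * B" using j(1) B0 by (intro mult_right_mono) auto
  finally have "(m K - m K')\<^sup>2 \<le> (real N * B)\<^sup>2"
    by (rule abs_le_square_iff[THEN iffD1, OF order_trans]) simp
  also have "\<dots> = (real N)\<^sup>2 * (D * (2 * (C * s K)))"
    unfolding power_mult_distrib B_def using D0 C0 s0 by simp
  also have "\<dots> = star_const \<kappa> CARD('n) * (s K * D)"
    by (simp add: star_const_def C_def N_def mult_ac)
  finally show ?thesis by (simp add: s_def D_def)
qed

text \<open>A fine element that meets the interior of \<open>T\<close> lies in some coarse cell,
  which must be \<open>T\<close> by disjointness. So the fine elements inside \<open>T\<close> cover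
  its interior, and, being finitely many closed sets, all of \<open>T\<close>.\<close>

lemma refinement_submesh:
  fixes \<T>h \<T>H :: "'a::euclidean_space set set"
  assumes Mh: "simplicial_mesh \<T>h D" and MH: "simplicial_mesh \<T>H D"
    and ref: "\<And>K. K \<in> \<T>h \<Longrightarrow> \<exists>T\<in>\<T>H. K \<subseteq> T" and T: "T \<in> \<T>H"
  shows "simplicial_mesh {K \<in> \<T>h. K \<subseteq> T} T"
proof -
  let ?M = "{K \<in> \<T>h. K \<subseteq> T}"
  have fin: "finite ?M" using simplicial_meshD(1)[OF Mh] by simp
  have "interior T \<subseteq> \<Union>?M"
  proof
    fix x assume x: "x \<in> interior T"
    then have "x \<in> \<Union>\<T>h"
      using T interior_subset simplicial_meshD(3)[OF MH] simplicial_meshD(3)[OF Mh] by blast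
    then obtain K where K: "K \<in> \<T>h" "x \<in> K" by auto
    then obtain T' where T': "T' \<in> \<T>H" "K \<subseteq> T'" using ref by blast
    have "T' = T" using mesh_interior_disjoint[OF MH T T'(1)] x K T' by blast
    then show "x \<in> \<Union>?M" using K T' by auto
  qed
  moreover have "closed (\<Union>?M)"
    using fin full_simplex_interior(3)[OF simplicial_meshD(2)[OF Mh]] compact_imp_closed by (intro closed_Union) auto
  ultimately have "closure (interior T) \<subseteq> \<Union>?M" by (simp add: closure_minimal)
  then have "\<Union>?M = T" using full_simplex_interior(2)[OF simplicial_meshD(2)[OF MH T]] by auto
  then show ?thesis using Mh fin by (auto simp: simplicial_mesh_def triangulation_def)
qed

text \<open>The 3 comes from splitting the error into three terms. \<open>24 * 2 ^ n\<close> is the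
  element estimate. With \<open>star_const\<close>, the 1 stands for the interpolation error and
  \<open>2 ^ n * \<kappa>\<^sup>2\<close> for the Poincare inequality of the interpolant. The factor
  \<open>real (Suc n) * \<kappa> ^ n\<close> bounds how often the stars count one element.\<close>

definition local_const :: "real \<Rightarrow> nat \<Rightarrow> real" where
  "local_const \<kappa> n = 3 * (24 * 2 ^ n + star_const \<kappa> n * (1 + 2 ^ n * \<kappa>\<^sup>2) * (real (Suc n) * \<kappa> ^ n))"

lemma star_const_nonneg: "\<kappa> \<ge> 2 \<Longrightarrow> star_const \<kappa> n \<ge> 0"
  by (simp add: star_const_def)

lemma local_const_nonneg: "\<kappa> \<ge> 2 \<Longrightarrow> local_const \<kappa> n \<ge> 0"
  unfolding local_const_def using star_const_nonneg[of \<kappa> n] by simp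

text \<open>The element means are compared with their continuous piecewise affine nodal interpolant \<open>W\<close>.\<close>

lemma mesh_broken_poincare:
  fixes M :: "(real^'n) set set" and m d :: "(real^'n) set \<Rightarrow> real"
  assumes n: "CARD('n) \<ge> 2" and M: "simplicial_mesh M T" and T: "compact T" "convex T" "measure lebesgue T > 0"
    and sr: "shape_regular \<kappa> M" and \<kappa>: "\<kappa> \<ge> 2" and d: "\<And>K. K \<in> M \<Longrightarrow> d K \<ge> 0"
    and jump: "\<And>K1 K2. K1 \<in> M \<Longrightarrow> K2 \<in> M \<Longrightarrow> K1 \<noteq> K2 \<Longrightarrow> aff_dim (K1 \<inter> K2) = int CARD('n) - 1 \<Longrightarrow>
      (m K1 - m K2)\<^sup>2 \<le> (d K1 + d K2) *
         ((diameter K1)\<^sup>2 / measure lebesgue K1 + (diameter K2)\<^sup>2 / measure lebesgue K2)"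
    and p: "\<And>K. K \<in> M \<Longrightarrow> continuous_on UNIV (p K)" "\<And>K x. K \<in> M \<Longrightarrow> x \<in> interior K \<Longrightarrow> w x = p K x"
    and elt: "\<And>K. K \<in> M \<Longrightarrow> (LINT x:K|lebesgue. (p K x - m K)\<^sup>2) \<le> 24 * 2 ^ CARD('n) * ((diameter K)\<^sup>2 * d K)"
  obtains c where "(LINT x:T|lebesgue. (w x - c)\<^sup>2) \<le> local_const \<kappa> CARD('n) * ((diameter T)\<^sup>2 * (\<Sum>K\<in>M. d K))"
proof -
  let ?n = "CARD('n)"
  define H where "H = diameter T"
  define S where "S = star_const \<kappa> ?n"
  have S0: "S \<ge> 0" using star_const_nonneg[OF \<kappa>] by (simp add: S_def)
  have fin: "finite M" and UM: "\<Union>M = T" using simplicial_meshD(1,3)[OF M] by auto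
  have cc: "compact K" "convex K" and mp: "measure lebesgue K > 0" if "K \<in> M" for K
    using full_simplex_interior(3,4,5)[OF simplicial_meshD(2)[OF M that]] by auto
  have hp: "diameter K > 0" if "K \<in> M" for K
    using shape_regular_volume(1)[OF _ sr that] simplicial_meshD(2)[OF M that] by simp
  have hH: "(diameter K)\<^sup>2 \<le> H\<^sup>2" if "K \<in> M" for K
  proof -
    have "diameter K \<le> H" unfolding H_def
      by (rule diameter_subset) (use that UM T(1) compact_imp_bounded in auto)
    then show ?thesis using hp[OF that] by (intro power_mono) auto
  qed
  define V where "V K = {v. v extreme_point_of K}" for K :: "(real^'n) set"
  have V: "finite (V K)" "card (V K) = Suc ?n" "K = convex hull (V K)" if "K \<in> M" for K
    using full_simplex_vertices[OF simplicial_meshD(2)[OF M that]] by (auto simp: V_def)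
  have VK: "v \<in> K" if "v \<in> V K" for v K using that by (simp add: V_def extreme_point_of_def)
  define D where "D v = (\<Sum>L | L \<in> M \<and> v \<in> L. d L)" for v
  define DK where "DK K = (\<Sum>v\<in>V K. D v)" for K
  have D0: "D v \<ge> 0" for v unfolding D_def using d by (intro sum_nonneg) auto
  have DK0: "DK K \<ge> 0" for K unfolding DK_def using D0 by (intro sum_nonneg)
  define s where "s K = (diameter K)\<^sup>2 / measure lebesgue K" for K :: "(real^'n) set"
  have s0: "s K \<ge> 0" for K by (simp add: s_def)
  \<comment> \<open>The nodal value at \<open>v\<close> is the mean on an arbitrary but fixed
    element containing \<open>v\<close>.\<close>
  define pick where "pick v = (SOME K. K \<in> M \<and> v \<in> K)" for v
  have pick: "pick v \<in> M" "v \<in> pick v" if "K \<in> M" "v \<in> K" for K v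
    using someI[of "\<lambda>K. K \<in> M \<and> v \<in> K" K] that by (auto simp: pick_def)
  obtain W c q where W: "\<And>K x. K \<in> M \<Longrightarrow> x \<in> K \<Longrightarrow> W x = c K + q K \<bullet> x"
    and Wv: "\<And>K v. K \<in> M \<Longrightarrow> v extreme_point_of K \<Longrightarrow> c K + q K \<bullet> v = m (pick v)"
    using mesh_nodal_interpolant[OF M, of "\<lambda>v. m (pick v)"] by metis
  define \<epsilon> where "\<epsilon> K = sqrt (S * (s K * DK K))" for K
  have \<epsilon>2: "(\<epsilon> K)\<^sup>2 = S * (s K * DK K)" for K unfolding \<epsilon>_def using S0 s0 DK0 by simp
  have \<epsilon>0: "\<epsilon> K \<ge> 0" for K unfolding \<epsilon>_def using S0 s0 DK0 by simp
  have vert: "\<bar>(c K - m K) + q K \<bullet> v\<bar> \<le> \<epsilon> K" if K: "K \<in> M" and v: "v \<in> V K" for K v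
  proof -
    have vK: "v \<in> K" using VK[OF v] .
    have "(m K - m (pick v))\<^sup>2 \<le> S * (s K * D v)"
      unfolding S_def s_def D_def
      by (rule star_mean_oscillation[OF n M T(2) sr \<kappa> d jump K pick(1)[OF K vK] vK pick(2)[OF K vK]])
    also have "\<dots> \<le> S * (s K * DK K)"
      unfolding DK_def using V(1)[OF K] v D0 S0 s0 by (intro mult_left_mono member_le_sum) auto
    finally have "(m K - m (pick v))\<^sup>2 \<le> (\<epsilon> K)\<^sup>2" by (simp only: \<epsilon>2)
    then have "\<bar>m K - m (pick v)\<bar> \<le> \<epsilon> K" using \<epsilon>0 abs_le_square_iff[of "m K - m (pick v)" "\<epsilon> K"] by simp
    moreover have "c K + q K \<bullet> v = m (pick v)" using Wv[OF K] v by (simp add: V_def)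
    ultimately show ?thesis by (simp add: abs_minus_commute algebra_simps)
  qed
  have near: "\<bar>W x - m K\<bar> \<le> \<epsilon> K" if K: "K \<in> M" and x: "x \<in> K" for K x
  proof -
    have "x \<in> convex hull (V K)" using V(3)[OF K] x by simp
    from convex_hull_affine_le[OF vert[OF K] this] show ?thesis using W[OF K x] by (simp add: algebra_simps)
  qed
  \<comment> \<open>On \<open>K\<close> the interpolant deviates from the constant
    \<open>m K\<close> by at most \<open>\<epsilon> K\<close>, so its gradient is at most
    \<open>\<epsilon> K\<close> divided by the radius of the inscribed ball.\<close>
  have grad: "(norm (q K))\<^sup>2 * measure lebesgue K \<le> \<kappa>\<^sup>2 * (S * DK K)" if K: "K \<in> M" for K
  proof -
    obtain x \<rho> where \<rho>: "\<rho> > 0" "ball x \<rho> \<subseteq> K" "diameter K \<le> \<kappa> * \<rho>"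
      using sr K unfolding shape_regular_def by blast
    have "norm (q K) * (2 * \<rho>) \<le> 2 * \<epsilon> K"
    proof (rule affine_gradient_bound[OF \<rho>(2,1)])
      fix y z assume "y \<in> K" "z \<in> K"
      then show "q K \<bullet> y - q K \<bullet> z \<le> 2 * \<epsilon> K"
        using near[OF K, of y] near[OF K, of z] W[OF K, of y] W[OF K, of z] by (simp add: abs_le_iff)
    qed
    then have 1: "norm (q K) * \<rho> \<le> \<epsilon> K" by simp
    have "norm (q K) * diameter K \<le> norm (q K) * (\<kappa> * \<rho>)" using \<rho>(3) by (intro mult_left_mono) auto
    also have "\<dots> \<le> \<kappa> * \<epsilon> K" using mult_left_mono[OF 1, of \<kappa>] \<kappa> by (simp add: mult_ac)
    finally have "(norm (q K) * diameter K)\<^sup>2 \<le> (\<kappa> * \<epsilon> K)\<^sup>2"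
      using hp[OF K] by (intro power_mono) auto
    then have "(norm (q K))\<^sup>2 * (diameter K)\<^sup>2 \<le> \<kappa>\<^sup>2 * (S * (s K * DK K))"
      by (simp only: power_mult_distrib \<epsilon>2)
    also have "\<dots> = \<kappa>\<^sup>2 * (S * DK K) * (diameter K)\<^sup>2 / measure lebesgue K" by (simp add: s_def)
    finally have "((norm (q K))\<^sup>2 * measure lebesgue K) * (diameter K)\<^sup>2 \<le> (\<kappa>\<^sup>2 * (S * DK K)) * (diameter K)\<^sup>2"
      using mp[OF K] by (simp add: field_simps)
    then show ?thesis using hp[OF K] by simp
  qed
  obtain y where y: "y \<in> T" "set_integrable lebesgue T (\<lambda>x. (W x - W y)\<^sup>2)"
    "(LINT x:T|lebesgue. (W x - W y)\<^sup>2) \<le> 2 ^ DIM(real^'n) * ((diameter T)\<^sup>2 * (\<Sum>K\<in>M. (norm (q K))\<^sup>2 * measure lebesgue K))"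
    using mesh_affine_poincare[OF M T W] .
  define a where "a = W y"
  have intT: "interior K \<subseteq> T" if "K \<in> M" for K using UM that interior_subset by blast
  have ci: "set_integrable lebesgue K f" "set_integrable lebesgue (interior K) f"
    "(LINT x:interior K|lebesgue. f x) = (LINT x:K|lebesgue. f x)"
    if K: "K \<in> M" and f: "continuous_on K f" for K and f :: "real^'n \<Rightarrow> real"
    using set_integrable_compact_continuous(2)[OF cc(1)[OF K] f]
      set_integral_interior[OF cc(1,2)[OF K] set_integrable_compact_continuous(2)[OF cc(1)[OF K] f]] by auto
  have cp: "continuous_on A (p K)" if "K \<in> M" for A K using continuous_on_subset[OF p(1)[OF that]] by blast
  have Weq: "(LINT x:T|lebesgue. (W x - a)\<^sup>2) = (\<Sum>K\<in>M. LINT x:K|lebesgue. (c K + q K \<bullet> x - a)\<^sup>2)"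
  proof -
    have "(LINT x:T|lebesgue. (W x - a)\<^sup>2) = (\<Sum>K\<in>M. LINT x:interior K|lebesgue. (c K + q K \<bullet> x - a)\<^sup>2)"
    proof (rule mesh_piecewise_integral(2)[OF M order_refl intT order_refl])
      show "set_integrable lebesgue (interior K) (\<lambda>x. (c K + q K \<bullet> x - a)\<^sup>2)" if "K \<in> M" for K
        by (rule ci(2)[OF that]) (intro continuous_intros)
      show "(W x - a)\<^sup>2 = (c K + q K \<bullet> x - a)\<^sup>2" if "K \<in> M" "x \<in> interior K" for K x
        using W[OF that(1) subsetD[OF interior_subset that(2)]] by simp
    qed auto
    also have "\<dots> = (\<Sum>K\<in>M. LINT x:K|lebesgue. (c K + q K \<bullet> x - a)\<^sup>2)"
      by (intro sum.cong refl ci(3) continuous_intros)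
    finally show ?thesis .
  qed
  have weq: "(LINT x:T|lebesgue. (w x - a)\<^sup>2) = (\<Sum>K\<in>M. LINT x:K|lebesgue. (p K x - a)\<^sup>2)"
  proof -
    have "(LINT x:T|lebesgue. (w x - a)\<^sup>2) = (\<Sum>K\<in>M. LINT x:interior K|lebesgue. (p K x - a)\<^sup>2)"
    proof (rule mesh_piecewise_integral(2)[OF M order_refl intT order_refl])
      show "set_integrable lebesgue (interior K) (\<lambda>x. (p K x - a)\<^sup>2)" if "K \<in> M" for K
        by (rule ci(2)[OF that]) (intro continuous_intros cp that)
    qed (use p(2) in auto)
    also have "\<dots> = (\<Sum>K\<in>M. LINT x:K|lebesgue. (p K x - a)\<^sup>2)"
      by (intro sum.cong refl ci(3) continuous_intros cp)
    finally show ?thesis .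
  qed
  have elem: "(LINT x:K|lebesgue. (p K x - a)\<^sup>2)
      \<le> 3 * (24 * 2 ^ ?n * (H\<^sup>2 * d K) + S * (H\<^sup>2 * DK K) + (LINT x:K|lebesgue. (c K + q K \<bullet> x - a)\<^sup>2))"
    if K: "K \<in> M" for K
  proof -
    have i: "set_integrable lebesgue K (\<lambda>x. (p K x - m K)\<^sup>2)" "set_integrable lebesgue K (\<lambda>x. (\<epsilon> K)\<^sup>2)"
      "set_integrable lebesgue K (\<lambda>x. (c K + q K \<bullet> x - a)\<^sup>2)" "set_integrable lebesgue K (\<lambda>x. (p K x - a)\<^sup>2)"
      by (rule ci(1)[OF K], intro continuous_intros cp[OF K])+
    have "(LINT x:K|lebesgue. (p K x - a)\<^sup>2)
       \<le> (LINT x:K|lebesgue. 3 * ((p K x - m K)\<^sup>2 + (\<epsilon> K)\<^sup>2 + (c K + q K \<bullet> x - a)\<^sup>2))"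
    proof (rule set_integral_mono[OF i(4)])
      show "set_integrable lebesgue K (\<lambda>x. 3 * ((p K x - m K)\<^sup>2 + (\<epsilon> K)\<^sup>2 + (c K + q K \<bullet> x - a)\<^sup>2))"
        by (intro set_integrable_mult_right set_integral_add i)
      fix x assume x: "x \<in> K"
      define A B E where "A = p K x - m K" and "B = m K - W x" and "E = W x - a"
      have B: "B\<^sup>2 \<le> (\<epsilon> K)\<^sup>2"
        using near[OF K x] \<epsilon>0[of K] abs_le_square_iff[of B "\<epsilon> K"] by (simp add: B_def abs_minus_commute)
      have "(A + B + E)\<^sup>2 \<le> 3 * (A\<^sup>2 + B\<^sup>2 + E\<^sup>2)"
        using zero_le_power2[of "A - B"] zero_le_power2[of "A - E"] zero_le_power2[of "B - E"]
        by (simp add: power2_eq_square algebra_simps)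
      also have "\<dots> \<le> 3 * (A\<^sup>2 + (\<epsilon> K)\<^sup>2 + E\<^sup>2)" using B by simp
      finally have "(A + B + E)\<^sup>2 \<le> 3 * (A\<^sup>2 + (\<epsilon> K)\<^sup>2 + E\<^sup>2)" .
      moreover have "A + B + E = p K x - a" by (simp add: A_def B_def E_def)
      ultimately have "(p K x - a)\<^sup>2 \<le> 3 * (A\<^sup>2 + (\<epsilon> K)\<^sup>2 + E\<^sup>2)" by simp
      then show "(p K x - a)\<^sup>2 \<le> 3 * ((p K x - m K)\<^sup>2 + (\<epsilon> K)\<^sup>2 + (c K + q K \<bullet> x - a)\<^sup>2)"
        by (simp only: A_def E_def W[OF K x])
    qed
    also have "\<dots> = 3 * ((LINT x:K|lebesgue. (p K x - m K)\<^sup>2) + measure lebesgue K * (\<epsilon> K)\<^sup>2 + (LINT x:K|lebesgue. (c K + q K \<bullet> x - a)\<^sup>2))"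
      unfolding set_integral_mult_right set_integral_add(2)[OF set_integral_add(1)[OF i(1,2)] i(3)]
        set_integral_add(2)[OF i(1,2)] set_lebesgue_integral_const ..
    also have "\<dots> \<le> 3 * (24 * 2 ^ ?n * (H\<^sup>2 * d K) + S * (H\<^sup>2 * DK K) + (LINT x:K|lebesgue. (c K + q K \<bullet> x - a)\<^sup>2))"
    proof (intro mult_left_mono add_mono order_refl)
      have "(diameter K)\<^sup>2 * d K \<le> H\<^sup>2 * d K" using hH[OF K] d[OF K] by (rule mult_right_mono)
      then have "24 * 2 ^ ?n * ((diameter K)\<^sup>2 * d K) \<le> 24 * 2 ^ ?n * (H\<^sup>2 * d K)"
        by (rule mult_left_mono) simp
      then show "(LINT x:K|lebesgue. (p K x - m K)\<^sup>2) \<le> 24 * 2 ^ ?n * (H\<^sup>2 * d K)"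
        by (rule order_trans[OF elt[OF K]])
      have "measure lebesgue K * (\<epsilon> K)\<^sup>2 = S * ((diameter K)\<^sup>2 * DK K)"
        unfolding \<epsilon>2 s_def using mp[OF K] by simp
      also have "\<dots> \<le> S * (H\<^sup>2 * DK K)"
        using hH[OF K] DK0 S0 by (intro mult_left_mono mult_right_mono)
      finally show "measure lebesgue K * (\<epsilon> K)\<^sup>2 \<le> S * (H\<^sup>2 * DK K)" .
    qed auto
    finally show ?thesis .
  qed
  \<comment> \<open>Double counting: a vertex of \<open>K\<close> that lies in \<open>L\<close> is a
    vertex of \<open>L\<close> that lies in \<open>K\<close>. So \<open>d L\<close> is counted at
    most once for each vertex of \<open>L\<close> and each element at that vertex.\<close>
  have DKsum: "(\<Sum>K\<in>M. DK K) \<le> (real (Suc ?n) * \<kappa> ^ ?n) * (\<Sum>K\<in>M. d K)"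
  proof -
    have "(\<Sum>K\<in>M. DK K) = (\<Sum>K\<in>M. \<Sum>v\<in>V K. \<Sum>L\<in>M. if v \<in> L then d L else 0)"
      unfolding DK_def D_def using fin by (simp add: sum.inter_filter)
    also have "\<dots> = (\<Sum>K\<in>M. \<Sum>L\<in>M. \<Sum>v\<in>V K. if v \<in> L then d L else 0)"
      by (intro sum.cong refl sum.swap)
    also have "\<dots> = (\<Sum>L\<in>M. \<Sum>K\<in>M. \<Sum>v\<in>V K. if v \<in> L then d L else 0)"
      by (rule sum.swap)
    also have "\<dots> \<le> (\<Sum>L\<in>M. (real (Suc ?n) * \<kappa> ^ ?n) * d L)"
    proof (rule sum_mono)
      fix L assume L: "L \<in> M"
      have "(\<Sum>K\<in>M. \<Sum>v\<in>V K. if v \<in> L then d L else 0) \<le> (\<Sum>K\<in>M. \<Sum>v\<in>V L. if v \<in> K then d L else 0)"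
      proof (rule sum_mono)
        fix K assume K: "K \<in> M"
        have "(\<Sum>v\<in>V K. if v \<in> L then d L else 0) = (\<Sum>v\<in>V K \<inter> L. d L)"
          by (rule sum.inter_restrict[OF V(1)[OF K], symmetric])
        also have "\<dots> \<le> (\<Sum>v\<in>V L \<inter> K. d L)"
        proof (rule sum_mono2)
          show "V K \<inter> L \<subseteq> V L \<inter> K"
            using mesh_vertices_agree[OF M K L] VK by (auto simp: V_def)
        qed (use V(1)[OF L] d[OF L] in auto)
        also have "\<dots> = (\<Sum>v\<in>V L. if v \<in> K then d L else 0)"
          by (rule sum.inter_restrict[OF V(1)[OF L]])
        finally show "(\<Sum>v\<in>V K. if v \<in> L then d L else 0) \<le> (\<Sum>v\<in>V L. if v \<in> K then d L else 0)" .
      qed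
      also have "\<dots> = (\<Sum>v\<in>V L. \<Sum>K\<in>M. if v \<in> K then d L else 0)" by (rule sum.swap)
      also have "\<dots> = (\<Sum>v\<in>V L. real (card {K \<in> M. v \<in> K}) * d L)"
        using fin by (intro sum.cong refl) (simp add: sum.inter_filter[symmetric])
      also have "\<dots> \<le> (\<Sum>v\<in>V L. \<kappa> ^ ?n * d L)"
        using mesh_star_card[OF M sr \<kappa>] d[OF L] by (intro sum_mono mult_right_mono)
      also have "\<dots> = (real (Suc ?n) * \<kappa> ^ ?n) * d L" using V(2)[OF L] by simp
      finally show "(\<Sum>K\<in>M. \<Sum>v\<in>V K. if v \<in> L then d L else 0) \<le> (real (Suc ?n) * \<kappa> ^ ?n) * d L" .
    qed
    finally show ?thesis by (simp add: sum_distrib_left)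
  qed
  have Wbound: "(LINT x:T|lebesgue. (W x - a)\<^sup>2) \<le> 2 ^ ?n * (H\<^sup>2 * (\<kappa>\<^sup>2 * (S * (\<Sum>K\<in>M. DK K))))"
  proof -
    have "(\<Sum>K\<in>M. (norm (q K))\<^sup>2 * measure lebesgue K) \<le> (\<Sum>K\<in>M. \<kappa>\<^sup>2 * (S * DK K))"
      using grad by (rule sum_mono)
    also have "\<dots> = \<kappa>\<^sup>2 * (S * (\<Sum>K\<in>M. DK K))" by (simp add: sum_distrib_left)
    finally have "2 ^ ?n * (H\<^sup>2 * (\<Sum>K\<in>M. (norm (q K))\<^sup>2 * measure lebesgue K)) \<le> 2 ^ ?n * (H\<^sup>2 * (\<kappa>\<^sup>2 * (S * (\<Sum>K\<in>M. DK K))))"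
      by (intro mult_left_mono) auto
    moreover have "(LINT x:T|lebesgue. (W x - a)\<^sup>2) \<le> 2 ^ ?n * (H\<^sup>2 * (\<Sum>K\<in>M. (norm (q K))\<^sup>2 * measure lebesgue K))"
      using y(3) by (simp add: a_def H_def)
    ultimately show ?thesis by (rule order_trans[rotated])
  qed
  have "(LINT x:T|lebesgue. (w x - a)\<^sup>2) \<le> (\<Sum>K\<in>M. 3 * (24 * 2 ^ ?n * (H\<^sup>2 * d K) + S * (H\<^sup>2 * DK K) + (LINT x:K|lebesgue. (c K + q K \<bullet> x - a)\<^sup>2)))"
    unfolding weq by (rule sum_mono[OF elem])
  also have "\<dots> = 3 * (24 * 2 ^ ?n * (H\<^sup>2 * (\<Sum>K\<in>M. d K)) + S * (H\<^sup>2 * (\<Sum>K\<in>M. DK K)) + (LINT x:T|lebesgue. (W x - a)\<^sup>2))"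
    unfolding Weq by (simp only: sum_distrib_left[symmetric] sum.distrib)
  also have "\<dots> \<le> 3 * (24 * 2 ^ ?n * (H\<^sup>2 * (\<Sum>K\<in>M. d K)) + S * (H\<^sup>2 * (\<Sum>K\<in>M. DK K)) + 2 ^ ?n * (H\<^sup>2 * (\<kappa>\<^sup>2 * (S * (\<Sum>K\<in>M. DK K)))))"
    using Wbound by simp
  also have "\<dots> = 3 * (24 * 2 ^ ?n * (H\<^sup>2 * (\<Sum>K\<in>M. d K)) + (S * (1 + 2 ^ ?n * \<kappa>\<^sup>2) * H\<^sup>2) * (\<Sum>K\<in>M. DK K))"
    by (simp add: algebra_simps)
  also have "\<dots> \<le> 3 * (24 * 2 ^ ?n * (H\<^sup>2 * (\<Sum>K\<in>M. d K)) + (S * (1 + 2 ^ ?n * \<kappa>\<^sup>2) * H\<^sup>2) * ((real (Suc ?n) * \<kappa> ^ ?n) * (\<Sum>K\<in>M. d K)))"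
    using DKsum S0 by (intro mult_left_mono add_mono order_refl) auto
  also have "\<dots> = local_const \<kappa> ?n * (H\<^sup>2 * (\<Sum>K\<in>M. d K))"
    unfolding local_const_def S_def by (simp only: ring_distribs mult_ac)
  finally show ?thesis using that[of a] by (simp add: H_def)
qed

subsection \<open>Stability of the discrete solution\<close>

lemma l2_inner_diff:
  fixes f g h :: "real^'n \<Rightarrow> 'b::euclidean_space"
  assumes "L2 A f" "L2 A g" "L2 A h"
  shows "l2_inner A (\<lambda>x. f x - g x) h = l2_inner A f h - l2_inner A g h"
    "l2_inner A h (\<lambda>x. f x - g x) = l2_inner A h f - l2_inner A h g"
  unfolding l2_inner_def inner_diff_left inner_diff_right
  by (intro set_integral_diff(2) L2_inner_integrable assms)+

lemma Lambda_n_h_L2: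
  assumes M: "simplicial_mesh \<T> T" and S: "S \<subseteq> T" "\<And>K. K \<in> \<T> \<Longrightarrow> interior K \<subseteq> S"
    and v: "v \<in> Lambda_n_h r \<T>"
  shows "L2 S v"
proof (rule L2_piecewise_continuous[OF M S])
  fix K assume "K \<in> \<T>"
  then obtain q where "poly_fun (r - 1) q" "\<forall>x\<in>interior K. v x = q x"
    using v unfolding Lambda_n_h_def by blast
  then show "\<exists>q. continuous_on UNIV q \<and> (\<forall>x\<in>interior K. v x = q x)"
    using poly_fun_continuous_on by blast
qed

lemma Lambda_n_h_diff:
  assumes "u \<in> Lambda_n_h r \<T>" "v \<in> Lambda_n_h r \<T>"
  shows "(\<lambda>x. u x - v x) \<in> Lambda_n_h r \<T>"
  unfolding Lambda_n_h_def
proof (intro CollectI ballI)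
  fix T assume "T \<in> \<T>"
  then obtain p q where "poly_fun (r - 1) p" "\<forall>x\<in>interior T. u x = p x"
      "poly_fun (r - 1) q" "\<forall>x\<in>interior T. v x = q x"
    using assms unfolding Lambda_n_h_def by blast
  then show "\<exists>q. poly_fun (r - 1) q \<and> (\<forall>x\<in>interior T. u x - v x = q x)"
    by (intro exI[of _ "\<lambda>x. p x - q x"]) (auto intro: poly_fun_diff)
qed

lemma Lambda_n_h_refines:
  assumes "v \<in> Lambda_n_h r \<T>H" "refines \<T>h \<T>H"
  shows "v \<in> Lambda_n_h r \<T>h"
  unfolding Lambda_n_h_def
proof (intro CollectI ballI)
  fix K assume "K \<in> \<T>h"
  then obtain T where T: "T \<in> \<T>H" "K \<subseteq> T" using assms(2) unfolding refines_def by blast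
  then obtain q where "poly_fun (r - 1) q" "\<forall>x\<in>interior T. v x = q x"
    using assms(1) unfolding Lambda_n_h_def by blast
  then show "\<exists>q. poly_fun (r - 1) q \<and> (\<forall>x\<in>interior K. v x = q x)"
    using interior_mono[OF T(2)] by blast
qed

text \<open>Constants lie in every local space. On the coarse mesh this is the test function that
  shows \<open>fh - fH\<close> to have mean zero on coarse cells.\<close>

lemma mesh_cell_indicator_Lambda_n_h:
  assumes M: "simplicial_mesh \<T> D" and T: "T \<in> \<T>"
  shows "indicat_real (interior T) \<in> Lambda_n_h r \<T>"
  unfolding Lambda_n_h_def
proof (intro CollectI ballI)
  fix T' assume T': "T' \<in> \<T>"
  have "indicat_real (interior T) x = (if T' = T then 1 else 0)" if "x \<in> interior T'" for x
    using mesh_interior_disjoint[OF M T' T] that interior_subset by (auto simp: indicator_def)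
  then show "\<exists>q. poly_fun (r - 1) q \<and> (\<forall>x\<in>interior T'. indicat_real (interior T) x = q x)"
    using poly_fun_const by (intro exI[of _ "\<lambda>_. if T' = T then 1 else 0"]) blast
qed

lemma weak_d_diff:
  fixes \<Omega> :: "(real^'n) set"
  assumes \<Omega>: "bounded \<Omega>" "open \<Omega>" and w: "weak_d \<Omega> \<sigma> z" "weak_d \<Omega> \<sigma>' z'"
    and L: "L2 \<Omega> \<sigma>" "L2 \<Omega> \<sigma>'" "L2 \<Omega> z" "L2 \<Omega> z'"
  shows "weak_d \<Omega> (\<lambda>x. \<sigma> x - \<sigma>' x) (\<lambda>x. z x - z' x)"
  unfolding weak_d_def
proof (intro allI impI)
  fix \<phi> G assume t: "test_fun \<Omega> \<phi> G"
  then have C: "C1_with_grad \<phi> G" by (auto simp: test_fun_def C1_with_grad_def)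
  have "compact (closure \<Omega>)" using \<Omega> by (simp add: compact_closure)
  then have "L2 (closure \<Omega>) G" "L2 (closure \<Omega>) \<phi>"
    using C1_with_gradD[OF C] by (auto intro: L2_compact_continuous)
  then have G: "L2 \<Omega> G" "L2 \<Omega> \<phi>"
    using \<Omega>(2) by (simp_all add: L2_subset[OF _ closure_subset])
  have "l2_inner \<Omega> (\<lambda>x. \<sigma> x - \<sigma>' x) G = l2_inner \<Omega> \<sigma> G - l2_inner \<Omega> \<sigma>' G"
    "l2_inner \<Omega> (\<lambda>x. z x - z' x) \<phi> = l2_inner \<Omega> z \<phi> - l2_inner \<Omega> z' \<phi>"
    using L G by (auto intro: l2_inner_diff)
  moreover have "l2_inner \<Omega> \<sigma> G = - l2_inner \<Omega> z \<phi>" "l2_inner \<Omega> \<sigma>' G = - l2_inner \<Omega> z' \<phi>"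
    using w t unfolding weak_d_def l2_inner_def inner_real_def by auto
  ultimately show "(LINT x:\<Omega>|lebesgue. (\<sigma> x - \<sigma>' x) \<bullet> G x) = - (LINT x:\<Omega>|lebesgue. (z x - z' x) * \<phi> x)"
    by (simp add: l2_inner_def)
qed

lemma discrete_solution_stability:
  fixes \<Omega> :: "(real^'n) set"
  assumes n: "CARD('n) \<ge> 2" and \<Omega>: "lipschitz_polyhedral_domain \<Omega>" and r: "r \<ge> 1"
    and Th: "conforming_triangulation \<Omega> \<T>h" and TH: "conforming_triangulation \<Omega> \<T>H"
    and ref: "refines \<T>h \<T>H" and sr: "shape_regular \<kappa> \<T>h"
    and f: "L2 \<Omega> f" and fh: "is_L2_proj \<Omega> (Lambda_n_h r \<T>h) f fh" and fH: "is_L2_proj \<Omega> (Lambda_n_h r \<T>H) f fH"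
    and solt: "discrete_solution fam r \<Omega> \<T>h fH \<sigma>t ut" and solh: "discrete_solution fam r \<Omega> \<T>h fh \<sigma>h uh"
  shows "l2_norm \<Omega> (\<lambda>x. \<sigma>h x - \<sigma>t x) \<le> sqrt (local_const \<kappa> CARD('n)) * osc fh fH \<T>H"
proof -
  have op: "open \<Omega>" and bd: "bounded \<Omega>" and ne: "\<Omega> \<noteq> {}" and lb: "lipschitz_boundary \<Omega>"
    using \<Omega> by (auto simp: lipschitz_polyhedral_domain_def)
  have Mh: "simplicial_mesh \<T>h (closure \<Omega>)" and MH: "simplicial_mesh \<T>H (closure \<Omega>)"
    using Th TH by (auto simp: conforming_triangulation_def simplicial_mesh_def)
  have intsub: "interior K \<subseteq> \<Omega>" if "simplicial_mesh \<T> (closure \<Omega>)" "K \<in> \<T>" for \<T> K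
  proof -
    have "K \<subseteq> closure \<Omega>" using simplicial_meshD(3)[OF that(1)] that(2) by auto
    then show ?thesis using interior_mono lipschitz_boundary_interior_closure[OF lb op] by blast
  qed
  note inth = intsub[OF Mh] and intH = intsub[OF MH]
  have sub: "\<Omega> \<subseteq> closure \<Omega>" by (rule closure_subset)
  have \<kappa>: "\<kappa> \<ge> 2"
  proof -
    \<comment> \<open>\<open>\<Omega>\<close> is nonempty, so there is at least one element, and its
      inscribed ball forces the bound.\<close>
    obtain K where "K \<in> \<T>h" using ne sub simplicial_meshD(3)[OF Mh] by blast
    then show ?thesis using shape_regular_volume(2)[OF _ sr] simplicial_meshD(2)[OF Mh] by auto
  qed
  define L where "L = local_const \<kappa> CARD('n)"
  have L0: "L \<ge> 0" unfolding L_def by (rule local_const_nonneg[OF \<kappa>])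
  define g where "g x = fh x - fH x" for x
  define w where "w x = uh x - ut x" for x
  define \<delta> where "\<delta> x = \<sigma>h x - \<sigma>t x" for x
  have L2h: "L2 \<Omega> v" if "v \<in> Lambda_n_h r \<T>h" for v
    by (rule Lambda_n_h_L2[OF Mh sub inth that])
  have fhL: "fh \<in> Lambda_n_h r \<T>h" and fHL: "fH \<in> Lambda_n_h r \<T>H" using fh fH by (auto simp: is_L2_proj_def)
  have fHh: "fH \<in> Lambda_n_h r \<T>h" by (rule Lambda_n_h_refines[OF fHL ref])
  have gL: "g \<in> Lambda_n_h r \<T>h" unfolding g_def by (rule Lambda_n_h_diff[OF fhL fHh])
  have uL: "uh \<in> Lambda_n_h r \<T>h" "ut \<in> Lambda_n_h r \<T>h"
    using solh solt by (auto simp: discrete_solution_def)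
  have wL: "w \<in> Lambda_n_h r \<T>h" unfolding w_def by (rule Lambda_n_h_diff[OF uL])
  have \<sigma>L: "\<sigma>h \<in> Lambda_nm1_h fam r \<Omega> \<T>h" "\<sigma>t \<in> Lambda_nm1_h fam r \<Omega> \<T>h"
    using solh solt by (auto simp: discrete_solution_def)
  then have \<sigma>2: "L2 \<Omega> \<sigma>h" "L2 \<Omega> \<sigma>t" by (auto simp: Lambda_nm1_h_def H_Lambda_def)
  have \<delta>2: "L2 \<Omega> \<delta>" unfolding \<delta>_def by (rule L2_diff[OF \<sigma>2])
  obtain z where z: "weak_d \<Omega> \<sigma>h z" "L2 \<Omega> z" "\<And>v. v \<in> Lambda_n_h r \<T>h \<Longrightarrow> l2_inner \<Omega> z v = l2_inner \<Omega> fh v"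
    using solh unfolding discrete_solution_def by blast
  obtain z' where z': "weak_d \<Omega> \<sigma>t z'" "L2 \<Omega> z'" "\<And>v. v \<in> Lambda_n_h r \<T>h \<Longrightarrow> l2_inner \<Omega> z' v = l2_inner \<Omega> fH v"
    using solt unfolding discrete_solution_def by blast
  have dg: "discrete_gradient fam r \<Omega> \<T>h \<delta> w"
    unfolding discrete_gradient_def
  proof (intro allI impI)
    fix \<tau> y assume a: "\<tau> \<in> Lambda_nm1_h fam r \<Omega> \<T>h \<and> weak_d \<Omega> \<tau> y \<and> L2 \<Omega> y"
    then have \<tau>2: "L2 \<Omega> \<tau>" by (auto simp: Lambda_nm1_h_def H_Lambda_def)
    have "l2_inner \<Omega> \<sigma>h \<tau> - l2_inner \<Omega> y uh = 0" "l2_inner \<Omega> \<sigma>t \<tau> - l2_inner \<Omega> y ut = 0"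
      using solh solt a unfolding discrete_solution_def by blast+
    then show "l2_inner \<Omega> \<delta> \<tau> = l2_inner \<Omega> y w"
      unfolding \<delta>_def w_def using l2_inner_diff(1)[OF \<sigma>2 \<tau>2] l2_inner_diff(2)[OF L2h[OF uL(1)] L2h[OF uL(2)]] a by simp
  qed
  have wd: "weak_d \<Omega> \<delta> (\<lambda>x. z x - z' x)"
    unfolding \<delta>_def by (rule weak_d_diff[OF bd op z(1) z'(1) \<sigma>2 z(2) z'(2)])
  have zz: "L2 \<Omega> (\<lambda>x. z x - z' x)" by (rule L2_diff[OF z(2) z'(2)])
  have \<delta>L: "\<delta> \<in> Lambda_nm1_h fam r \<Omega> \<T>h"
    unfolding Lambda_nm1_h_def H_Lambda_def
  proof (intro CollectI conjI ballI)
    fix K assume "K \<in> \<T>h"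
    then obtain p q where "local_sigma fam r p" "\<forall>x\<in>interior K. \<sigma>h x = p x"
       "local_sigma fam r q" "\<forall>x\<in>interior K. \<sigma>t x = q x"
      using \<sigma>L unfolding Lambda_nm1_h_def by blast
    then show "\<exists>q. local_sigma fam r q \<and> (\<forall>x\<in>interior K. \<delta> x = q x)"
      by (intro exI[of _ "\<lambda>x. p x - q x"]) (auto intro: local_sigma_diff simp: \<delta>_def)
  qed (use \<delta>2 wd zz in auto)
  define X where "X = (LINT x:\<Omega>|lebesgue. (norm (\<delta> x))\<^sup>2)"
  \<comment> \<open>\<open>\<delta>\<close> is itself an admissible test field, and its divergence
    acts on discrete functions as \<open>g\<close> does.\<close>
  have Xgw: "X = (LINT x:\<Omega>|lebesgue. g x * w x)"
  proof -
    have "X = l2_inner \<Omega> \<delta> \<delta>" by (simp add: X_def l2_inner_def power2_norm_eq_inner)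
    also have "\<dots> = l2_inner \<Omega> (\<lambda>x. z x - z' x) w"
      using dg \<delta>L wd zz unfolding discrete_gradient_def by blast
    also have "\<dots> = l2_inner \<Omega> z w - l2_inner \<Omega> z' w" by (rule l2_inner_diff(1)[OF z(2) z'(2) L2h[OF wL]])
    also have "\<dots> = l2_inner \<Omega> fh w - l2_inner \<Omega> fH w" using z(3)[OF wL] z'(3)[OF wL] by simp
    also have "\<dots> = l2_inner \<Omega> g w"
      unfolding g_def by (rule l2_inner_diff(1)[OF L2h[OF fhL] L2h[OF fHh] L2h[OF wL], symmetric])
    finally show ?thesis by (simp add: l2_inner_def)
  qed
  have "\<forall>K\<in>\<T>h. \<exists>q. poly_fun (r - 1) q \<and> (\<forall>x\<in>interior K. w x = q x)"
    using wL by (simp add: Lambda_n_h_def)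
  then obtain p where "\<forall>K\<in>\<T>h. poly_fun (r - 1) (p K) \<and> (\<forall>x\<in>interior K. w x = p K x)"
    by (rule bchoice[THEN exE])
  then have p: "\<And>K. K \<in> \<T>h \<Longrightarrow> poly_fun (r - 1) (p K)" "\<And>K x. K \<in> \<T>h \<Longrightarrow> x \<in> interior K \<Longrightarrow> w x = p K x" by auto
  have pc: "\<And>K. K \<in> \<T>h \<Longrightarrow> continuous_on UNIV (p K)" using poly_fun_continuous_on[OF p(1)] .
  define d where "d K = (LINT x:interior K|lebesgue. (norm (\<delta> x))\<^sup>2)" for K
  define m where "m K = (LINT x:K|lebesgue. p K x) / measure lebesgue K" for K
  have d0: "d K \<ge> 0" for K unfolding d_def set_lebesgue_integral_def by (rule integral_nonneg_AE) auto
  define o2 where "o2 T = (LINT x:T|lebesgue. (diameter T * g x)\<^sup>2)" for T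
  have o0: "o2 T \<ge> 0" for T unfolding o2_def set_lebesgue_integral_def by (rule integral_nonneg_AE) auto
  have cell: "set_integrable lebesgue (interior T) (\<lambda>x. g x * w x) \<and>
      \<bar>LINT x:interior T|lebesgue. g x * w x\<bar> \<le> sqrt L * (sqrt (o2 T) * sqrt (d T))" if T: "T \<in> \<T>H" for T
  proof -
    define M where "M = {K \<in> \<T>h. K \<subseteq> T}"
    have M: "simplicial_mesh M T"
      unfolding M_def by (rule refinement_submesh[OF Mh MH _ T]) (use ref in \<open>auto simp: refines_def\<close>)
    have MT: "K \<in> \<T>h" if "K \<in> M" for K using that by (simp add: M_def)
    have ct: "compact T" "convex T" "measure lebesgue T > 0"
      using full_simplex_interior(3,4,5)[OF simplicial_meshD(2)[OF MH T]] by auto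
    have srM: "shape_regular \<kappa> M" using sr by (auto simp: shape_regular_def M_def)
    have intT: "interior K \<subseteq> interior T" "interior K \<subseteq> T" if "K \<in> M" for K
      using that interior_mono[of K T] interior_subset by (auto simp: M_def)
    obtain c where c: "(LINT x:T|lebesgue. (w x - c)\<^sup>2) \<le> local_const \<kappa> CARD('n) * ((diameter T)\<^sup>2 * (\<Sum>K\<in>M. d K))"
    proof (rule mesh_broken_poincare[OF n M ct srM \<kappa>, of d m p w])
      show "(m K1 - m K2)\<^sup>2 \<le> (d K1 + d K2) *
          ((diameter K1)\<^sup>2 / measure lebesgue K1 + (diameter K2)\<^sup>2 / measure lebesgue K2)"
        if "K1 \<in> M" "K2 \<in> M" "K1 \<noteq> K2" "aff_dim (K1 \<inter> K2) = int CARD('n) - 1" for K1 K2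
        using facet_jump_bound[OF Mh inth r dg \<delta>2 pc p(2) MT[OF that(1)] MT[OF that(2)] that(3)] that(4)
        by (simp add: m_def d_def)
      show "(LINT x:K|lebesgue. (p K x - m K)\<^sup>2) \<le> 24 * 2 ^ CARD('n) * ((diameter K)\<^sup>2 * d K)" if "K \<in> M" for K
        unfolding m_def d_def by (rule element_mean_bound[OF Mh inth r dg \<delta>2 p MT[OF that]])
    qed (use d0 pc p(2) MT in auto)
    have \<delta>int: "set_integrable lebesgue (interior K) (\<lambda>x. (norm (\<delta> x))\<^sup>2)" if "K \<in> M" for K
      using L2_subset[OF \<delta>2 inth[OF MT[OF that]]] by (simp add: L2_def)
    \<comment> \<open>The elements of \<open>M\<close> tile \<open>T\<close>, so exactly the part of
      \<open>\<delta>\<close> on \<open>T\<close> enters; this is what makes the final sum over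
      coarse cells possible.\<close>
    have dT: "(\<Sum>K\<in>M. d K) = d T"
      unfolding d_def using mesh_set_integral(2)[OF M interior_subset intT(1) \<delta>int] by simp
    have MLam: "v \<in> Lambda_n_h r M" if "v \<in> Lambda_n_h r \<T>h" for v
      using that by (auto simp: Lambda_n_h_def M_def)
    have L2T: "L2 T v" if "v \<in> Lambda_n_h r \<T>h" for v
      by (rule Lambda_n_h_L2[OF M order_refl intT(2) MLam[OF that]])
    have gT: "L2 T g" and wT: "L2 T w" using L2T gL wL by auto
    have cT: "L2 T (\<lambda>x. c)" by (rule L2_compact_continuous[OF ct(1)]) (intro continuous_intros)
    have wcT: "L2 T (\<lambda>x. w x - c)" by (rule L2_diff[OF wT cT])
    \<comment> \<open>Both \<open>fh\<close> and \<open>fH\<close> have the same moment as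
      \<open>f\<close> against the cell indicator, which lies in the coarse space and by refinement
      also in the fine one.\<close>
    have orth: "(LINT x:T|lebesgue. g x) = 0"
    proof -
      define v where "v = indicat_real (interior T)"
      have vH: "v \<in> Lambda_n_h r \<T>H" unfolding v_def by (rule mesh_cell_indicator_Lambda_n_h[OF MH T])
      have vh: "v \<in> Lambda_n_h r \<T>h" by (rule Lambda_n_h_refines[OF vH ref])
      have "l2_inner \<Omega> (\<lambda>x. f x - fH x) v = 0" "l2_inner \<Omega> (\<lambda>x. f x - fh x) v = 0"
        using fh fH vH vh by (auto simp: is_L2_proj_def)
      then have "l2_inner \<Omega> g v = 0"
        unfolding g_def using l2_inner_diff(1)[OF f L2h[OF fHh] L2h[OF vh]] l2_inner_diff(1)[OF f L2h[OF fhL] L2h[OF vh]]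
          l2_inner_diff(1)[OF L2h[OF fhL] L2h[OF fHh] L2h[OF vh]] by simp
      moreover have "l2_inner \<Omega> g v = (LINT x:interior T|lebesgue. g x)"
        unfolding l2_inner_def set_lebesgue_integral_def v_def
        using intH[OF T] by (intro Bochner_Integration.integral_cong) (auto simp: indicator_def)
      moreover have gi: "set_integrable lebesgue T g"
        using L2_inner_integrable[OF gT L2_compact_continuous[OF ct(1), of "\<lambda>_. 1"]] by simp
      ultimately show ?thesis using set_integral_interior(2)[OF ct(1,2) gi] by simp
    qed
    have gw: "set_integrable lebesgue T (\<lambda>x. g x * w x)" using L2_inner_integrable[OF gT wT] by simp
    have "(LINT x:interior T|lebesgue. g x * w x) = (LINT x:T|lebesgue. g x * w x)"
      by (rule set_integral_interior(2)[OF ct(1,2) gw])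
    also have "\<dots> = (LINT x:T|lebesgue. g x \<bullet> (w x - c))"
      using l2_inner_diff(2)[OF wT cT gT] orth by (simp add: l2_inner_def)
    finally have "(LINT x:interior T|lebesgue. g x * w x)\<^sup>2
       \<le> (LINT x:T|lebesgue. (norm (g x))\<^sup>2) * (LINT x:T|lebesgue. (norm (w x - c))\<^sup>2)"
      using L2_Cauchy_Schwarz[OF gT wcT] by simp
    also have "\<dots> \<le> (LINT x:T|lebesgue. (g x)\<^sup>2) * (L * ((diameter T)\<^sup>2 * d T))"
    proof -
      have "0 \<le> (LINT x:T|lebesgue. (g x)\<^sup>2)"
        unfolding set_lebesgue_integral_def by (rule integral_nonneg_AE) auto
      then show ?thesis using c by (simp add: dT L_def mult_left_mono)
    qed
    also have "\<dots> = L * (o2 T * d T)"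
      by (simp add: o2_def power_mult_distrib mult_ac)
    finally have "\<bar>LINT x:interior T|lebesgue. g x * w x\<bar> \<le> sqrt (L * (o2 T * d T))"
      by (metis real_sqrt_abs real_sqrt_le_iff)
    then show ?thesis using set_integral_interior(1)[OF ct(1,2) gw] by (simp add: real_sqrt_mult)
  qed
  have \<delta>T: "set_integrable lebesgue (interior T) (\<lambda>x. (norm (\<delta> x))\<^sup>2)" if "T \<in> \<T>H" for T
    using L2_subset[OF \<delta>2 intH[OF that]] by (simp add: L2_def)
  have X1: "X = (\<Sum>T\<in>\<T>H. d T)"
    unfolding X_def d_def by (rule mesh_set_integral(2)[OF MH sub intH \<delta>T])
  have "X = (\<Sum>T\<in>\<T>H. LINT x:interior T|lebesgue. g x * w x)"
    unfolding Xgw using cell by (intro mesh_set_integral(2)[OF MH sub intH]) auto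
  also have "\<dots> \<le> (\<Sum>T\<in>\<T>H. sqrt L * (sqrt (o2 T) * sqrt (d T)))"
    using cell by (intro sum_mono) (auto simp: abs_le_iff)
  also have "\<dots> = sqrt L * (\<Sum>T\<in>\<T>H. sqrt (o2 T) * sqrt (d T))" by (simp add: sum_distrib_left)
  \<comment> \<open>Cauchy-Schwarz over the coarse cells recombines the local factors into
    \<open>osc\<close> and \<open>X\<close>.\<close>
  also have "\<dots> \<le> sqrt L * sqrt ((\<Sum>T\<in>\<T>H. (sqrt (o2 T))\<^sup>2) * (\<Sum>T\<in>\<T>H. (sqrt (d T))\<^sup>2))"
    using L0 by (intro mult_left_mono real_le_rsqrt Cauchy_Schwarz_ineq_sum) auto
  also have "\<dots> = sqrt L * (osc fh fH \<T>H * sqrt X)"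
    using o0 d0 by (simp add: X1 osc_def o2_def g_def real_sqrt_mult)
  finally have le: "sqrt X * sqrt X \<le> (sqrt L * osc fh fH \<T>H) * sqrt X"
    using d0 by (simp add: X1 sum_nonneg mult_ac)
  have "0 \<le> osc fh fH \<T>H"
    unfolding osc_def using o0 by (intro real_sqrt_ge_zero sum_nonneg) (simp add: o2_def g_def)
  then have "0 \<le> sqrt L * osc fh fH \<T>H" using L0 by simp
  moreover have "sqrt X \<ge> 0" using d0 by (simp add: X1 sum_nonneg)
  \<comment> \<open>One factor \<open>sqrt X\<close> cancels unless it is zero, in which case the
    bound is immediate.\<close>
  ultimately have "sqrt X \<le> sqrt L * osc fh fH \<T>H"
    using mult_right_le_imp_le[OF le] by (cases "sqrt X = 0") linarith+
  then show ?thesis by (simp add: l2_norm_def X_def \<delta>_def L_def)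
qed

theorem theorem4p4:
  fixes \<Omega> :: "(real^'n) set" and fam :: fe_family and r :: nat and \<kappa> :: real
  assumes "CARD('n) \<ge> 2"
    and "lipschitz_polyhedral_domain \<Omega>"
    and "r \<ge> 1"
  shows "\<exists>C. \<forall>\<T>h \<T>H f fh fH \<sigma>h uh \<sigma>t ut.
           conforming_triangulation \<Omega> \<T>h \<and> conforming_triangulation \<Omega> \<T>H \<and>
           refines \<T>h \<T>H \<and> shape_regular \<kappa> \<T>h \<and> shape_regular \<kappa> \<T>H \<and>
           L2 \<Omega> f \<and>
           is_L2_proj \<Omega> (Lambda_n_h r \<T>h) f fh \<and> is_L2_proj \<Omega> (Lambda_n_h r \<T>H) f fH \<and>
           discrete_solution fam r \<Omega> \<T>h fH \<sigma>t ut \<and>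
           discrete_solution fam r \<Omega> \<T>h fh \<sigma>h uh
           \<longrightarrow> l2_norm \<Omega> (\<lambda>x. \<sigma>h x - \<sigma>t x) \<le> C * osc fh fH \<T>H"
proof (intro exI allI impI, elim conjE)
  fix \<T>h \<T>H f fh fH \<sigma>h uh \<sigma>t ut
  assume "conforming_triangulation \<Omega> \<T>h" "conforming_triangulation \<Omega> \<T>H"
    "refines \<T>h \<T>H" "shape_regular \<kappa> \<T>h" "L2 \<Omega> f"
    "is_L2_proj \<Omega> (Lambda_n_h r \<T>h) f fh" "is_L2_proj \<Omega> (Lambda_n_h r \<T>H) f fH"
    "discrete_solution fam r \<Omega> \<T>h fH \<sigma>t ut" "discrete_solution fam r \<Omega> \<T>h fh \<sigma>h uh"
  \<comment> \<open>The constant is built from \<open>\<kappa>\<close> and the dimension alone, so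
    it can be fixed before the meshes and the data.\<close>
  then show "l2_norm \<Omega> (\<lambda>x. \<sigma>h x - \<sigma>t x) \<le> sqrt (local_const \<kappa> CARD('n)) * osc fh fH \<T>H"
    by (rule discrete_solution_stability[OF assms])
qed

end
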